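(* Let $p,\tilde p\in L_1(0,1)$ be complex-valued, and let $F$ and $\tilde F$ be the matrices $$F(x)=\begin{pmatrix}0&1&0\\-p&0&1\\0&-p&0\end{pmatrix},\qquad \tilde F(x)=\begin{pmatrix}0&1&0\\-\tilde p&0&1\\0&-\tilde p&0\end{pmatrix},$$ which are associated matrices of $l_3(y)=y'''+(py)'+py'$ and of the analogous expression with $\tilde p$. Assume that both problems $\mathcal L=(F,U,V)$ and $\tilde{\mathcal L}=(\tilde F,U,V)$ satisfy the separation assumption. For $i\in\{1,2\}$ let $\mathfrak S_i$ be the spectrum of the boundary value problem $y^{[3]}=\lambda y$, $U_i(y)=0$, $V_2(y)=V_3(y)=0$, and let $\tilde{\mathfrak S}_i$ be the corresponding spectrum for $\tilde{\mathcal L}$. If $\mathfrak S_1=\tilde{\mathfrak S}_1$ and $\mathfrak S_2=\tilde{\mathfrak S}_2$ (as multisets), then $p=\tilde p$ a.e. on $(0,1)$.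
   Context: General setting (order $n$). Let $F(x)=[f_{k,j}(x)]_{k,j=1}^n$ be a complex-valued matrix function on $[0,1]$ with $f_{k,j}\equiv0$ for $j>k+1$, $f_{k,k+1}\equiv1$, $f_{k,k}\in L_2(0,1)$, $f_{k,j}\in L_1(0,1)$ for $k>j$, and $\operatorname{trace}F\equiv0$. Quasi-derivatives: $y^{[0]}=y$, $y^{[k]}=(y^{[k-1]})'-\sum_{j=1}^k f_{k,j}y^{[j-1]}$, $k=1,\dots,n$. Let $\mathcal D_F=\{y: y^{[k]}\in AC[0,1],\ k=0,\dots,n-1\}$. A solution of $y^{[n]}=\lambda y$ ($\lambda\in\mathbb C$) is a function $y\in\mathcal D_F$ with $y^{[n]}=\lambda y$ a.e. on $(0,1)$. Linear forms: $U_s(y)=y^{[n-s]}(0)$, $V_s(y)=y^{[n-s]}(1)$, $s=1,\dots,n$. Let $C_k(x,\lambda)$, $k=1,\dots,n$, be the solutions with $U_s(C_k)=\delta_{s,k}$. Put $\Delta_{k,k}(\lambda)=\det[V_s(C_r)]_{s,r=k+1}^n$ (with $\Delta_{n,n}\equiv1$), and for $j>k$ let $\Delta_{j,k}(\lambda)$ be obtained from $\Delta_{k,k}(\lambda)$ by replacing $C_j$ by $C_k$; these are entire functions of $\lambda$. Separation assumption: for each $1\le m\le n-1$, $\Delta_{m,m}$ and $\Delta_{m+1,m+1}$ have no common zeros. The problem $\mathcal L=(F,U,V)$ is this data; objects for $\tilde{\mathcal L}$ (built from $\tilde F$ in the same way) carry a tilde. The spectrum of a boundary value problem $y^{[n]}=\lambda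 y$, $W_1(y)=\dots=W_n(y)=0$, where each $W_i$ is one of the forms $U_s,V_s$, is the multiset of zeros, counted with multiplicities, of the entire function $\det[W_i(C_r(\cdot,\lambda))]_{i,r=1}^n$. *)

theory Defs
  imports "HOL-Analysis.Analysis" "HOL-Library.Extended_Nat"
begin

definition AC_on :: "real set \<Rightarrow> (real \<Rightarrow> complex) \<Rightarrow> bool" where
  "AC_on S f \<longleftrightarrow> (\<forall>\<epsilon>>0. \<exists>\<delta>>0. \<forall>(m::nat) (a::nat \<Rightarrow> real) b.
      (\<forall>i<m. a i \<in> S \<and> b i \<in> S \<and> {a i..b i} \<subseteq> S \<and> a i \<le> b i) \<and>
      (\<forall>i<m. \<forall>j<m. i \<noteq> j \<longrightarrow> b i \<le> a j \<or> b j \<le> a i) \<and>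
      (\<Sum>i<m. b i - a i) < \<delta>
      \<longrightarrow> (\<Sum>i<m. norm (f (b i) - f (a i))) < \<epsilon>)"

text \<open>Coefficient matrix F, entries F k j x for 1 \<le> k,j \<le> n (1-based).
  A quasi-derivative system: Y 0 = y and Y k = y^[k] for 1 \<le> k \<le> n-1.
  qsol n F lam Y: y = Y 0 is a solution of y^[n] = lam y, the functions Y 0, ..., Y (n-1)
  are absolutely continuous on [0,1], and a.e. on (0,1):
  Y k = (Y (k-1))' - sum_{j=1}^k f_{k,j} Y (j-1) for k<n, and for k = n this expression
  equals lam * y.\<close>
definition qsol :: "nat \<Rightarrow> (nat \<Rightarrow> nat \<Rightarrow> real \<Rightarrow> complex) \<Rightarrow> complex \<Rightarrow> (nat \<Rightarrow> real \<Rightarrow> complex) \<Rightarrow> bool" where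
  "qsol n F lam Y \<longleftrightarrow>
     (\<forall>k<n. AC_on {0..1} (Y k)) \<and>
     (AE x in lebesgue_on {0<..<1}. \<forall>k\<in>{1..n}. \<exists>D.
        (Y (k - 1) has_vector_derivative D) (at x) \<and>
        (if k < n then Y k x else lam * Y 0 x) = D - (\<Sum>j=1..k. F k j x * Y (j - 1) x))"

datatype bform = U nat | V nat

fun form_val :: "nat \<Rightarrow> bform \<Rightarrow> (nat \<Rightarrow> real \<Rightarrow> complex) \<Rightarrow> complex" where
  "form_val n (U s) Y = Y (n - s) 0"
| "form_val n (V s) Y = Y (n - s) 1"

definition C_form :: "nat \<Rightarrow> (nat \<Rightarrow> nat \<Rightarrow> real \<Rightarrow> complex) \<Rightarrow> complex \<Rightarrow> nat \<Rightarrow> bform \<Rightarrow> complex" where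
  "C_form n F lam r W = (THE v. \<exists>Y. qsol n F lam Y \<and>
       (\<forall>s\<in>{1..n}. form_val n (U s) Y = (if s = r then 1 else 0)) \<and> form_val n W Y = v)"

definition detn :: "nat \<Rightarrow> (nat \<Rightarrow> nat \<Rightarrow> complex) \<Rightarrow> complex" where
  "detn m M = (\<Sum>\<pi> | \<pi> permutes {1..m}. of_int (sign \<pi>) * (\<Prod>i\<in>{1..m}. M i (\<pi> i)))"

definition Delta_kk :: "nat \<Rightarrow> (nat \<Rightarrow> nat \<Rightarrow> real \<Rightarrow> complex) \<Rightarrow> nat \<Rightarrow> complex \<Rightarrow> complex" where
  "Delta_kk n F k lam = detn (n - k) (\<lambda>s r. C_form n F lam (r + k) (V (s + k)))"

definition separation :: "nat \<Rightarrow> (nat \<Rightarrow> nat \<Rightarrow> real \<Rightarrow> complex) \<Rightarrow> bool" where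
  "separation n F \<longleftrightarrow> (\<forall>m\<in>{1..n-1}. \<not> (\<exists>lam. Delta_kk n F m lam = 0 \<and> Delta_kk n F (m+1) lam = 0))"

text \<open>Characteristic determinant det[W_i(C_r(.,lam))]_{i,r=1}^n of the problem
  y^[n] = lam y, W_1(y) = ... = W_n(y) = 0.\<close>
definition char_det :: "nat \<Rightarrow> (nat \<Rightarrow> nat \<Rightarrow> real \<Rightarrow> complex) \<Rightarrow> (nat \<Rightarrow> bform) \<Rightarrow> complex \<Rightarrow> complex" where
  "char_det n F W lam = detn n (\<lambda>i r. C_form n F lam r (W i))"

definition zero_mult :: "(complex \<Rightarrow> complex) \<Rightarrow> complex \<Rightarrow> enat" where
  "zero_mult f z = (if \<forall>k. (deriv ^^ k) f z = 0 then \<infinity>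
                    else enat (LEAST k. (deriv ^^ k) f z \<noteq> 0))"

text \<open>Spectrum as a multiset on complex numbers, given by its multiplicity function.\<close>
definition spectrum_mult :: "nat \<Rightarrow> (nat \<Rightarrow> nat \<Rightarrow> real \<Rightarrow> complex) \<Rightarrow> (nat \<Rightarrow> bform) \<Rightarrow> complex \<Rightarrow> enat" where
  "spectrum_mult n F W = zero_mult (char_det n F W)"

text \<open>The associated matrix of y''' + (p y)' + p y'.\<close>
definition F3 :: "(real \<Rightarrow> complex) \<Rightarrow> nat \<Rightarrow> nat \<Rightarrow> real \<Rightarrow> complex" where
  "F3 p k j x = (if k = 1 \<and> j = 2 then 1
                 else if k = 2 \<and> j = 1 then - p x
                 else if k = 2 \<and> j = 3 then 1
                 else if k = 3 \<and> j = 2 then - p x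
                 else 0)"

definition bc3 :: "nat \<Rightarrow> nat \<Rightarrow> bform" where
  "bc3 i j = (if j = 1 then U i else if j = 2 then V 2 else V 3)"

end

theory Submission
  imports Defs "HOL-Complex_Analysis.Complex_Analysis"
begin

text \<open>The operator \<open>y''' + (p y)' + p y'\<close> is formally skew-adjoint, so the two by two minors of solutions at
  \<open>\<lambda>\<close> are solutions at \<open>- \<lambda>\<close>. Hence, with \<open>\<alpha>\<^sub>k(\<lambda>)\<close> the value at \<open>1\<close> of the solution whose \<open>k\<close>-th
  quasi-derivative is the only nonzero one at \<open>0\<close>, the two spectra are the zeros of \<open>\<alpha>\<^sub>0(- \<lambda>)\<close> and \<open>\<alpha>\<^sub>1(- \<lambda>)\<close>,
  separation says that \<open>\<alpha>\<^sub>0(\<lambda>)\<close> and \<open>\<alpha>\<^sub>0(- \<lambda>)\<close> have no common zero, and there is a Pluecker relation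
  \<open>\<alpha>\<^sub>2(\<lambda>) \<alpha>\<^sub>0(- \<lambda>) + \<alpha>\<^sub>0(\<lambda>) \<alpha>\<^sub>2(- \<lambda>) = \<alpha>\<^sub>1(\<lambda>) \<alpha>\<^sub>1(- \<lambda>)\<close>.

  Writing \<open>\<lambda> = \<rho>\<^sup>3\<close>, the \<open>L\<^sub>1\<close> perturbation is of relative size \<open>1 / \<rho>\<close>, which yields upper bounds for solutions
  and, on suitable circles \<open>\<bar>\<rho>\<bar> = R\<^sub>n\<close>, lower bounds for \<open>\<alpha>\<^sub>0\<close> and \<open>\<alpha>\<^sub>1\<close>. Quotients of functions with equal
  zeros are bounded on these circles, so Liouville's theorem shows that \<open>\<alpha>\<^sub>0\<close> and \<open>\<alpha>\<^sub>1\<close> agree for \<open>p\<close> and \<open>q\<close>.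
  By the Pluecker relation and separation the difference of the two \<open>\<alpha>\<^sub>2\<close>, divided by \<open>\<alpha>\<^sub>0\<close>, is entire; it
  is small on the circles, so the \<open>\<alpha>\<^sub>2\<close> agree as well. Then the Weyl matrices agree, and the transformation
  between the solutions of the two equations is entire in \<open>\<lambda>\<close> with two first-row entries that are small on
  the circles. These entries vanish, and differentiating this at \<open>\<lambda> = 0\<close> gives \<open>p = q\<close>.\<close>

section \<open>Absolutely continuous functions\<close>

text \<open>Since \<open>p\<close> is merely integrable, solutions are handled through absolutely
  continuous functions and integral equations. For \<open>u ^ 3 = \<lambda>\<close>, the sum of
  \<open>u ^ (2 - j)\<close> times the \<open>j\<close>-th quasi-derivative obeys a scalar equation
  with rate \<open>u\<close> in which \<open>p\<close> multiplies quantities one order smaller in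
  \<open>u\<close>; this is the source of the relative error \<open>1 / \<rho>\<close>. Any two of
  the exponents \<open>\<rho> * om ^ i\<close> differ by \<open>sqrt 3 * norm \<rho>\<close> in
  modulus, and the circles make this length a multiple of \<open>2 * pi\<close>. The obstacle at the
  end is exponential growth. The entries of the transformation are entire because they are built
  from initial value solutions, but estimated directly they could grow like a solution at
  \<open>\<lambda>\<close> times one at \<open>- \<lambda>\<close>. Equality of the Weyl matrices
  permits rewriting them through Weyl solutions, which are controlled from the endpoint
  \<open>1\<close>; the growth that remains is cancelled by the lower bounds for
  \<open>\<alpha>\<^sub>0\<close> at \<open>\<lambda>\<close> and at \<open>- \<lambda>\<close>.
  Only powers of \<open>\<rho>\<close> are left, and they are negative for exactly the two entries
  used.\<close>

lemma AC_on_subset: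
  assumes "AC_on S f" "T \<subseteq> S"
  shows "AC_on T f"
  unfolding AC_on_def
proof (intro allI impI)
  fix \<epsilon> :: real assume "\<epsilon> > 0"
  obtain \<delta> where "\<delta> > 0" and \<delta>: "\<forall>(m::nat) (a::nat \<Rightarrow> real) b.
      (\<forall>i<m. a i \<in> S \<and> b i \<in> S \<and> {a i..b i} \<subseteq> S \<and> a i \<le> b i) \<and>
      (\<forall>i<m. \<forall>j<m. i \<noteq> j \<longrightarrow> b i \<le> a j \<or> b j \<le> a i) \<and>
      (\<Sum>i<m. b i - a i) < \<delta> \<longrightarrow> (\<Sum>i<m. norm (f (b i) - f (a i))) < \<epsilon>"
    using assms(1)[unfolded AC_on_def, rule_format, OF \<open>\<epsilon> > 0\<close>] by (elim exE conjE) (rule that)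
  show "\<exists>\<delta>>0. \<forall>(m::nat) (a::nat \<Rightarrow> real) b.
      (\<forall>i<m. a i \<in> T \<and> b i \<in> T \<and> {a i..b i} \<subseteq> T \<and> a i \<le> b i) \<and>
      (\<forall>i<m. \<forall>j<m. i \<noteq> j \<longrightarrow> b i \<le> a j \<or> b j \<le> a i) \<and>
      (\<Sum>i<m. b i - a i) < \<delta> \<longrightarrow> (\<Sum>i<m. norm (f (b i) - f (a i))) < \<epsilon>"
  proof (intro exI[of _ \<delta>] conjI allI impI; (elim conjE)?)
    fix m :: nat and a b :: "nat \<Rightarrow> real"
    assume *: "\<forall>i<m. a i \<in> T \<and> b i \<in> T \<and> {a i..b i} \<subseteq> T \<and> a i \<le> b i"
      "\<forall>i<m. \<forall>j<m. i \<noteq> j \<longrightarrow> b i \<le> a j \<or> b j \<le> a i" "(\<Sum>i<m. b i - a i) < \<delta>"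
    have "a i \<in> S \<and> b i \<in> S \<and> {a i..b i} \<subseteq> S \<and> a i \<le> b i" if "i < m" for i
      using *(1)[rule_format, OF that] assms(2) by auto
    then show "(\<Sum>i<m. norm (f (b i) - f (a i))) < \<epsilon>"
      using \<delta>[rule_format, of m a b] *(2,3) by simp
  qed (rule \<open>\<delta> > 0\<close>)
qed

text \<open>Tagged divisions are sets of pairs rather than numbered lists, so the numbered families
  of \<open>AC_on\<close> are reindexed over an arbitrary type.\<close>

lemma AC_on_finite_family:
  fixes f :: "real \<Rightarrow> complex"
  assumes "AC_on S f" "\<epsilon> > 0"
  shows "\<exists>\<delta>>0. \<forall>I (u::'i \<Rightarrow> real) v. finite I \<and> (\<forall>i\<in>I. u i \<le> v i \<and> {u i..v i} \<subseteq> S) \<and>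
      (\<forall>i\<in>I. \<forall>j\<in>I. i \<noteq> j \<longrightarrow> v i \<le> u j \<or> v j \<le> u i) \<and>
      (\<Sum>i\<in>I. v i - u i) < \<delta> \<longrightarrow> (\<Sum>i\<in>I. norm (f (v i) - f (u i))) < \<epsilon>"
proof -
  obtain \<delta> where "\<delta> > 0" and \<delta>: "\<forall>(m::nat) (a::nat \<Rightarrow> real) b.
      (\<forall>i<m. a i \<in> S \<and> b i \<in> S \<and> {a i..b i} \<subseteq> S \<and> a i \<le> b i) \<and>
      (\<forall>i<m. \<forall>j<m. i \<noteq> j \<longrightarrow> b i \<le> a j \<or> b j \<le> a i) \<and>
      (\<Sum>i<m. b i - a i) < \<delta> \<longrightarrow> (\<Sum>i<m. norm (f (b i) - f (a i))) < \<epsilon>"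
    using assms(1)[unfolded AC_on_def, rule_format, OF assms(2)] by (elim exE conjE) (rule that)
  show ?thesis
  proof (rule exI[of _ \<delta>], intro conjI allI impI; (elim conjE)?)
    fix I and u v :: "'i \<Rightarrow> real"
    assume I: "finite I" "\<forall>i\<in>I. u i \<le> v i \<and> {u i..v i} \<subseteq> S"
      "\<forall>i\<in>I. \<forall>j\<in>I. i \<noteq> j \<longrightarrow> v i \<le> u j \<or> v j \<le> u i" "(\<Sum>i\<in>I. v i - u i) < \<delta>"
    obtain h where h: "bij_betw h {..<card I} I"
      using ex_bij_betw_nat_finite[OF I(1)] unfolding atLeast0LessThan by blast
    have hI: "h n \<in> I" if "n < card I" for n
      using h that by (auto simp: bij_betw_def)
    have "(\<Sum>n<card I. norm (f (v (h n)) - f (u (h n)))) < \<epsilon>"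
    proof (rule \<delta>[rule_format, of "card I" "\<lambda>n. u (h n)" "\<lambda>n. v (h n)"], intro conjI)
      show "\<forall>i<card I. u (h i) \<in> S \<and> v (h i) \<in> S \<and> {u (h i)..v (h i)} \<subseteq> S \<and> u (h i) \<le> v (h i)"
        using I(2) hI by fastforce
      show "\<forall>i<card I. \<forall>j<card I. i \<noteq> j \<longrightarrow> v (h i) \<le> u (h j) \<or> v (h j) \<le> u (h i)"
      proof (intro allI impI)
        fix i j assume ij: "i < card I" "j < card I" "i \<noteq> j"
        then have "h i \<noteq> h j" using h by (auto simp: bij_betw_def inj_on_def)
        then show "v (h i) \<le> u (h j) \<or> v (h j) \<le> u (h i)" using I(3) hI ij by simp
      qed
      show "(\<Sum>i<card I. v (h i) - u (h i)) < \<delta>"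
        using I(4) sum.reindex_bij_betw[OF h, of "\<lambda>i. v i - u i"] by simp
    qed
    then show "(\<Sum>i\<in>I. norm (f (v i) - f (u i))) < \<epsilon>"
      using sum.reindex_bij_betw[OF h, of "\<lambda>i. norm (f (v i) - f (u i))"] by simp
  qed (rule \<open>\<delta> > 0\<close>)
qed

lemma sum_length_le_measure:
  fixes u v :: "'i \<Rightarrow> real"
  assumes "finite I" "\<And>i. i \<in> I \<Longrightarrow> u i \<le> v i \<and> {u i..v i} \<subseteq> G"
    and "\<And>i j. \<lbrakk>i \<in> I; j \<in> I; i \<noteq> j\<rbrakk> \<Longrightarrow> v i \<le> u j \<or> v j \<le> u i"
    and "G \<in> lmeasurable"
  shows "(\<Sum>i\<in>I. v i - u i) \<le> measure lebesgue G"
proof -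
  have "measure lebesgue (\<Union>i\<in>I. {u i..v i}) = (\<Sum>i\<in>I. measure lebesgue {u i..v i})"
  proof (rule measure_negligible_finite_Union_image)
    show "pairwise (\<lambda>i j. negligible ({u i..v i} \<inter> {u j..v j})) I"
    proof (rule pairwiseI)
      fix i j assume "i \<in> I" "j \<in> I" "i \<noteq> j"
      then have "{u i..v i} \<inter> {u j..v j} \<subseteq> {u i, u j}"
        using assms(3)[of i j] assms(2)[of i] assms(2)[of j] by auto
      then show "negligible ({u i..v i} \<inter> {u j..v j})"
        by (rule negligible_subset[rotated]) auto
    qed
  qed (use assms in auto)
  moreover have "measure lebesgue (\<Union>i\<in>I. {u i..v i}) \<le> measure lebesgue G"
    using assms by (intro measure_mono_fmeasurable) auto
  moreover have "(\<Sum>i\<in>I. measure lebesgue {u i..v i}) = (\<Sum>i\<in>I. v i - u i)"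
    using assms(2) by (intro sum.cong) auto
  ultimately show ?thesis by simp
qed

text \<open>Integrability of \<open>g\<close> is part of the conclusion, which is why the gauge
  integral is used. At tags off the null set the gauge is the radius of differentiability; at tags
  in it, the gauge is an open set of measure below the \<open>\<delta>\<close> of absolute
  continuity, so those intervals carry little increment of \<open>f\<close>.\<close>

theorem AC_on_has_integral_derivative:
  fixes f g :: "real \<Rightarrow> complex"
  assumes "a \<le> b" and AC: "AC_on {a..b} f" and "negligible N"
    and deriv: "\<And>x. x \<in> {a<..<b} - N \<Longrightarrow> (f has_vector_derivative g x) (at x)"
  shows "(g has_integral (f b - f a)) {a..b}"
proof -
  define N' where "N' = N \<union> {a, b}"
  have N': "negligible N'"
    unfolding N'_def using assms(3) by (intro negligible_Un) auto
  \<comment> \<open>With value 0 on the exceptional set, which now includes both endpoints, a bad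
    tag contributes nothing but the increment of \<open>f\<close>.\<close>
  define g' where "g' x = (if x \<in> N' then 0 else g x)" for x
  have "(g' has_integral (f b - f a)) {a..b}"
    unfolding has_integral_real
  proof (intro allI impI)
    fix e :: real assume "e > 0"
    define e' where "e' = e / (2 * (b - a + 1))"
    have "e' > 0" "e' * (b - a) < e / 2"
      using \<open>e > 0\<close> \<open>a \<le> b\<close> by (auto simp: e'_def field_simps)
    obtain \<delta> where "\<delta> > 0" and \<delta>:
      "\<forall>I (u::(real \<times> real set) \<Rightarrow> real) v. finite I \<and> (\<forall>i\<in>I. u i \<le> v i \<and> {u i..v i} \<subseteq> {a..b}) \<and>
      (\<forall>i\<in>I. \<forall>j\<in>I. i \<noteq> j \<longrightarrow> v i \<le> u j \<or> v j \<le> u i) \<and>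
      (\<Sum>i\<in>I. v i - u i) < \<delta> \<longrightarrow> (\<Sum>i\<in>I. norm (f (v i) - f (u i))) < e/2"
      using AC_on_finite_family[OF AC half_gt_zero[OF \<open>e > 0\<close>], where 'i = "real \<times> real set"]
      by (elim exE conjE) (rule that)
    obtain G where "open G" "N' \<subseteq> G" and G: "G - N' \<in> lmeasurable" "emeasure lebesgue (G - N') < ennreal \<delta>"
      using sets_lebesgue_outer_open[OF negligible_imp_sets[OF N'] \<open>\<delta> > 0\<close>] by metis
    have "(G - N') \<union> (G \<inter> N') \<in> lmeasurable"
      using G(1) N' negligible_imp_measurable negligible_subset[OF N', of "G \<inter> N'"]
      by (intro fmeasurable.Un) auto
    then have Gm: "G \<in> lmeasurable"
      by (simp add: Un_Diff_Int)
    have "measure lebesgue G = measure lebesgue (G - N')"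
      using N' Gm by (simp add: measure_Diff_null_set negligible_iff_null_sets fmeasurableD)
    then have Gd: "measure lebesgue G < \<delta>"
      using G \<open>\<delta> > 0\<close> by (simp add: emeasure_eq_measure2 ennreal_less_iff)
    have "\<forall>x. \<exists>d>0. x \<in> {a..b} - N' \<longrightarrow>
         (\<forall>y. norm (y-x) < d \<longrightarrow> norm (f y - f x - (y-x) *\<^sub>R g x) \<le> e' * norm (y-x))"
    proof
      fix x
      show "\<exists>d>0. x \<in> {a..b} - N' \<longrightarrow>
         (\<forall>y. norm (y-x) < d \<longrightarrow> norm (f y - f x - (y-x) *\<^sub>R g x) \<le> e' * norm (y-x))"
      proof (cases "x \<in> {a..b} - N'")
        case True
        then have "x \<in> {a<..<b} - N"
          by (auto simp: N'_def)
        from deriv[OF this] show ?thesis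
          unfolding has_vector_derivative_def has_derivative_at_alt
          using \<open>e' > 0\<close> by blast
      qed (auto intro: exI[of _ 1])
    qed
    then obtain d where d: "\<And>x. 0 < d x"
      "\<And>x y. \<lbrakk>x \<in> {a..b} - N'; norm (y-x) < d x\<rbrakk>
                        \<Longrightarrow> norm (f y - f x - (y-x) *\<^sub>R g x) \<le> e' * norm (y-x)"
      by metis
    define \<gamma> where "\<gamma> x = (if x \<in> N' then G else ball x (d x))" for x
    show "\<exists>\<gamma>. gauge \<gamma> \<and> (\<forall>\<D>. \<D> tagged_division_of {a..b} \<and> \<gamma> fine \<D> \<longrightarrow>
            norm ((\<Sum>(x,k)\<in>\<D>. measure lborel k *\<^sub>R g' x) - (f b - f a)) < e)"
    proof (rule exI[of _ \<gamma>], safe)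
      show "gauge \<gamma>"
        using \<open>open G\<close> \<open>N' \<subseteq> G\<close> d(1) by (auto simp: gauge_def \<gamma>_def)
    next
      fix D assume D: "D tagged_division_of {a..b}" and fineD: "\<gamma> fine D"
      have finD: "finite D" using D by auto
      have DK: "\<exists>u v. K = {u..v} \<and> u \<le> v \<and> u \<le> x \<and> x \<le> v \<and> a \<le> u \<and> v \<le> b \<and> {u..v} \<subseteq> \<gamma> x"
        if "(x,K) \<in> D" for x K
      proof -
        obtain u v where K: "K = cbox u v" using tagged_division_ofD(4)[OF D \<open>(x,K) \<in> D\<close>] by blast
        have "x \<in> K" "K \<subseteq> {a..b}" using D \<open>(x,K) \<in> D\<close> by auto
        moreover have "K \<subseteq> \<gamma> x" using fineD that by (auto simp: fine_def)
        ultimately show ?thesis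
          using K by (intro exI[of _ u] exI[of _ v]) auto
      qed
      \<comment> \<open>Degenerate intervals must be left out: disjoint interiors do not order a
        single point against an interval containing it. Their increments vanish anyway.\<close>
      define A where "A = {i \<in> D. fst i \<in> N' \<and> Inf (snd i) < Sup (snd i)}"
      have ba: "b - a = (\<Sum>(x,K)\<in>D. Sup K - Inf K)" "f b - f a = (\<Sum>(x,K)\<in>D. f(Sup K) - f(Inf K))"
        using additive_tagged_division_1[where f= "\<lambda>x. x"] additive_tagged_division_1[where f= f]
            \<open>a \<le> b\<close> D by auto
      have disj: "Sup (snd i) \<le> Inf (snd j) \<or> Sup (snd j) \<le> Inf (snd i)"
        if "i \<in> A" "j \<in> A" "i \<noteq> j" for i j
      proof -
        obtain x K y L where ij: "i = (x,K)" "j = (y,L)" by (metis surj_pair)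
        have inD: "(x,K) \<in> D" "(y,L) \<in> D" using that ij by (auto simp: A_def)
        have "interior K \<inter> interior L = {}"
          using tagged_division_ofD(5)[OF D inD] that(3) ij by blast
        moreover obtain u v u' v' where K: "K = {u..v}" "u \<le> v" "L = {u'..v'}" "u' \<le> v'"
          using DK[OF inD(1)] DK[OF inD(2)] by blast
        ultimately have e: "{u<..<v} \<inter> {u'<..<v'} = {}" by auto
        have lt: "u < v" "u' < v'"
          using that K ij by (auto simp: A_def)
        have "v \<le> u' \<or> v' \<le> u"
        proof (rule ccontr)
          assume "\<not> (v \<le> u' \<or> v' \<le> u)"
          then have "(max u u' + min v v')/2 \<in> {u<..<v} \<inter> {u'<..<v'}"
            using lt by (auto simp: max_def min_def field_simps)
          with e show False by simp
        qed
        then show ?thesis using K ij by simp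
      qed
      have Aint: "Inf (snd i) \<le> Sup (snd i) \<and> {Inf (snd i)..Sup (snd i)} \<subseteq> {a..b} \<and> {Inf (snd i)..Sup (snd i)} \<subseteq> G"
        if "i \<in> A" for i
      proof -
        obtain x K where i: "i = (x,K)" by (metis surj_pair)
        then have "(x,K) \<in> D" "x \<in> N'" using that by (auto simp: A_def)
        then show ?thesis using DK[of x K] i by (auto simp: \<gamma>_def)
      qed
      have finA: "finite A" using finD by (simp add: A_def)
      have Asum: "(\<Sum>i\<in>A. norm (f (Sup (snd i)) - f (Inf (snd i)))) < e/2"
      proof (rule \<delta>[rule_format], intro conjI)
        have "(\<Sum>i\<in>A. Sup (snd i) - Inf (snd i)) \<le> measure lebesgue G"
          by (rule sum_length_le_measure[OF finA]) (use Aint disj Gm in auto)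
        then show "(\<Sum>i\<in>A. Sup (snd i) - Inf (snd i)) < \<delta>" using Gd by simp
      qed (use Aint disj finA in auto)
      let ?h = "\<lambda>i. measure lborel (snd i) *\<^sub>R g' (fst i) - (f (Sup (snd i)) - f (Inf (snd i)))"
      have "norm ((\<Sum>(x,k)\<in>D. measure lborel k *\<^sub>R g' x) - (f b - f a)) = norm (\<Sum>i\<in>D. ?h i)"
        unfolding ba sum_subtractf[symmetric] by (simp add: case_prod_unfold)
      also have "\<dots> \<le> (\<Sum>i\<in>D. norm (?h i))"
        by (rule norm_sum)
      also have "\<dots> \<le> (\<Sum>i\<in>D. e' * (Sup (snd i) - Inf (snd i)) + (if i \<in> A then norm (f (Sup (snd i)) - f (Inf (snd i))) else 0))"
      proof (rule sum_mono)
        fix i assume "i \<in> D"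
        obtain x K where i: "i = (x,K)" by (metis surj_pair)
        obtain u v where K: "K = {u..v}" "u \<le> v" "u \<le> x" "x \<le> v" "a \<le> u" "v \<le> b" "{u..v} \<subseteq> \<gamma> x"
          using DK[of x K] \<open>i \<in> D\<close> i by blast
        show "norm (?h i) \<le> e' * (Sup (snd i) - Inf (snd i)) + (if i \<in> A then norm (f (Sup (snd i)) - f (Inf (snd i))) else 0)"
        proof (cases "x \<in> N'")
          case True
          then have g0: "g' x = 0" by (simp add: g'_def)
          show ?thesis
          proof (cases "u < v")
            case True
            then have "i \<in> A" using K i \<open>i \<in> D\<close> \<open>x \<in> N'\<close> by (auto simp: A_def)
            then show ?thesis using K i g0 \<open>e' > 0\<close> by (simp add: norm_minus_commute)
          qed (use K i g0 \<open>e' > 0\<close> in auto)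
        next
          case False
          then have x: "x \<in> {a..b} - N'" using K by auto
          have "u \<in> \<gamma> x" "v \<in> \<gamma> x"
            using K by auto
          then have "norm (u - x) < d x" "norm (v - x) < d x"
            using False by (auto simp: \<gamma>_def dist_norm)
          then have 1: "norm (f u - f x - (u-x) *\<^sub>R g x) \<le> e' * norm (u-x)"
            "norm (f v - f x - (v-x) *\<^sub>R g x) \<le> e' * norm (v-x)"
            using d(2)[OF x] by auto
          have "(v - u) *\<^sub>R g x - (f v - f u) = (f u - f x - (u-x) *\<^sub>R g x) - (f v - f x - (v-x) *\<^sub>R g x)"
            by (simp add: algebra_simps)
          then have "norm ((v - u) *\<^sub>R g x - (f v - f u)) =
              norm ((f u - f x - (u-x) *\<^sub>R g x) - (f v - f x - (v-x) *\<^sub>R g x))"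
            by (rule arg_cong)
          also have "\<dots> \<le> e' * norm (u-x) + e' * norm (v-x)"
            using norm_triangle_ineq4[of "f u - f x - (u-x) *\<^sub>R g x" "f v - f x - (v-x) *\<^sub>R g x"] 1 by linarith
          also have "\<dots> = e' * (v - u)" using K by (simp add: algebra_simps)
          finally have "norm (?h i) \<le> e' * (v - u)"
            using K i False by (simp add: g'_def)
          moreover have "0 \<le> (if i \<in> A then norm (f (Sup (snd i)) - f (Inf (snd i))) else 0)" by simp
          ultimately show ?thesis using K i by simp
        qed
      qed
      also have "\<dots> = e' * (b - a) + (\<Sum>i\<in>A. norm (f (Sup (snd i)) - f (Inf (snd i))))"
        unfolding sum.distrib ba(1) sum_distrib_left
        using finD by (simp add: case_prod_unfold sum.inter_filter A_def)
      also have "\<dots> < e" using Asum \<open>e' * (b - a) < e / 2\<close> by linarith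
      finally show "norm ((\<Sum>(x,k)\<in>D. measure lborel k *\<^sub>R g' x) - (f b - f a)) < e" .
    qed
  qed
  then show ?thesis
    by (rule has_integral_spike[OF N', rotated]) (auto simp: g'_def)
qed

text \<open>Lebesgue's differentiation theorem: Henstock's lemma bounds the total length of any disjoint family of bad
  intervals, and the Vitali theorem covers the bad points by such a family.\<close>

theorem negligible_not_vector_derivative_integral:
  fixes g :: "real \<Rightarrow> complex"
  assumes int: "g integrable_on {a..b}"
  shows "negligible {x \<in> {a<..<b}. \<not> ((\<lambda>x. integral {a..x} g) has_vector_derivative g x) (at x)}"
proof -
  \<comment> \<open>The point may lie anywhere in the interval, not only at an end, so that the tags
    of a tagged division qualify.\<close>
  define bad where "bad e x u v \<longleftrightarrow> u < v \<and> u \<le> x \<and> x \<le> v \<and> a \<le> u \<and> v \<le> b \<and>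
      e * (v - u) < norm (integral {u..v} g - (v - u) *\<^sub>R g x)" for e x u v :: real
  define E where "E e = {x \<in> {a<..<b}. \<forall>d>0. \<exists>u v. bad e x u v \<and> v - u < d}" for e
  have negE: "negligible (E e)" if "e > 0" for e
    unfolding negligible_outer_le
  proof (intro allI impI)
    fix \<epsilon> :: real assume "\<epsilon> > 0"
    then have "e * \<epsilon> > 0" using that by simp
    \<comment> \<open>Each bad interval has Henstock defect above \<open>e\<close> times its length,
      so a total defect below \<open>e * \<epsilon>\<close> forces total length below
      \<open>\<epsilon>\<close>.\<close>
    obtain \<gamma> where "gauge \<gamma>" and \<gamma>: "\<And>p. \<lbrakk>p tagged_partial_division_of (cbox a b); \<gamma> fine p\<rbrakk> \<Longrightarrow>
             sum (\<lambda>(x,k). norm (measure lborel k *\<^sub>R g x - integral k g)) p < e * \<epsilon>"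
      using Henstock_lemma[OF int[folded box_real(2)] \<open>e * \<epsilon> > 0\<close>] by auto
    define K where "K = {(x,u,v). bad e x u v \<and> {u..v} \<subseteq> \<gamma> x}"
    define c where "c = (\<lambda>(x::real,u::real,v::real). (u + v) / 2)"
    define r where "r = (\<lambda>(x::real,u::real,v::real). (v - u) / 2)"
    have cb: "cball (c (x,u,v)) (r (x,u,v)) = {u..v}" if "u \<le> v" for x u v
      by (auto simp: c_def r_def cball_eq_atLeastAtMost field_simps)
    have r0: "0 < r i" if "i \<in> K" for i
      using that by (auto simp: K_def r_def bad_def)
    have cov: "\<exists>i. i \<in> K \<and> x \<in> cball (c i) (r i) \<and> r i < d" if xE: "x \<in> E e" "0 < d" for x d
    proof -
      have "open (\<gamma> x)" "x \<in> \<gamma> x" using \<open>gauge \<gamma>\<close> by (auto simp: gauge_def)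
      then obtain \<eta> where "\<eta> > 0" "ball x \<eta> \<subseteq> \<gamma> x" using openE by blast
      then have "min d \<eta> > 0" using xE by simp
      then obtain u v where uv: "bad e x u v" "v - u < min d \<eta>"
        using xE unfolding E_def by blast
      have "{u..v} \<subseteq> ball x \<eta>" using uv by (auto simp: bad_def dist_real_def)
      then have "(x,u,v) \<in> K" using uv \<open>ball x \<eta> \<subseteq> \<gamma> x\<close> by (auto simp: K_def)
      moreover have "x \<in> cball (c (x,u,v)) (r (x,u,v))"
        using uv by (subst cb) (auto simp: bad_def)
      moreover have "r (x,u,v) < d" using uv by (auto simp: r_def bad_def)
      ultimately show ?thesis by blast
    qed
    obtain C where C: "countable C" "C \<subseteq> K"
      "pairwise (\<lambda>i j. disjnt (cball (c i) (r i)) (cball (c j) (r j))) C"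
      "negligible (E e - (\<Union>i\<in>C. cball (c i) (r i)))"
      using Vitali_covering_theorem_cballs[of K r "E e" c, OF r0 cov] by blast
    define B where "B i = cball (c i) (r i)" for i
    have fin: "measure lebesgue (\<Union>i\<in>C'. B i) \<le> \<epsilon>" if C': "C' \<subseteq> C" "finite C'" for C'
    proof -
      define p where "p = (\<lambda>(x,u,v). (x, {u..v})) ` C'"
      have inK: "bad e x u v" "{u..v} \<subseteq> \<gamma> x" if "(x,u,v) \<in> C'" for x u v
        using that C' C(2) by (auto simp: K_def)
      have inj: "inj_on (\<lambda>(x,u,v). (x, {u..v})) C'"
      proof -
        have "u < v" if "(x,u,v) \<in> C'" for x u v using inK(1)[OF that] by (simp add: bad_def)
        then show ?thesis by (fastforce simp: inj_on_def)
      qed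
      have "p tagged_partial_division_of cbox a b"
        unfolding tagged_partial_division_of_def
      proof (intro conjI allI impI; (elim conjE)?)
        show "finite p" using C' by (simp add: p_def)
        fix x L assume "(x, L) \<in> p"
        then obtain u v where L: "(x,u,v) \<in> C'" "L = {u..v}" by (auto simp: p_def)
        then show "x \<in> L" "L \<subseteq> cbox a b" "\<exists>a b. L = cbox a b"
          using inK(1)[of x u v] by (auto simp: bad_def)
        fix y M assume "(y, M) \<in> p" and ne: "(x, L) \<noteq> (y, M)"
        then obtain u' v' where M: "(y,u',v') \<in> C'" "M = {u'..v'}" by (auto simp: p_def)
        have "(x,u,v) \<noteq> (y,u',v')" using ne L M by auto
        then have "disjnt (cball (c (x,u,v)) (r (x,u,v))) (cball (c (y,u',v')) (r (y,u',v')))"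
          using C(3) C'(1) L(1) M(1) by (meson pairwiseD subsetD)
        then have "L \<inter> M = {}"
          using inK(1)[OF L(1)] inK(1)[OF M(1)] L M by (simp add: cb disjnt_def bad_def)
        then show "interior L \<inter> interior M = {}"
          using interior_subset by blast
      qed
      moreover have "\<gamma> fine p"
        using inK(2) by (auto simp: fine_def p_def)
      ultimately have "sum (\<lambda>(x,k). norm (measure lborel k *\<^sub>R g x - integral k g)) p < e * \<epsilon>"
        by (rule \<gamma>)
      moreover have "sum (\<lambda>(x,k). norm (measure lborel k *\<^sub>R g x - integral k g)) p
          = (\<Sum>(x,u,v)\<in>C'. norm (measure lborel {u..v} *\<^sub>R g x - integral {u..v} g))"
        unfolding p_def by (subst sum.reindex[OF inj]) (auto intro!: sum.cong)
      moreover have "(\<Sum>(x,u,v)\<in>C'. e * (v - u)) \<le> (\<Sum>(x,u,v)\<in>C'. norm (measure lborel {u..v} *\<^sub>R g x - integral {u..v} g))"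
        using inK(1) by (intro sum_mono) (force simp: bad_def norm_minus_commute)
      moreover have "(\<Sum>(x,u,v)\<in>C'. e * (v - u)) = e * (\<Sum>(x,u,v)\<in>C'. v - u)"
        by (simp add: sum_distrib_left case_prod_unfold)
      ultimately have "e * (\<Sum>(x,u,v)\<in>C'. v - u) < e * \<epsilon>" by linarith
      then have "(\<Sum>(x,u,v)\<in>C'. v - u) < \<epsilon>" using \<open>e > 0\<close> by simp
      moreover have "measure lebesgue (\<Union>i\<in>C'. B i) \<le> (\<Sum>i\<in>C'. measure lebesgue (B i))"
        using C' by (intro measure_UNION_le) (auto simp: B_def)
      moreover have "(\<Sum>i\<in>C'. measure lebesgue (B i)) = (\<Sum>(x,u,v)\<in>C'. v - u)"
        using inK(1) by (intro sum.cong) (force simp: B_def cb bad_def)+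
      ultimately show ?thesis by linarith
    qed
    have Bab: "(\<Union>i\<in>C. B i) \<subseteq> {a..b}"
    proof
      fix t assume "t \<in> (\<Union>i\<in>C. B i)"
      then obtain x u v where xuv: "(x,u,v) \<in> C" "t \<in> B (x,u,v)" by auto
      then have bd: "bad e x u v" using C(2) by (auto simp: K_def)
      then have "B (x,u,v) = {u..v}" unfolding B_def by (intro cb) (simp add: bad_def)
      then show "t \<in> {a..b}" using xuv bd by (auto simp: bad_def)
    qed
    have Um: "(\<Union>i\<in>C. B i) \<in> lmeasurable"
    proof (rule fmeasurableI2)
      show "{a..b} \<in> lmeasurable" by simp
      show "(\<Union>i\<in>C. B i) \<in> sets lebesgue"
        using C(1) by (intro sets.countable_UN') (auto simp: B_def)
    qed (rule Bab)
    have mU: "measure lebesgue (\<Union>i\<in>C. B i) \<le> \<epsilon>"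
    proof (rule field_le_epsilon)
      fix e' :: real assume "e' > 0"
      have fin': "\<And>D'. \<lbrakk>D' \<subseteq> B ` C; finite D'\<rbrakk> \<Longrightarrow> measure lebesgue (\<Union>D') \<le> \<epsilon>"
        using fin by (metis finite_subset_image)
      have cC: "countable (B ` C)" using C(1) by simp
      have mB: "d \<in> lmeasurable" if "d \<in> B ` C" for d
        using that by (auto simp: B_def)
      obtain D' where D': "D' \<subseteq> B ` C" "finite D'"
        "measure lebesgue (\<Union>(B ` C)) - e' < measure lebesgue (\<Union>D')"
        using measure_countable_Union_approachable[OF cC \<open>e' > 0\<close> mB fin'] by metis
      moreover have "measure lebesgue (\<Union>D') \<le> \<epsilon>"
        using D' fin by (metis finite_subset_image)
      ultimately show "measure lebesgue (\<Union>i\<in>C. B i) \<le> \<epsilon> + e'" by linarith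
    qed
    let ?N = "E e - (\<Union>i\<in>C. cball (c i) (r i))"
    show "\<exists>T. E e \<subseteq> T \<and> T \<in> lmeasurable \<and> measure lebesgue T \<le> \<epsilon>"
    proof (intro exI[of _ "?N \<union> (\<Union>i\<in>C. B i)"] conjI)
      show "E e \<subseteq> ?N \<union> (\<Union>i\<in>C. B i)" by (auto simp: B_def)
      show "?N \<union> (\<Union>i\<in>C. B i) \<in> lmeasurable"
        using C(4) Um negligible_imp_measurable by (intro fmeasurable.Un) auto
      have "measure lebesgue (?N \<union> (\<Union>i\<in>C. B i)) \<le> measure lebesgue ?N + measure lebesgue (\<Union>i\<in>C. B i)"
        using C(4) Um negligible_imp_measurable by (intro measure_Un_le) (auto simp: fmeasurableD)
      then show "measure lebesgue (?N \<union> (\<Union>i\<in>C. B i)) \<le> \<epsilon>"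
        using mU negligible_imp_measure0[OF C(4)] by linarith
    qed
  qed
  have sub: "{x \<in> {a<..<b}. \<not> ((\<lambda>x. integral {a..x} g) has_vector_derivative g x) (at x)}
     \<subseteq> (\<Union>n. E (1 / real (Suc n)))"
  proof (safe, rule ccontr)
    fix x assume x: "x \<in> {a<..<b}" and nE: "x \<notin> (\<Union>n. E (1 / real (Suc n)))"
      and nd: "\<not> ((\<lambda>x. integral {a..x} g) has_vector_derivative g x) (at x)"
    have "((\<lambda>x. integral {a..x} g) has_vector_derivative g x) (at x)"
      unfolding has_vector_derivative_def has_derivative_at_alt
    proof (intro conjI allI impI)
      show "bounded_linear (\<lambda>h. h *\<^sub>R g x)" by (rule bounded_linear_scaleR_left)
      fix e :: real assume "e > 0"
      obtain n where n: "1 / real (Suc n) < e" using nat_approx_posE[OF \<open>e > 0\<close>] by blast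
      obtain d where "d > 0" and d: "\<And>u v. bad (1 / real (Suc n)) x u v \<Longrightarrow> \<not> (v - u < d)"
      proof -
        have "x \<notin> E (1 / real (Suc n))" using nE by blast
        then have "\<exists>d>0. \<forall>u v. \<not> (bad (1 / real (Suc n)) x u v \<and> v - u < d)"
          using x by (simp add: E_def)
        then show ?thesis using that by blast
      qed
      define d' where "d' = min d (min (x - a) (b - x))"
      have ub: "norm (integral {u..v} g - (v - u) *\<^sub>R g x) \<le> e * (v - u)"
        if "u < v" "u \<le> x" "x \<le> v" "a \<le> u" "v \<le> b" "v - u < d" for u v
      proof -
        have "\<not> bad (1 / real (Suc n)) x u v" using d that by blast
        then have "norm (integral {u..v} g - (v - u) *\<^sub>R g x) \<le> 1 / real (Suc n) * (v - u)"
          using that unfolding bad_def by auto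
        also have "\<dots> \<le> e * (v - u)" using n that by (intro mult_right_mono) auto
        finally show ?thesis .
      qed
      show "\<exists>d>0. \<forall>y. norm (y - x) < d \<longrightarrow>
           norm (integral {a..y} g - integral {a..x} g - (y - x) *\<^sub>R g x) \<le> e * norm (y - x)"
      proof (intro exI[of _ d'] conjI allI impI)
        show "d' > 0" using \<open>d > 0\<close> x by (auto simp: d'_def)
        fix y assume y: "norm (y - x) < d'"
        have intsub: "g integrable_on {a..t}" if "t \<le> b" for t
          using that by (intro integrable_subinterval_real[OF int]) auto
        consider "y = x" | "x < y" | "y < x" by linarith
        then show "norm (integral {a..y} g - integral {a..x} g - (y - x) *\<^sub>R g x) \<le> e * norm (y - x)"
        proof cases
          case 2
          then have "integral {a..x} g + integral {x..y} g = integral {a..y} g"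
            using x y by (intro Henstock_Kurzweil_Integration.integral_combine intsub) (auto simp: d'_def)
          then have "integral {a..y} g - integral {a..x} g - (y - x) *\<^sub>R g x = integral {x..y} g - (y - x) *\<^sub>R g x"
            by (simp add: algebra_simps)
          then show ?thesis using ub[of x y] 2 x y by (auto simp: d'_def)
        next
          case 3
          then have "integral {a..y} g + integral {y..x} g = integral {a..x} g"
            using x y by (intro Henstock_Kurzweil_Integration.integral_combine intsub) (auto simp: d'_def)
          then have eq: "integral {a..y} g - integral {a..x} g - (y - x) *\<^sub>R g x = - (integral {y..x} g - (x - y) *\<^sub>R g x)"
            by (simp add: algebra_simps)
          show ?thesis unfolding eq norm_minus_cancel using ub[of y x] 3 x y by (auto simp: d'_def)
        qed simp
      qed
    qed
    with nd show False by blast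
  qed
  show ?thesis
    by (rule negligible_subset[OF _ sub]) (intro negligible_countable_Union, auto intro: negE)
qed

text \<open>The excess of \<open>norm (g x)\<close> over the level \<open>n\<close> tends to 0 in L1
  by dominated convergence. The splitting is used twice: for absolute continuity of integrals and
  for the contraction property of the Volterra operator.\<close>

lemma absolutely_integrable_truncation:
  fixes g :: "real \<Rightarrow> complex"
  assumes g: "g absolutely_integrable_on {a..b}" and "\<epsilon> > 0"
  obtains B h where "B > 0" "h integrable_on {a..b}" "\<And>x. 0 \<le> h x" "integral {a..b} h < \<epsilon>"
    "\<And>x. norm (g x) \<le> B + h x"
proof -
  define h where "h n x = max (norm (g x) - real n) 0" for n x
  have ng: "(\<lambda>x. norm (g x)) absolutely_integrable_on {a..b}"
    using absolutely_integrable_norm[OF g] by (simp add: o_def)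
  have hi: "h n integrable_on {a..b}" for n
  proof -
    have "(\<lambda>x. norm (g x) - real n) absolutely_integrable_on {a..b}"
      using ng by (intro set_integral_diff(1)) auto
    then have "(\<lambda>x. max (norm (g x) - real n) 0) absolutely_integrable_on {a..b}"
      by (intro absolutely_integrable_max_1) auto
    then show ?thesis unfolding h_def by (rule set_lebesgue_integral_eq_integral(1))
  qed
  have "(\<lambda>n. integral {a..b} (h n)) \<longlonglongrightarrow> integral {a..b} (\<lambda>x. 0::real)"
  proof (rule dominated_convergence[where h = "\<lambda>x. norm (g x)"])
    show "(\<lambda>x. norm (g x)) integrable_on {a..b}"
      using ng by (rule set_lebesgue_integral_eq_integral(1))
    show "norm (h n x) \<le> norm (g x)" for n x by (auto simp: h_def)
    fix x
    obtain N where "norm (g x) \<le> real N" using real_arch_simple by blast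
    then have "\<forall>n\<ge>N. h n x = 0" by (auto simp: h_def)
    then show "(\<lambda>n. h n x) \<longlonglongrightarrow> 0"
      by (intro tendsto_eventually) (auto simp: eventually_sequentially)
  qed (rule hi)
  then have "\<forall>\<^sub>F n in sequentially. integral {a..b} (h n) < \<epsilon>"
    using \<open>\<epsilon> > 0\<close> by (intro order_tendstoD) auto
  then obtain n where n: "integral {a..b} (h n) < \<epsilon>"
    by (auto simp: eventually_sequentially)
  show ?thesis
  proof (rule that[of "real (Suc n)" "h n"])
    show "norm (g x) \<le> real (Suc n) + h n x" for x by (auto simp: h_def)
  qed (use hi n in \<open>auto simp: h_def\<close>)
qed

lemma AC_on_integral:
  fixes g :: "real \<Rightarrow> complex"
  assumes g: "g absolutely_integrable_on {a..b}"
  shows "AC_on {a..b} (\<lambda>x. c + integral {a..x} g)"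
  unfolding AC_on_def
proof (intro allI impI)
  fix \<epsilon> :: real assume "\<epsilon> > 0"
  obtain B h where B: "B > 0" "h integrable_on {a..b}" "\<And>x. 0 \<le> h x" "integral {a..b} h < \<epsilon>/2"
    "\<And>x. norm (g x) \<le> B + h x"
    using absolutely_integrable_truncation[OF g half_gt_zero[OF \<open>\<epsilon> > 0\<close>]] by metis
  have gi: "g integrable_on {a..b}" using g by (rule set_lebesgue_integral_eq_integral(1))
  show "\<exists>\<delta>>0. \<forall>(m::nat) (u::nat \<Rightarrow> real) v.
      (\<forall>i<m. u i \<in> {a..b} \<and> v i \<in> {a..b} \<and> {u i..v i} \<subseteq> {a..b} \<and> u i \<le> v i) \<and>
      (\<forall>i<m. \<forall>j<m. i \<noteq> j \<longrightarrow> v i \<le> u j \<or> v j \<le> u i) \<and>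
      (\<Sum>i<m. v i - u i) < \<delta>
      \<longrightarrow> (\<Sum>i<m. norm ((c + integral {a..v i} g) - (c + integral {a..u i} g))) < \<epsilon>"
  proof (intro exI[of _ "\<epsilon> / (2 * B)"] conjI allI impI; (elim conjE)?)
    show "\<epsilon> / (2 * B) > 0" using B \<open>\<epsilon> > 0\<close> by simp
    fix m :: nat and u v :: "nat \<Rightarrow> real"
    assume uv: "\<forall>i<m. u i \<in> {a..b} \<and> v i \<in> {a..b} \<and> {u i..v i} \<subseteq> {a..b} \<and> u i \<le> v i"
      and dis: "\<forall>i<m. \<forall>j<m. i \<noteq> j \<longrightarrow> v i \<le> u j \<or> v j \<le> u i"
      and small: "(\<Sum>i<m. v i - u i) < \<epsilon> / (2 * B)"
    \<comment> \<open>Open intervals are used so that at most one summand is nonzero at any point,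
      even where two intervals share an endpoint.\<close>
    define H where "H i x = (if x \<in> {u i<..<v i} then h x else 0)" for i x
    have hi: "h integrable_on {u i..v i}" if "i < m" for i
      using that uv by (intro integrable_subinterval_real[OF B(2)]) auto
    have Hi: "(H i has_integral integral {u i..v i} h) {a..b}" if "i < m" for i
    proof -
      have "(h has_integral integral {u i..v i} h) {u i<..<v i}"
        using hi[OF that] by (simp add: has_integral_Icc_iff_Ioo[symmetric] integrable_integral)
      then show ?thesis unfolding H_def
        by (subst has_integral_restrict) (use uv that in auto)
    qed
    have each: "norm ((c + integral {a..v i} g) - (c + integral {a..u i} g)) \<le> B * (v i - u i) + integral {u i..v i} h"
      if i: "i < m" for i
    proof -
      have "integral {a..u i} g + integral {u i..v i} g = integral {a..v i} g"
        using i uv by (intro Henstock_Kurzweil_Integration.integral_combine integrable_subinterval_real[OF gi]) auto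
      then have "(c + integral {a..v i} g) - (c + integral {a..u i} g) = integral {u i..v i} g"
        by (simp add: algebra_simps)
      then have "norm ((c + integral {a..v i} g) - (c + integral {a..u i} g)) = norm (integral {u i..v i} g)"
        by (rule arg_cong)
      also have "\<dots> \<le> integral {u i..v i} (\<lambda>x. B + h x)"
        using i uv hi[OF i] B(5)
        by (intro integral_norm_bound_integral integrable_subinterval_real[OF gi] integrable_add) auto
      also have "\<dots> = B * (v i - u i) + integral {u i..v i} h"
        using i uv hi[OF i] by (subst integral_add) auto
      finally show ?thesis .
    qed
    have "(\<Sum>i<m. integral {u i..v i} h) \<le> integral {a..b} h"
    proof (rule has_integral_le)
      show "((\<lambda>x. \<Sum>i<m. H i x) has_integral (\<Sum>i<m. integral {u i..v i} h)) {a..b}"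
        using Hi by (intro has_integral_sum) auto
      show "(h has_integral integral {a..b} h) {a..b}" using B(2) by (rule integrable_integral)
      fix x assume "x \<in> {a..b}"
      show "(\<Sum>i<m. H i x) \<le> h x"
      proof (cases "\<exists>i<m. x \<in> {u i<..<v i}")
        case True
        then obtain i where i: "i < m" "x \<in> {u i<..<v i}" by blast
        have "H j x = 0" if "j \<in> {..<m} - {i}" for j
          using i that dis[rule_format, of i j] by (auto simp: H_def)
        then have "(\<Sum>i<m. H i x) = H i x"
          using i by (subst sum.remove[of _ i]) auto
        then show ?thesis using i by (simp add: H_def)
      next
        case False
        then have "(\<Sum>i<m. H i x) = 0" by (intro sum.neutral) (auto simp: H_def)
        then show ?thesis using B(3) by simp
      qed
    qed
    moreover have "B * (\<Sum>i<m. v i - u i) < \<epsilon> / 2"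
      using small B(1) by (simp add: field_simps)
    moreover have "(\<Sum>i<m. B * (v i - u i) + integral {u i..v i} h) =
        B * (\<Sum>i<m. v i - u i) + (\<Sum>i<m. integral {u i..v i} h)"
      by (simp add: sum.distrib sum_distrib_left)
    ultimately have "(\<Sum>i<m. B * (v i - u i) + integral {u i..v i} h) < \<epsilon>"
      using B(4) by linarith
    moreover have "(\<Sum>i<m. norm ((c + integral {a..v i} g) - (c + integral {a..u i} g)))
       \<le> (\<Sum>i<m. B * (v i - u i) + integral {u i..v i} h)"
      using each by (intro sum_mono) auto
    ultimately show "(\<Sum>i<m. norm ((c + integral {a..v i} g) - (c + integral {a..u i} g))) < \<epsilon>"
      by linarith
  qed
qed

text \<open>Common source of the closure properties: sums, products and functions that agree on the
  set all have increments controlled in this way.\<close>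

lemma AC_on_dominated:
  assumes f: "AC_on S f" and g: "AC_on S g" and "K > 0"
    and h: "\<And>x y. \<lbrakk>x \<in> S; y \<in> S\<rbrakk> \<Longrightarrow> norm (h y - h x) \<le> K * (norm (f y - f x) + norm (g y - g x))"
  shows "AC_on S h"
  unfolding AC_on_def
proof (intro allI impI)
  fix \<epsilon> :: real assume "\<epsilon> > 0"
  then have e: "\<epsilon> / (2 * K) > 0" using \<open>K > 0\<close> by simp
  obtain \<delta>1 where "\<delta>1 > 0" and \<delta>1: "\<forall>(m::nat) (a::nat \<Rightarrow> real) b.
      (\<forall>i<m. a i \<in> S \<and> b i \<in> S \<and> {a i..b i} \<subseteq> S \<and> a i \<le> b i) \<and>
      (\<forall>i<m. \<forall>j<m. i \<noteq> j \<longrightarrow> b i \<le> a j \<or> b j \<le> a i) \<and>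
      (\<Sum>i<m. b i - a i) < \<delta>1 \<longrightarrow> (\<Sum>i<m. norm (f (b i) - f (a i))) < \<epsilon> / (2 * K)"
    using f[unfolded AC_on_def, rule_format, OF e] by (elim exE conjE) (rule that)
  obtain \<delta>2 where "\<delta>2 > 0" and \<delta>2: "\<forall>(m::nat) (a::nat \<Rightarrow> real) b.
      (\<forall>i<m. a i \<in> S \<and> b i \<in> S \<and> {a i..b i} \<subseteq> S \<and> a i \<le> b i) \<and>
      (\<forall>i<m. \<forall>j<m. i \<noteq> j \<longrightarrow> b i \<le> a j \<or> b j \<le> a i) \<and>
      (\<Sum>i<m. b i - a i) < \<delta>2 \<longrightarrow> (\<Sum>i<m. norm (g (b i) - g (a i))) < \<epsilon> / (2 * K)"
    using g[unfolded AC_on_def, rule_format, OF e] by (elim exE conjE) (rule that)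
  show "\<exists>\<delta>>0. \<forall>(m::nat) (a::nat \<Rightarrow> real) b.
      (\<forall>i<m. a i \<in> S \<and> b i \<in> S \<and> {a i..b i} \<subseteq> S \<and> a i \<le> b i) \<and>
      (\<forall>i<m. \<forall>j<m. i \<noteq> j \<longrightarrow> b i \<le> a j \<or> b j \<le> a i) \<and>
      (\<Sum>i<m. b i - a i) < \<delta> \<longrightarrow> (\<Sum>i<m. norm (h (b i) - h (a i))) < \<epsilon>"
  proof (intro exI[of _ "min \<delta>1 \<delta>2"] conjI allI impI; (elim conjE)?)
    show "min \<delta>1 \<delta>2 > 0" using \<open>\<delta>1 > 0\<close> \<open>\<delta>2 > 0\<close> by simp
    fix m :: nat and a b :: "nat \<Rightarrow> real"
    assume *: "\<forall>i<m. a i \<in> S \<and> b i \<in> S \<and> {a i..b i} \<subseteq> S \<and> a i \<le> b i"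
      "\<forall>i<m. \<forall>j<m. i \<noteq> j \<longrightarrow> b i \<le> a j \<or> b j \<le> a i" "(\<Sum>i<m. b i - a i) < min \<delta>1 \<delta>2"
    have 1: "(\<Sum>i<m. norm (f (b i) - f (a i))) < \<epsilon> / (2 * K)"
      using \<delta>1[rule_format, of m a b] * by simp
    have 2: "(\<Sum>i<m. norm (g (b i) - g (a i))) < \<epsilon> / (2 * K)"
      using \<delta>2[rule_format, of m a b] * by simp
    have "(\<Sum>i<m. norm (h (b i) - h (a i))) \<le> (\<Sum>i<m. K * (norm (f (b i) - f (a i)) + norm (g (b i) - g (a i))))"
      using * h by (intro sum_mono) auto
    also have "\<dots> = K * ((\<Sum>i<m. norm (f (b i) - f (a i))) + (\<Sum>i<m. norm (g (b i) - g (a i))))"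
      by (simp add: sum.distrib[symmetric] sum_distrib_left)
    also have "\<dots> < K * (\<epsilon> / (2 * K) + \<epsilon> / (2 * K))"
      using 1 2 \<open>K > 0\<close> by (intro mult_strict_left_mono add_strict_mono)
    also have "\<dots> = \<epsilon>" using \<open>K > 0\<close> by (simp add: field_simps)
    finally show "(\<Sum>i<m. norm (h (b i) - h (a i))) < \<epsilon>" .
  qed
qed

lemma AC_on_imp_continuous_on:
  assumes "AC_on {a..b} f"
  shows "continuous_on {a..b} f"
  unfolding continuous_on_iff
proof (intro ballI allI impI)
  fix x e :: real assume "x \<in> {a..b}" "e > 0"
  obtain \<delta> where "\<delta> > 0" and \<delta>: "\<forall>I (u::unit \<Rightarrow> real) v. finite I \<and> (\<forall>i\<in>I. u i \<le> v i \<and> {u i..v i} \<subseteq> {a..b}) \<and>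
      (\<forall>i\<in>I. \<forall>j\<in>I. i \<noteq> j \<longrightarrow> v i \<le> u j \<or> v j \<le> u i) \<and>
      (\<Sum>i\<in>I. v i - u i) < \<delta> \<longrightarrow> (\<Sum>i\<in>I. norm (f (v i) - f (u i))) < e"
    using AC_on_finite_family[OF assms \<open>e > 0\<close>, where 'i = unit] by (elim exE conjE) (rule that)
  show "\<exists>d>0. \<forall>y\<in>{a..b}. dist y x < d \<longrightarrow> dist (f y) (f x) < e"
  proof (intro exI[of _ \<delta>] conjI ballI impI)
    fix y assume y: "y \<in> {a..b}" "dist y x < \<delta>"
    have "norm (f (max x y) - f (min x y)) < e"
      using \<delta>[rule_format, of "{()}" "\<lambda>_. min x y" "\<lambda>_. max x y"] y \<open>x \<in> {a..b}\<close>
      by (auto simp: dist_real_def max_def min_def split: if_splits)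
    then show "dist (f y) (f x) < e"
      by (auto simp: max_def min_def dist_norm norm_minus_commute split: if_splits)
  qed (rule \<open>\<delta> > 0\<close>)
qed

lemma AC_on_add: "AC_on S f \<Longrightarrow> AC_on S g \<Longrightarrow> AC_on S (\<lambda>x. f x + g x)"
proof (erule AC_on_dominated[where K = 1], assumption)
  fix x y
  have "f y + g y - (f x + g x) = (f y - f x) + (g y - g x)" by simp
  then show "norm (f y + g y - (f x + g x)) \<le> 1 * (norm (f y - f x) + norm (g y - g x))"
    using norm_triangle_ineq[of "f y - f x" "g y - g x"] by (simp only: mult_1)
qed simp

lemma AC_on_mult:
  assumes f: "AC_on {a..b} f" and g: "AC_on {a..b} g"
  shows "AC_on {a..b} (\<lambda>x. f x * g x)"
proof -
  have "compact (f ` {a..b})" "compact (g ` {a..b})"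
    using assms by (auto intro!: compact_continuous_image AC_on_imp_continuous_on)
  then have "bounded (f ` {a..b})" "bounded (g ` {a..b})"
    by (auto intro: compact_imp_bounded)
  then obtain M1 M2 where M: "\<And>x. x \<in> {a..b} \<Longrightarrow> norm (f x) \<le> M1" "\<And>x. x \<in> {a..b} \<Longrightarrow> norm (g x) \<le> M2"
    unfolding bounded_iff by blast
  define K where "K = max 1 (max M1 M2)"
  show ?thesis
  proof (rule AC_on_dominated[OF f g, of K])
    show "K > 0" by (simp add: K_def)
    fix x y assume xy: "x \<in> {a..b}" "y \<in> {a..b}"
    have "f y * g y - f x * g x = (f y - f x) * g y + f x * (g y - g x)"
      by (simp add: algebra_simps)
    then have "norm (f y * g y - f x * g x) \<le> norm (f y - f x) * norm (g y) + norm (f x) * norm (g y - g x)"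
      using norm_triangle_ineq[of "(f y - f x) * g y" "f x * (g y - g x)"] by (simp add: norm_mult)
    also have "\<dots> \<le> norm (f y - f x) * K + K * norm (g y - g x)"
      using M xy by (intro add_mono mult_left_mono mult_right_mono) (auto simp: K_def le_max_iff_disj)
    finally show "norm (f y * g y - f x * g x) \<le> K * (norm (f y - f x) + norm (g y - g x))"
      by (simp add: algebra_simps)
  qed
qed

lemma AC_on_reflect:
  assumes "AC_on {0..1} f"
  shows "AC_on {0..1} (\<lambda>x. f (1 - x))"
  unfolding AC_on_def
proof (intro allI impI)
  fix \<epsilon> :: real assume "\<epsilon> > 0"
  obtain \<delta> where "\<delta> > 0" and \<delta>: "\<forall>(m::nat) (a::nat \<Rightarrow> real) b.
      (\<forall>i<m. a i \<in> {0..1} \<and> b i \<in> {0..1} \<and> {a i..b i} \<subseteq> {0..1} \<and> a i \<le> b i) \<and>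
      (\<forall>i<m. \<forall>j<m. i \<noteq> j \<longrightarrow> b i \<le> a j \<or> b j \<le> a i) \<and>
      (\<Sum>i<m. b i - a i) < \<delta> \<longrightarrow> (\<Sum>i<m. norm (f (b i) - f (a i))) < \<epsilon>"
    using assms(1)[unfolded AC_on_def, rule_format, OF \<open>\<epsilon> > 0\<close>] by (elim exE conjE) (rule that)
  show "\<exists>\<delta>>0. \<forall>(m::nat) (a::nat \<Rightarrow> real) b.
      (\<forall>i<m. a i \<in> {0..1} \<and> b i \<in> {0..1} \<and> {a i..b i} \<subseteq> {0..1} \<and> a i \<le> b i) \<and>
      (\<forall>i<m. \<forall>j<m. i \<noteq> j \<longrightarrow> b i \<le> a j \<or> b j \<le> a i) \<and>
      (\<Sum>i<m. b i - a i) < \<delta> \<longrightarrow> (\<Sum>i<m. norm (f (1 - b i) - f (1 - a i))) < \<epsilon>"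
  proof (intro exI[of _ \<delta>] conjI allI impI; (elim conjE)?)
    fix m :: nat and a b :: "nat \<Rightarrow> real"
    assume *: "\<forall>i<m. a i \<in> {0..1} \<and> b i \<in> {0..1} \<and> {a i..b i} \<subseteq> {0..1} \<and> a i \<le> b i"
      "\<forall>i<m. \<forall>j<m. i \<noteq> j \<longrightarrow> b i \<le> a j \<or> b j \<le> a i" "(\<Sum>i<m. b i - a i) < \<delta>"
    have "(\<Sum>i<m. norm (f (1 - a i) - f (1 - b i))) < \<epsilon>"
    proof (rule \<delta>[rule_format, of m "\<lambda>i. 1 - b i" "\<lambda>i. 1 - a i"], intro conjI)
      show "\<forall>i<m. 1 - b i \<in> {0..1} \<and> 1 - a i \<in> {0..1} \<and> {1 - b i..1 - a i} \<subseteq> {0..1} \<and> 1 - b i \<le> 1 - a i"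
        using *(1) by auto
      show "\<forall>i<m. \<forall>j<m. i \<noteq> j \<longrightarrow> 1 - a i \<le> 1 - b j \<or> 1 - a j \<le> 1 - b i"
        using *(2) by fastforce
      show "(\<Sum>i<m. 1 - a i - (1 - b i)) < \<delta>" using *(3) by simp
    qed
    then show "(\<Sum>i<m. norm (f (1 - b i) - f (1 - a i))) < \<epsilon>"
      by (simp add: norm_minus_commute)
  qed (rule \<open>\<delta> > 0\<close>)
qed

section \<open>Calculus of absolutely continuous functions with a prescribed derivative almost
  everywhere\<close>

lemma AE_lebesgue_on_iff_negligible:
  assumes "S \<in> sets lebesgue"
  shows "(AE x in lebesgue_on S. P x) \<longleftrightarrow> (\<exists>N. negligible N \<and> (\<forall>x\<in>S - N. P x))"
proof -
  have "(AE x in lebesgue_on S. P x) \<longleftrightarrow> (AE x in lebesgue. x \<in> S \<longrightarrow> P x)"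
    using assms by (subst AE_restrict_space_iff) auto
  also have "\<dots> \<longleftrightarrow> (\<exists>N. negligible N \<and> {x. \<not> (x \<in> S \<longrightarrow> P x)} \<subseteq> N)"
    by (auto simp: eventually_ae_filter negligible_iff_null_sets)
  also have "\<dots> \<longleftrightarrow> (\<exists>N. negligible N \<and> (\<forall>x\<in>S - N. P x))"
    by (intro ex_cong1) auto
  finally show ?thesis .
qed

text \<open>The derivative is a named function, constrained only off a null set of the open
  interval. Thus it may contain \<open>p\<close>, and right-hand sides can be rewritten
  algebraically with \<open>ac_deriv_cong\<close>.\<close>

definition ac_deriv :: "(real \<Rightarrow> complex) \<Rightarrow> (real \<Rightarrow> complex) \<Rightarrow> bool" where
  "ac_deriv f g \<longleftrightarrow> AC_on {0..1} f \<and>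
     (\<exists>N. negligible N \<and> (\<forall>x\<in>{0<..<1} - N. (f has_vector_derivative g x) (at x)))"

lemma ac_deriv_continuous_on: "ac_deriv f g \<Longrightarrow> continuous_on {0..1} f"
  by (auto simp: ac_deriv_def intro: AC_on_imp_continuous_on)

lemma ac_deriv_has_integral:
  assumes "ac_deriv f g" "0 \<le> a" "a \<le> b" "b \<le> 1"
  shows "(g has_integral (f b - f a)) {a..b}"
proof -
  obtain N where N: "negligible N" "\<forall>x\<in>{0<..<1} - N. (f has_vector_derivative g x) (at x)"
    using assms(1) unfolding ac_deriv_def by blast
  show ?thesis
  proof (rule AC_on_has_integral_derivative[OF \<open>a \<le> b\<close> _ N(1)])
    show "AC_on {a..b} f"
      using assms unfolding ac_deriv_def by (auto intro: AC_on_subset)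
    show "(f has_vector_derivative g x) (at x)" if "x \<in> {a<..<b} - N" for x
      using N(2) that assms by auto
  qed
qed

lemma ac_deriv_cong:
  assumes "ac_deriv f g" and f: "\<And>x. x \<in> {0..1} \<Longrightarrow> f' x = f x" and g: "\<And>x. x \<in> {0<..<1} \<Longrightarrow> g' x = g x"
  shows "ac_deriv f' g'"
proof -
  obtain N where N: "negligible N" "\<forall>x\<in>{0<..<1} - N. (f has_vector_derivative g x) (at x)"
    using assms(1) unfolding ac_deriv_def by blast
  have "AC_on {0..1} f'"
  proof (rule AC_on_dominated)
    show "AC_on {0..1} f" "AC_on {0..1} f" using assms(1) by (auto simp: ac_deriv_def)
    show "norm (f' y - f' x) \<le> 1 * (norm (f y - f x) + norm (f y - f x))" if "x \<in> {0..1}" "y \<in> {0..1}" for x y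
      using that f by simp
  qed simp
  moreover have "(f' has_vector_derivative g' x) (at x)" if "x \<in> {0<..<1} - N" for x
  proof (rule has_vector_derivative_transform_within_open[where S = "{0<..<1}"])
    show "(f has_vector_derivative g' x) (at x)" using N that g by auto
  qed (use that f in auto)
  ultimately show ?thesis using N(1) unfolding ac_deriv_def by blast
qed

lemma ac_deriv_integral:
  assumes "g absolutely_integrable_on {0..1}"
  shows "ac_deriv (\<lambda>x. c + integral {0..x} g) g"
proof -
  have "g integrable_on {0..1}" using assms by (rule set_lebesgue_integral_eq_integral(1))
  note N = negligible_not_vector_derivative_integral[OF this]
  show ?thesis
    unfolding ac_deriv_def
  proof (intro conjI exI[of _ "{x \<in> {0<..<1}. \<not> ((\<lambda>x. integral {0..x} g) has_vector_derivative g x) (at x)}"] ballI)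
    show "AC_on {0..1} (\<lambda>x. c + integral {0..x} g)" by (rule AC_on_integral[OF assms])
    fix x :: real assume "x \<in> {0<..<1} - {x \<in> {0<..<1}. \<not> ((\<lambda>x. integral {0..x} g) has_vector_derivative g x) (at x)}"
    then have "((\<lambda>x. integral {0..x} g) has_vector_derivative g x) (at x)" by blast
    from has_vector_derivative_add[OF has_vector_derivative_const this]
    show "((\<lambda>x. c + integral {0..x} g) has_vector_derivative g x) (at x)" by simp
  qed (rule N)
qed

lemma ac_deriv_C1:
  assumes "\<And>x. (f has_vector_derivative g x) (at x)" "continuous_on {0..1} g"
  shows "ac_deriv f g"
proof (rule ac_deriv_cong)
  show "ac_deriv (\<lambda>x. f 0 + integral {0..x} g) g"
    using assms(2) by (intro ac_deriv_integral absolutely_integrable_continuous_real)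
  fix x :: real assume "x \<in> {0..1}"
  then have "(g has_integral (f x - f 0)) {0..x}"
    using assms(1) by (intro fundamental_theorem_of_calculus) (auto intro: has_vector_derivative_at_within)
  then show "f x = f 0 + integral {0..x} g" by (simp add: integral_unique)
qed simp

lemma ac_deriv_const: "ac_deriv (\<lambda>x. c) (\<lambda>x. 0)"
  by (rule ac_deriv_C1) (rule has_vector_derivative_const continuous_on_const)+

lemma ac_deriv_exp: "ac_deriv (\<lambda>x. exp (c * of_real x)) (\<lambda>x. c * exp (c * of_real x))"
proof (rule ac_deriv_C1)
  fix x :: real
  have "((\<lambda>z. exp (c * z)) has_field_derivative c * exp (c * of_real x)) (at (of_real x))"
    by (auto intro!: derivative_eq_intros)
  from has_vector_derivative_real_field[OF this]
  show "((\<lambda>x. exp (c * of_real x)) has_vector_derivative c * exp (c * of_real x)) (at x)" .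
qed (intro continuous_intros)

lemma ac_deriv_add:
  assumes "ac_deriv f f'" "ac_deriv g g'"
  shows "ac_deriv (\<lambda>x. f x + g x) (\<lambda>x. f' x + g' x)"
proof -
  obtain N M where N: "negligible N" "\<forall>x\<in>{0<..<1} - N. (f has_vector_derivative f' x) (at x)"
    and M: "negligible M" "\<forall>x\<in>{0<..<1} - M. (g has_vector_derivative g' x) (at x)"
    using assms unfolding ac_deriv_def by blast
  have "negligible (N \<union> M)" using N M by (intro negligible_Un)
  moreover have "((\<lambda>x. f x + g x) has_vector_derivative f' x + g' x) (at x)" if "x \<in> {0<..<1} - (N \<union> M)" for x
    using N M that by (intro has_vector_derivative_add) auto
  moreover have "AC_on {0..1} (\<lambda>x. f x + g x)"
    using assms by (intro AC_on_add) (auto simp: ac_deriv_def)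
  ultimately show ?thesis unfolding ac_deriv_def by blast
qed

lemma ac_deriv_mult:
  assumes "ac_deriv f f'" "ac_deriv g g'"
  shows "ac_deriv (\<lambda>x. f x * g x) (\<lambda>x. f x * g' x + f' x * g x)"
proof -
  obtain N M where N: "negligible N" "\<forall>x\<in>{0<..<1} - N. (f has_vector_derivative f' x) (at x)"
    and M: "negligible M" "\<forall>x\<in>{0<..<1} - M. (g has_vector_derivative g' x) (at x)"
    using assms unfolding ac_deriv_def by blast
  have "negligible (N \<union> M)" using N M by (intro negligible_Un)
  moreover have "((\<lambda>x. f x * g x) has_vector_derivative f x * g' x + f' x * g x) (at x)" if "x \<in> {0<..<1} - (N \<union> M)" for x
    using N M that by (intro has_vector_derivative_mult) auto
  moreover have "AC_on {0..1} (\<lambda>x. f x * g x)"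
    using assms by (intro AC_on_mult) (auto simp: ac_deriv_def)
  ultimately show ?thesis unfolding ac_deriv_def by blast
qed

lemma ac_deriv_cmult: "ac_deriv f f' \<Longrightarrow> ac_deriv (\<lambda>x. c * f x) (\<lambda>x. c * f' x)"
  using ac_deriv_mult[OF ac_deriv_const[of c]] by simp

lemma ac_deriv_diff:
  assumes "ac_deriv f f'" "ac_deriv g g'"
  shows "ac_deriv (\<lambda>x. f x - g x) (\<lambda>x. f' x - g' x)"
  using ac_deriv_add[OF assms(1) ac_deriv_cmult[OF assms(2), of "-1"]] by simp

lemma ac_deriv_reflect:
  assumes "ac_deriv f g"
  shows "ac_deriv (\<lambda>x. f (1 - x)) (\<lambda>x. - g (1 - x))"
proof -
  obtain N where N: "negligible N" "\<forall>x\<in>{0<..<1} - N. (f has_vector_derivative g x) (at x)"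
    using assms(1) unfolding ac_deriv_def by blast
  let ?M = "(\<lambda>x. 1 - x) ` N"
  have "negligible ?M"
    by (rule negligible_differentiable_image_negligible[OF order_refl N(1)])
      (auto intro!: derivative_intros simp: differentiable_on_def)
  moreover have "((\<lambda>x. f (1 - x)) has_vector_derivative - g (1 - x)) (at x)" if "x \<in> {0<..<1} - ?M" for x
  proof -
    have "1 - x \<in> {0<..<1} - N" using that by (force simp: image_iff)
    then have "(f has_vector_derivative g (1 - x)) (at (1 - x))" using N(2) by blast
    moreover have "((\<lambda>x. 1 - x) has_vector_derivative -1) (at x)"
      by (auto intro!: derivative_eq_intros)
    ultimately have "(f \<circ> (\<lambda>x. 1 - x) has_vector_derivative -1 *\<^sub>R g (1 - x)) (at x)"
      by (intro vector_diff_chain_at) auto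
    then show ?thesis by (simp add: o_def)
  qed
  moreover have "AC_on {0..1} (\<lambda>x. f (1 - x))"
    using assms by (intro AC_on_reflect) (auto simp: ac_deriv_def)
  ultimately show ?thesis unfolding ac_deriv_def by blast
qed

lemma ac_deriv_zero_ae:
  assumes "ac_deriv f g" "\<And>x. x \<in> {0..1} \<Longrightarrow> f x = c"
  obtains N where "negligible N" "\<And>x. x \<in> {0<..<1} - N \<Longrightarrow> g x = 0"
proof -
  have "ac_deriv (\<lambda>x. c) g"
    by (rule ac_deriv_cong[OF assms(1)]) (use assms(2) in auto)
  then obtain N where N: "negligible N" "\<forall>x\<in>{0<..<1} - N. ((\<lambda>x. c) has_vector_derivative g x) (at x)"
    unfolding ac_deriv_def by blast
  show ?thesis
  proof (rule that[OF N(1)])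
    fix x assume "x \<in> {0<..<1} - N"
    then have "((\<lambda>x. c) has_vector_derivative g x) (at x)" using N(2) by blast
    then show "g x = 0" using has_vector_derivative_const vector_derivative_unique_at by blast
  qed
qed

text \<open>Continuity turns the almost everywhere statement into one at every point of the closed
  interval, so that the resulting identity can be differentiated again.\<close>

lemma ac_deriv_zero_continuous:
  assumes "ac_deriv f g" "\<And>x. x \<in> {0..1} \<Longrightarrow> f x = c" and g: "continuous_on {0..1} g" and x: "x \<in> {0..1}"
  shows "g x = 0"
proof -
  have "((\<lambda>u. integral {0..u} g) has_vector_derivative g x) (at x within {0..1})"
    using g x by (rule integral_has_vector_derivative)
  moreover have "integral {0..u} g = 0" if "u \<in> {0..1}" for u
    using ac_deriv_has_integral[OF assms(1), of 0 u] that assms(2) by (auto simp: integral_unique)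
  ultimately have "((\<lambda>u. 0) has_vector_derivative g x) (at x within {0..1})"
    using x by (rule_tac has_vector_derivative_transform[where f = "\<lambda>u. integral {0..u} g" and S = "{0..1}"]) auto
  then show ?thesis
    using has_vector_derivative_const vector_derivative_unique_within_closed_interval[of 0 1 x] x
    by (metis box_real(2) zero_less_one)
qed

lemma ac_deriv_zero_const:
  assumes "ac_deriv f (\<lambda>x. 0)" "x \<in> {0..1}"
  shows "f x = f 0"
proof -
  have "((\<lambda>x. 0) has_integral (f x - f 0)) {0..x}"
    using ac_deriv_has_integral[OF assms(1), of 0 x] assms(2) by simp
  then have "f x - f 0 = 0" by (rule has_integral_unique) (rule has_integral_0)
  then show ?thesis by simp
qed

section \<open>Existence, uniqueness and analytic dependence of solutions\<close>

lemma absolutely_integrable_mult_continuous: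
  fixes p f :: "real \<Rightarrow> complex"
  assumes p: "p absolutely_integrable_on {a..b}" and f: "continuous_on {a..b} f"
  shows "(\<lambda>x. p x * f x) absolutely_integrable_on {a..b}"
proof -
  have "bounded (f ` {a..b})"
    using f by (intro compact_imp_bounded compact_continuous_image) auto
  moreover have "f \<in> borel_measurable (lebesgue_on {a..b})"
    using f by (intro continuous_imp_measurable_on_sets_lebesgue) auto
  ultimately have "(\<lambda>x. f x * p x) absolutely_integrable_on {a..b}"
    using p by (intro absolutely_integrable_bounded_measurable_product[OF bilinear_times]) auto
  then show ?thesis by (simp add: mult.commute)
qed

abbreviation L1 :: "(real \<Rightarrow> complex) \<Rightarrow> bool" where
  "L1 p \<equiv> p absolutely_integrable_on {0..1}"

text \<open>First-order form of the quasi-derivative equations, with \<open>Y 1\<close> the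
  derivative of \<open>Y 0\<close> and \<open>Y 2\<close> the second quasi-derivative; the last
  branch is meant for \<open>k = 2\<close>.\<close>

definition rhs :: "(real \<Rightarrow> complex) \<Rightarrow> complex \<Rightarrow> (nat \<Rightarrow> real \<Rightarrow> complex) \<Rightarrow> nat \<Rightarrow> real \<Rightarrow> complex" where
  "rhs p lam Y k t = (if k = 0 then Y 1 t else if k = 1 then Y 2 t - p t * Y 0 t
                      else lam * Y 0 t - p t * Y 1 t)"

definition sol :: "(real \<Rightarrow> complex) \<Rightarrow> complex \<Rightarrow> (nat \<Rightarrow> real \<Rightarrow> complex) \<Rightarrow> bool" where
  "sol p lam Y \<longleftrightarrow> (\<forall>k<3. ac_deriv (Y k) (rhs p lam Y k))"

lemma sum3: "(\<Sum>k<3. f k) = f 0 + f 1 + (f (2::nat) :: 'a::comm_monoid_add)"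
  by (simp add: numeral_3_eq_3 numeral_2_eq_2)

lemma all3: "(\<forall>k<3. P k) \<longleftrightarrow> P 0 \<and> P 1 \<and> P (2::nat)"
  by (auto simp: numeral_3_eq_3 numeral_2_eq_2 less_Suc_eq)

lemma sol_iff: "sol p lam Y \<longleftrightarrow> ac_deriv (Y 0) (Y 1) \<and> ac_deriv (Y 1) (\<lambda>t. Y 2 t - p t * Y 0 t) \<and>
    ac_deriv (Y 2) (\<lambda>t. lam * Y 0 t - p t * Y 1 t)"
  unfolding sol_def all3 by (simp add: rhs_def[abs_def])

lemma rhs_absolutely_integrable:
  assumes "L1 p" "\<And>k. k < 3 \<Longrightarrow> continuous_on {0..1} (Y k)"
  shows "rhs p lam Y k absolutely_integrable_on {0..1}"
proof -
  have "continuous_on {0..1} (Y 0)" "continuous_on {0..1} (Y 1)" "continuous_on {0..1} (Y 2)"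
    using assms(2) by auto
  then have "Y 1 absolutely_integrable_on {0..1}" "Y 2 absolutely_integrable_on {0..1}"
    "(\<lambda>t. lam * Y 0 t) absolutely_integrable_on {0..1}"
    by (auto intro!: absolutely_integrable_continuous_real continuous_on_mult continuous_on_const)
  moreover have "(\<lambda>t. p t * Y 0 t) absolutely_integrable_on {0..1}" "(\<lambda>t. p t * Y 1 t) absolutely_integrable_on {0..1}"
    using assms by (auto intro: absolutely_integrable_mult_continuous)
  ultimately have "(\<lambda>t. Y 2 t - p t * Y 0 t) absolutely_integrable_on {0..1}"
    "(\<lambda>t. lam * Y 0 t - p t * Y 1 t) absolutely_integrable_on {0..1}"
    by (auto intro: set_integral_diff(1))
  with \<open>Y 1 absolutely_integrable_on {0..1}\<close> show ?thesis
    unfolding rhs_def[abs_def] by (cases "k = 0"; cases "k = 1") simp_all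
qed

lemma rhs_integrable:
  assumes "L1 p" "\<And>k. k < 3 \<Longrightarrow> continuous_on {0..1} (Y k)"
    and "0 \<le> x" "x \<le> 1"
  shows "rhs p lam Y k integrable_on {0..x}"
  using assms(3,4)
  by (intro integrable_subinterval_real[OF set_lebesgue_integral_eq_integral(1)[OF rhs_absolutely_integrable[where Y = Y, OF assms(1,2)]]])
    auto

lemma norm_rhs_le:
  "(\<Sum>k<3. norm (rhs p lam Y k t)) \<le> (1 + norm lam + norm (p t)) * (\<Sum>k<3. norm (Y k t))"
proof -
  have arith: "b + x + y \<le> (1 + l + q) * (a + b + c)"
    if "0 \<le> a" "0 \<le> b" "0 \<le> c" "0 \<le> l" "0 \<le> q" "x \<le> c + q * a" "y \<le> l * a + q * b" for a b c l q x y :: real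
  proof -
    have "0 \<le> l * b" "0 \<le> l * c" "0 \<le> q * c" using that by auto
    moreover have "(1 + l + q) * (a + b + c) = a + b + c + l * a + l * b + l * c + q * a + q * b + q * c"
      by (simp add: algebra_simps)
    ultimately show ?thesis using that by linarith
  qed
  have "norm (Y 2 t - p t * Y 0 t) \<le> norm (Y 2 t) + norm (p t) * norm (Y 0 t)"
    using norm_triangle_ineq4[of "Y 2 t" "p t * Y 0 t"] by (simp add: norm_mult)
  moreover have "norm (lam * Y 0 t - p t * Y 1 t) \<le> norm lam * norm (Y 0 t) + norm (p t) * norm (Y 1 t)"
    using norm_triangle_ineq4[of "lam * Y 0 t" "p t * Y 1 t"] by (simp add: norm_mult)
  ultimately show ?thesis
    unfolding sum3 by (simp add: rhs_def arith)
qed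

text \<open>Splitting \<open>p\<close> into a bounded part and a part that is small in \<open>L\<^sub>1\<close> makes the Volterra operator a contraction
  for the norm weighted by \<open>exp (\<kappa> * t)\<close>.\<close>

lemma rhs_weighted_contraction:
  assumes p: "L1 p" and "L \<ge> 0"
  shows "\<exists>\<kappa>>0. \<forall>lam Y M x. norm lam \<le> L \<and> (\<forall>k<3. continuous_on {0..1} (Y k)) \<and>
      (\<forall>t\<in>{0..1}. (\<Sum>k<3. norm (Y k t)) \<le> M * exp (\<kappa> * t)) \<and> x \<in> {0..1}
      \<longrightarrow> (\<Sum>k<3. norm (integral {0..x} (rhs p lam Y k))) \<le> M / 2 * exp (\<kappa> * x)"
proof -
  obtain B h where B: "B > 0" "h integrable_on {0..1}" "\<And>x. 0 \<le> h x" "integral {0..1} h < 1/4"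
    "\<And>x. norm (p x) \<le> B + h x"
    using absolutely_integrable_truncation[OF p, of "1/4"] by (metis zero_less_divide_1_iff zero_less_numeral)
  \<comment> \<open>With \<open>\<kappa> = 4 * A\<close> the bounded part integrates to at most
    \<open>M / 4 * exp (\<kappa> * x)\<close>; the part with L1 norm below 1/4 gives another
    quarter. Nothing depends on \<open>lam\<close> beyond \<open>norm lam \<le> L\<close>, and this
    uniformity later yields holomorphy.\<close>
  define A where "A = 1 + L + B"
  define \<kappa> where "\<kappa> = 4 * A"
  have A: "A > 0" "\<kappa> > 0" using B(1) \<open>L \<ge> 0\<close> by (auto simp: A_def \<kappa>_def)
  show ?thesis
  proof (intro exI[of _ \<kappa>] conjI allI impI; (elim conjE)?)
    show "\<kappa> > 0" by (rule A(2))
    fix lam :: complex and Y :: "nat \<Rightarrow> real \<Rightarrow> complex" and M x :: real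
    assume lam: "norm lam \<le> L" and "\<forall>k<3. continuous_on {0..1} (Y k)"
      and "\<forall>t\<in>{0..1}. (\<Sum>k<3. norm (Y k t)) \<le> M * exp (\<kappa> * t)" and x: "x \<in> {0..1}"
    then have Y: "\<And>k. k < 3 \<Longrightarrow> continuous_on {0..1} (Y k)"
      and bd: "\<And>t. t \<in> {0..1} \<Longrightarrow> (\<Sum>k<3. norm (Y k t)) \<le> M * exp (\<kappa> * t)" by auto
    have "0 \<le> (\<Sum>k<3. norm (Y k 0))" by (simp add: sum_nonneg)
    with bd[of 0] have M: "M \<ge> 0" by simp
    have hx: "h integrable_on {0..x}"
      using x by (intro integrable_subinterval_real[OF B(2)]) auto
    have ni: "(\<lambda>t. norm (rhs p lam Y k t)) integrable_on {0..x}" for k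
    proof -
      have "rhs p lam Y k absolutely_integrable_on {0..x}"
        using x by (intro absolutely_integrable_on_subinterval[OF rhs_absolutely_integrable[where Y = Y, OF p Y]]) auto
      then show ?thesis by (auto simp: absolutely_integrable_on_def)
    qed
    have ei: "((\<lambda>t. A * M * exp (\<kappa> * t)) has_integral (M / 4 * exp (\<kappa> * x) - M / 4 * exp (\<kappa> * 0))) {0..x}"
    proof (rule fundamental_theorem_of_calculus)
      fix t
      have "((\<lambda>x. M / 4 * exp (\<kappa> * x)) has_real_derivative A * M * exp (\<kappa> * t)) (at t within {0..x})"
        by (auto intro!: derivative_eq_intros simp: \<kappa>_def)
      then show "((\<lambda>x. M / 4 * exp (\<kappa> * x)) has_vector_derivative A * M * exp (\<kappa> * t)) (at t within {0..x})"
        by (simp add: has_real_derivative_iff_has_vector_derivative)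
    qed (use x in auto)
    have "(\<Sum>k<3. norm (integral {0..x} (rhs p lam Y k))) \<le> (\<Sum>k<3. integral {0..x} (\<lambda>t. norm (rhs p lam Y k t)))"
      using x by (intro sum_mono integral_norm_bound_integral rhs_integrable[where Y = Y, OF p Y] ni) auto
    also have "\<dots> = integral {0..x} (\<lambda>t. \<Sum>k<3. norm (rhs p lam Y k t))"
      using ni by (intro integral_sum[symmetric]) auto
    also have "\<dots> \<le> integral {0..x} (\<lambda>t. A * M * exp (\<kappa> * t) + M * exp (\<kappa> * x) * h t)"
    proof (rule integral_le)
      show "(\<lambda>t. \<Sum>k<3. norm (rhs p lam Y k t)) integrable_on {0..x}"
        using ni by (intro integrable_sum) auto
      show "(\<lambda>t. A * M * exp (\<kappa> * t) + M * exp (\<kappa> * x) * h t) integrable_on {0..x}"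
        by (rule integrable_add[OF has_integral_integrable[OF ei] integrable_on_mult_right[OF hx]])
      fix t assume t: "t \<in> {0..x}"
      have "(\<Sum>k<3. norm (rhs p lam Y k t)) \<le> (1 + norm lam + norm (p t)) * (\<Sum>k<3. norm (Y k t))"
        by (rule norm_rhs_le)
      also have "\<dots> \<le> (A + h t) * (M * exp (\<kappa> * t))"
        using lam B(3)[of t] B(5)[of t] bd[of t] t x A
        by (intro mult_mono) (auto simp: A_def intro!: sum_nonneg)
      also have "\<dots> = A * M * exp (\<kappa> * t) + M * h t * exp (\<kappa> * t)" by (simp add: algebra_simps)
      also have "M * h t * exp (\<kappa> * t) \<le> M * h t * exp (\<kappa> * x)"
        using t A M B(3)[of t] by (intro mult_left_mono) auto
      finally show "(\<Sum>k<3. norm (rhs p lam Y k t)) \<le> A * M * exp (\<kappa> * t) + M * exp (\<kappa> * x) * h t"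
        by (simp add: mult_ac)
    qed
    also have "\<dots> = (M / 4 * exp (\<kappa> * x) - M / 4) + M * exp (\<kappa> * x) * integral {0..x} h"
      unfolding integral_add[OF has_integral_integrable[OF ei] integrable_on_mult_right[OF hx]]
      using integral_unique[OF ei] by simp
    also have "\<dots> \<le> M / 4 * exp (\<kappa> * x) + M * exp (\<kappa> * x) * (1/4)"
    proof -
      have "integral {0..x} h \<le> integral {0..1} h"
        using x B by (intro integral_subset_le hx) auto
      then have "M * exp (\<kappa> * x) * integral {0..x} h \<le> M * exp (\<kappa> * x) * (1/4)"
        using M B(4) by (intro mult_left_mono) auto
      then show ?thesis using M by linarith
    qed
    also have "\<dots> = M / 2 * exp (\<kappa> * x)" by simp
    finally show "(\<Sum>k<3. norm (integral {0..x} (rhs p lam Y k))) \<le> M / 2 * exp (\<kappa> * x)" .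
  qed
qed

lemma sol_continuous_on: "sol p lam Y \<Longrightarrow> k < 3 \<Longrightarrow> continuous_on {0..1} (Y k)"
  unfolding sol_def by (blast intro: ac_deriv_continuous_on)

lemma sol_integral_eq:
  assumes "sol p lam Y" "k < 3" "x \<in> {0..1}"
  shows "integral {0..x} (rhs p lam Y k) = Y k x - Y k 0"
  using assms ac_deriv_has_integral[of "Y k" "rhs p lam Y k" 0 x]
  by (auto simp: sol_def integral_unique)

text \<open>With zero initial values a solution is a fixed point of the Volterra operator, so each
  application of the contraction halves its weighted bound.\<close>

lemma sol_zero:
  assumes p: "L1 p" and Y: "sol p lam Y"
    and 0: "\<And>k. k < 3 \<Longrightarrow> Y k 0 = 0" and kx: "k < 3" "x \<in> {0..1}"
  shows "Y k x = 0"
proof -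
  obtain \<kappa> where \<kappa>: "\<kappa> > 0"
    and contr: "\<forall>lam' Y M x. norm lam' \<le> norm lam \<and> (\<forall>k<3. continuous_on {0..1} (Y k)) \<and>
      (\<forall>t\<in>{0..1}. (\<Sum>k<3. norm (Y k t)) \<le> M * exp (\<kappa> * t)) \<and> x \<in> {0..1}
      \<longrightarrow> (\<Sum>k<3. norm (integral {0..x} (rhs p lam' Y k))) \<le> M / 2 * exp (\<kappa> * x)"
    using rhs_weighted_contraction[OF p norm_ge_zero[of lam]] by (elim exE conjE) (rule that)
  have "compact ((\<lambda>t. \<Sum>k<3. norm (Y k t)) ` {0..1})"
    using sol_continuous_on[OF Y] by (intro compact_continuous_image continuous_intros) auto
  then have "bounded ((\<lambda>t. \<Sum>k<3. norm (Y k t)) ` {0..1})" by (rule compact_imp_bounded)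
  then obtain M where M: "\<And>t. t \<in> {0..1} \<Longrightarrow> (\<Sum>k<3. norm (Y k t)) \<le> M"
  proof -
    obtain M where M: "\<And>s. s \<in> (\<lambda>t. \<Sum>k<3. norm (Y k t)) ` {0..1} \<Longrightarrow> norm s \<le> M"
      using \<open>bounded _\<close> by (auto simp: bounded_iff)
    have "(\<Sum>k<3. norm (Y k t)) \<le> M" if "t \<in> {0..1}" for t
      using M[OF imageI[OF that]] by simp
    then show ?thesis by (rule that)
  qed
  have M0: "M \<ge> 0" using M[of 0] sum_nonneg[of "{..<3}" "\<lambda>k. norm (Y k 0)"] by simp
  have ind: "(\<Sum>k<3. norm (Y k t)) \<le> M / 2 ^ n * exp (\<kappa> * t)" if "t \<in> {0..1}" for n t
    using that
  proof (induction n arbitrary: t)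
    case 0
    have "M * 1 \<le> M * exp (\<kappa> * t)" using M0 \<kappa> 0 by (intro mult_left_mono) auto
    then show ?case using M[OF 0] by simp
  next
    case (Suc n)
    have "(\<Sum>k<3. norm (Y k t)) = (\<Sum>k<3. norm (integral {0..t} (rhs p lam Y k)))"
      using sol_integral_eq[OF Y _ Suc.prems] 0 by (intro sum.cong) auto
    also have "\<dots> \<le> M / 2 ^ n / 2 * exp (\<kappa> * t)"
      using Suc by (intro contr[rule_format] conjI) (auto intro: sol_continuous_on[OF Y])
    finally show ?case by simp
  qed
  have "(\<lambda>n. M / 2 ^ n * exp (\<kappa> * x)) \<longlonglongrightarrow> 0"
    by real_asymp
  then have "(\<Sum>k<3. norm (Y k x)) \<le> 0"
    using ind[OF kx(2)] by (intro LIMSEQ_le_const) auto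
  moreover have "norm (Y k x) \<le> (\<Sum>k<3. norm (Y k x))"
    using kx by (intro member_le_sum) auto
  ultimately have "norm (Y k x) \<le> 0" by linarith
  then show ?thesis by simp
qed

lemma sol_add_cmult:
  assumes "sol p lam Y" "sol p lam Z"
  shows "sol p lam (\<lambda>k x. a * Y k x + b * Z k x)"
  unfolding sol_def
proof (intro allI impI)
  fix k :: nat assume "k < 3"
  then have "ac_deriv (\<lambda>x. a * Y k x + b * Z k x) (\<lambda>x. a * rhs p lam Y k x + b * rhs p lam Z k x)"
    using assms by (intro ac_deriv_add ac_deriv_cmult) (auto simp: sol_def)
  then show "ac_deriv (\<lambda>x. a * Y k x + b * Z k x) (rhs p lam (\<lambda>k x. a * Y k x + b * Z k x) k)"
    by (rule ac_deriv_cong) (auto simp: rhs_def algebra_simps)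
qed

lemma sol_unique:
  assumes p: "L1 p" and "sol p lam Y" "sol p lam Z"
    and "\<And>k. k < 3 \<Longrightarrow> Y k 0 = Z k 0" and "k < 3" "x \<in> {0..1}"
  shows "Y k x = Z k x"
  using sol_zero[OF p sol_add_cmult[OF assms(2,3), of 1 "-1"]] assms(4-) by simp

text \<open>These are the terms of the Neumann series, not its partial sums: the \<open>n\<close>-th
  one is the Volterra operator applied \<open>n\<close> times to the constant initial
  vector.\<close>

primrec picard :: "(real \<Rightarrow> complex) \<Rightarrow> complex \<Rightarrow> (nat \<Rightarrow> complex) \<Rightarrow> nat \<Rightarrow> nat \<Rightarrow> real \<Rightarrow> complex" where
  "picard p lam c 0 = (\<lambda>k x. c k)"
| "picard p lam c (Suc n) = (\<lambda>k x. integral {0..x} (rhs p lam (picard p lam c n) k))"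

lemma picard_continuous_on:
  assumes p: "L1 p"
  shows "continuous_on {0..1} (picard p lam c n k)"
proof (induction n arbitrary: k)
  case (Suc n)
  show ?case
    using rhs_integrable[where Y = "picard p lam c n" and x = 1, OF p Suc] by (simp add: indefinite_integral_continuous_1)
qed simp

lemma picard_bound:
  assumes p: "L1 p" and "L \<ge> 0"
  shows "\<exists>K\<ge>0. \<forall>lam n k x. norm lam \<le> L \<and> k < 3 \<and> x \<in> {0..1} \<longrightarrow> norm (picard p lam c n k x) \<le> K * (1/2) ^ n"
proof -
  obtain \<kappa> where \<kappa>: "\<kappa> > 0"
    and contr: "\<forall>lam' Y M x. norm lam' \<le> L \<and> (\<forall>k<3. continuous_on {0..1} (Y k)) \<and>
      (\<forall>t\<in>{0..1}. (\<Sum>k<3. norm (Y k t)) \<le> M * exp (\<kappa> * t)) \<and> x \<in> {0..1}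
      \<longrightarrow> (\<Sum>k<3. norm (integral {0..x} (rhs p lam' Y k))) \<le> M / 2 * exp (\<kappa> * x)"
    using rhs_weighted_contraction[OF p \<open>L \<ge> 0\<close>] by (elim exE conjE) (rule that)
  define M where "M = (\<Sum>k<3. norm (c k))"
  have M0: "M \<ge> 0" by (simp add: M_def sum_nonneg)
  have ind: "(\<Sum>k<3. norm (picard p lam c n k t)) \<le> M / 2 ^ n * exp (\<kappa> * t)" if "t \<in> {0..1}" "norm lam \<le> L" for lam n t
    using that
  proof (induction n arbitrary: t)
    case 0
    have "M * 1 \<le> M * exp (\<kappa> * t)" using M0 \<kappa> 0 by (intro mult_left_mono) auto
    then show ?case by (simp add: M_def)
  next
    case (Suc n)
    have "(\<Sum>k<3. norm (integral {0..t} (rhs p lam (picard p lam c n) k))) \<le> M / 2 ^ n / 2 * exp (\<kappa> * t)"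
      using Suc by (intro contr[rule_format] conjI) (auto intro: picard_continuous_on[OF p])
    then show ?case by simp
  qed
  show ?thesis
  proof (intro exI[of _ "M * exp \<kappa>"] conjI allI impI; (elim conjE)?)
    show "M * exp \<kappa> \<ge> 0" using M0 by simp
    fix lam :: complex and n k x assume "norm lam \<le> L" "(k::nat) < 3" "x \<in> {0..(1::real)}"
    have "norm (picard p lam c n k x) \<le> (\<Sum>k<3. norm (picard p lam c n k x))"
      using \<open>k < 3\<close> by (intro member_le_sum) auto
    also have "\<dots> \<le> M / 2 ^ n * exp (\<kappa> * x)" by (rule ind) fact+
    also have "\<dots> \<le> M / 2 ^ n * exp (\<kappa> * 1)"
      using M0 \<kappa> \<open>x \<in> {0..1}\<close> by (intro mult_left_mono) auto
    finally show "norm (picard p lam c n k x) \<le> M * exp \<kappa> * (1/2) ^ n"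
      by (simp add: power_divide)
  qed
qed

definition csol :: "(real \<Rightarrow> complex) \<Rightarrow> complex \<Rightarrow> (nat \<Rightarrow> complex) \<Rightarrow> nat \<Rightarrow> real \<Rightarrow> complex" where
  "csol p lam c k x = (\<Sum>n. picard p lam c n k x)"

lemma rhs_sum: "rhs p lam (\<lambda>k x. \<Sum>n\<in>I. Y n k x) k t = (\<Sum>n\<in>I. rhs p lam (Y n) k t)"
  by (simp add: rhs_def sum_distrib_left sum_subtractf)

lemma csol_solution:
  assumes p: "L1 p"
  shows "sol p lam (csol p lam c)" and "k < 3 \<Longrightarrow> csol p lam c k 0 = c k"
proof -
  obtain K where K: "K \<ge> 0"
    "\<And>lam' n k x. \<lbrakk>norm lam' \<le> norm lam; k < 3; x \<in> {0..1}\<rbrakk> \<Longrightarrow> norm (picard p lam' c n k x) \<le> K * (1/2) ^ n"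
    using picard_bound[OF p norm_ge_zero[of lam], of c] by auto
  define S where "S N k x = (\<Sum>n<N. picard p lam c n k x)" for N k x
  have geo: "(\<lambda>n. K * (1/2) ^ n) sums (K * 2)"
    using sums_mult[OF geometric_sums[of "1/2::real"], of K] by simp
  have ul: "uniform_limit {0..1} (\<lambda>N. S N k) (csol p lam c k) sequentially" if "k < 3" for k
    unfolding S_def csol_def[abs_def]
    by (rule Weierstrass_m_test[where M = "\<lambda>n. K * (1/2) ^ n"]) (use K(2) that geo in \<open>auto simp: sums_iff\<close>)
  have Sc: "continuous_on {0..1} (S N k)" for N k
    unfolding S_def by (intro continuous_intros picard_continuous_on[OF p])
  have Yc: "continuous_on {0..1} (csol p lam c k)" if "k < 3" for k
    by (rule uniform_limit_theorem[OF _ ul[OF that]]) (auto simp: Sc)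
  have lim: "(\<lambda>N. S N k x) \<longlonglongrightarrow> csol p lam c k x" if "k < 3" "x \<in> {0..1}" for k x
    using ul[OF that(1)] that(2) by (rule tendsto_uniform_limitI)
  have Sb: "norm (S N k x) \<le> K * 2" if "k < 3" "x \<in> {0..1}" for N k x
  proof -
    have "norm (S N k x) \<le> (\<Sum>n<N. K * (1/2) ^ n)"
      unfolding S_def using K(2) that by (intro sum_norm_le) auto
    also have "\<dots> \<le> K * 2"
      using sum_le_suminf[of "\<lambda>n. K * (1/2) ^ n" "{..<N}"] geo K(1) by (simp add: sums_iff)
    finally show ?thesis .
  qed
  have eq: "csol p lam c k x = c k + integral {0..x} (rhs p lam (csol p lam c) k)" if kx: "k < 3" "x \<in> {0..1}" for k x
  proof -
    have "(\<lambda>N. integral {0..x} (rhs p lam (S N) k)) \<longlonglongrightarrow> integral {0..x} (rhs p lam (csol p lam c) k)"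
    \<comment> \<open>The partial sums are bounded by the geometric series with sum
      \<open>K * 2\<close>, so an integrable multiple of \<open>1 + norm lam + norm (p t)\<close>
      dominates.\<close>
    proof (rule dominated_convergence(2)[where h = "\<lambda>t. (1 + norm lam + norm (p t)) * (\<Sum>k<3::nat. K * 2)"])
      show "rhs p lam (S N) k integrable_on {0..x}" for N
        using kx by (intro rhs_integrable[OF p] Sc) auto
      have "p absolutely_integrable_on {0..x}"
        using kx by (intro absolutely_integrable_on_subinterval[OF p]) auto
      then show "(\<lambda>t. (1 + norm lam + norm (p t)) * (\<Sum>k<3::nat. K * 2)) integrable_on {0..x}"
        by (intro integrable_on_mult_left integrable_add) (auto simp: absolutely_integrable_on_def)
      show "norm (rhs p lam (S N) k t) \<le> (1 + norm lam + norm (p t)) * (\<Sum>k<3::nat. K * 2)" if "t \<in> {0..x}" for N t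
      proof -
        have "norm (rhs p lam (S N) k t) \<le> (\<Sum>k<3. norm (rhs p lam (S N) k t))"
          using kx by (intro member_le_sum) auto
        also have "\<dots> \<le> (1 + norm lam + norm (p t)) * (\<Sum>k<3. norm (S N k t))" by (rule norm_rhs_le)
        also have "\<dots> \<le> (1 + norm lam + norm (p t)) * (\<Sum>k<3::nat. K * 2)"
          using kx that by (intro mult_left_mono sum_mono Sb) auto
        finally show ?thesis .
      qed
      show "(\<lambda>N. rhs p lam (S N) k t) \<longlonglongrightarrow> rhs p lam (csol p lam c) k t" if "t \<in> {0..x}" for t
        using kx that by (auto simp: rhs_def intro!: tendsto_intros lim)
    qed
    \<comment> \<open>The integral operator shifts the series by one term, hence
      \<open>Suc N\<close> and the missing initial term \<open>c k\<close>.\<close>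
    moreover have "integral {0..x} (rhs p lam (S N) k) = S (Suc N) k x - c k" for N
    proof -
      have "integral {0..x} (rhs p lam (S N) k) = integral {0..x} (\<lambda>t. \<Sum>n<N. rhs p lam (picard p lam c n) k t)"
        unfolding S_def[abs_def] rhs_sum[abs_def] by (simp add: rhs_sum)
      also have "\<dots> = (\<Sum>n<N. picard p lam c (Suc n) k x)"
        using kx by (subst integral_sum) (auto intro!: rhs_integrable[OF p] picard_continuous_on[OF p])
      also have "\<dots> = S (Suc N) k x - c k"
        unfolding S_def by (subst sum.lessThan_Suc_shift) simp
      finally show ?thesis .
    qed
    ultimately have "(\<lambda>N. S (Suc N) k x - c k) \<longlonglongrightarrow> integral {0..x} (rhs p lam (csol p lam c) k)"
      by simp
    moreover have "(\<lambda>N. S (Suc N) k x - c k) \<longlonglongrightarrow> csol p lam c k x - c k"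
      using lim[OF kx] by (intro tendsto_intros LIMSEQ_Suc)
    ultimately have "integral {0..x} (rhs p lam (csol p lam c) k) = csol p lam c k x - c k"
      by (rule LIMSEQ_unique)
    then show ?thesis by simp
  qed
  show "csol p lam c k 0 = c k" if "k < 3"
    using eq[OF that, of 0] by simp
  show "sol p lam (csol p lam c)"
    unfolding sol_def
  proof (intro allI impI)
    fix k :: nat assume k: "k < 3"
    show "ac_deriv (csol p lam c k) (rhs p lam (csol p lam c) k)"
      by (rule ac_deriv_cong[OF ac_deriv_integral[where c = "c k", OF rhs_absolutely_integrable[where Y = "csol p lam c", OF p Yc]]])
        (use eq[OF k] in auto)
  qed
qed

text \<open>Polynomial dependence on \<open>lam\<close> gives holomorphy of each term without
  differentiating under the integral sign; the sum inherits it by locally uniform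
  convergence.\<close>

lemma picard_polynomial:
  assumes p: "L1 p"
  shows "\<exists>N a. (\<forall>j k. continuous_on {0..1} (a j k)) \<and>
    (\<forall>lam k. \<forall>x\<in>{0..1}. picard p lam c n k x = (\<Sum>j<N. lam ^ j * a j k x))"
proof (induction n)
  case 0
  show ?case by (rule exI[of _ 1], rule exI[of _ "\<lambda>j k x. c k"]) auto
next
  case (Suc n)
  then obtain N a where a: "\<And>j k. continuous_on {0..1} (a j k)"
    "\<And>lam k x. x \<in> {0..1} \<Longrightarrow> picard p lam c n k x = (\<Sum>j<(N::nat). lam ^ j * a j k x)" by blast
  \<comment> \<open>The right-hand side is affine in \<open>lam\<close>: \<open>A\<close> integrates
    its value at \<open>lam = 0\<close>, and \<open>B\<close> integrates the coefficient of
    \<open>lam\<close>, which occurs only in the last component.\<close>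
  define A where "A j k x = integral {0..x} (rhs p 0 (a j) k)" for j :: nat and k x
  define B where "B j k x = integral {0..x} (\<lambda>t. if k = 0 \<or> k = 1 then 0 else a j 0 t)" for j k :: nat and x
  have Bi: "(\<lambda>t. if k = 0 \<or> k = (1::nat) then 0 else a j 0 t) integrable_on {0..x}" if "x \<in> {0..1}" for j k x
    using that continuous_on_subset[OF a(1)[of j 0], of "{0..x}"]
    by (cases "k = 0 \<or> k = 1") (auto intro!: integrable_continuous_real)
  have Ac: "continuous_on {0..1} (A j k)" for j k
    using rhs_integrable[where Y = "a j" and x = 1, OF p a(1)] by (simp add: A_def[abs_def] indefinite_integral_continuous_1)
  have Bc: "continuous_on {0..1} (B j k)" for j k
    unfolding B_def by (intro indefinite_integral_continuous_1 Bi) auto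
  define a' where "a' j k x = (if j < N then A j k x else 0) + (if 0 < j then B (j - 1) k x else 0)" for j k x
  have "continuous_on {0..1} (a' j k)" for j k
    unfolding a'_def using Ac Bc by (intro continuous_on_add) (cases "j < N"; cases "0 < j"; auto)+
  moreover have "picard p lam c (Suc n) k x = (\<Sum>j<Suc N. lam ^ j * a' j k x)" if x: "x \<in> {0..1}" for lam k x
  proof -
    have "picard p lam c (Suc n) k x = integral {0..x} (\<lambda>t. \<Sum>j<N. lam ^ j * rhs p 0 (a j) k t +
        lam ^ Suc j * (if k = 0 \<or> k = 1 then 0 else a j 0 t))"
      unfolding picard.simps
    proof (rule integral_cong)
      fix t assume "t \<in> {0..x}"
      then have t: "t \<in> {0..1}" using x by auto
      show "rhs p lam (picard p lam c n) k t = (\<Sum>j<N. lam ^ j * rhs p 0 (a j) k t +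
        lam ^ Suc j * (if k = 0 \<or> k = 1 then 0 else a j 0 t))"
        by (simp add: rhs_def a(2)[OF t] sum_distrib_left sum_subtractf[symmetric] sum.distrib[symmetric] algebra_simps)
    qed
    also have "\<dots> = (\<Sum>j<N. lam ^ j * A j k x + lam ^ Suc j * B j k x)"
    proof (intro integral_unique has_integral_sum)
      fix j
      have "rhs p 0 (a j) k integrable_on {0..x}"
        using x by (intro rhs_integrable[where Y = "a j", OF p a(1)]) auto
      then show "((\<lambda>t. lam ^ j * rhs p 0 (a j) k t + lam ^ Suc j * (if k = 0 \<or> k = 1 then 0 else a j 0 t))
          has_integral (lam ^ j * A j k x + lam ^ Suc j * B j k x)) {0..x}"
        unfolding A_def B_def
        by (intro has_integral_add has_integral_mult_right integrable_integral Bi[OF x])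
    qed simp
    also have "\<dots> = (\<Sum>j<Suc N. lam ^ j * a' j k x)"
    proof -
      have "(\<Sum>j<Suc N. lam ^ j * (if j < N then A j k x else 0)) = (\<Sum>j<N. lam ^ j * A j k x)" by simp
      moreover have "(\<Sum>j<Suc N. lam ^ j * (if 0 < j then B (j - 1) k x else 0)) = (\<Sum>j<N. lam ^ Suc j * B j k x)"
        by (subst sum.lessThan_Suc_shift) simp
      ultimately show ?thesis unfolding a'_def distrib_left sum.distrib by simp
    qed
    finally show ?thesis .
  qed
  ultimately show ?case by blast
qed

lemma csol_holomorphic:
  assumes p: "L1 p" and kx: "k < 3" "x \<in> {0..1}"
  shows "(\<lambda>lam. csol p lam c k x) holomorphic_on UNIV"
proof (rule holomorphic_uniform_sequence[where f = "\<lambda>N lam. \<Sum>n<N. picard p lam c n k x"])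
  have ph: "(\<lambda>lam. picard p lam c n k x) holomorphic_on UNIV" for n
  proof -
    obtain N a where "\<forall>lam k. \<forall>x\<in>{0..1}. picard p lam c n k x = (\<Sum>j<N. lam ^ j * a j k x)"
      using picard_polynomial[OF p, of c n] by (elim exE conjE) (rule that)
    then have "(\<lambda>lam. picard p lam c n k x) = (\<lambda>lam. \<Sum>j<N. lam ^ j * a j k x)"
      using kx(2) by auto
    then show ?thesis by (auto intro!: holomorphic_intros)
  qed
  show "(\<lambda>lam. \<Sum>n<N. picard p lam c n k x) holomorphic_on UNIV" for N
    by (intro holomorphic_intros ph)
  fix z :: complex
  obtain K where K: "K \<ge> 0"
    "\<And>lam n k x. \<lbrakk>norm lam \<le> norm z + 1; k < 3; x \<in> {0..1}\<rbrakk> \<Longrightarrow> norm (picard p lam c n k x) \<le> K * (1/2) ^ n"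
    using picard_bound[OF p, of "norm z + 1" c] by auto
  have "uniform_limit (cball z 1) (\<lambda>N lam. \<Sum>n<N. picard p lam c n k x) (\<lambda>lam. csol p lam c k x) sequentially"
    unfolding csol_def
  proof (rule Weierstrass_m_test[where M = "\<lambda>n. K * (1/2) ^ n"])
    fix n lam assume "lam \<in> cball z 1"
    then have "norm lam \<le> norm z + 1"
      using norm_triangle_ineq4[of z "z - lam"] by (simp add: dist_norm)
    then show "norm (picard p lam c n k x) \<le> K * (1/2) ^ n" using K(2) kx by blast
  qed (auto intro!: summable_mult summable_geometric)
  then show "\<exists>d>0. cball z d \<subseteq> UNIV \<and> uniform_limit (cball z d) (\<lambda>N lam. \<Sum>n<N. picard p lam c n k x) (\<lambda>lam. csol p lam c k x) sequentially"
    by (intro exI[of _ 1]) auto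
qed simp

section \<open>Translation of the boundary value problems into values of solutions\<close>

lemma ac_deriv_iff_AE:
  "ac_deriv f g \<longleftrightarrow> AC_on {0..1} f \<and> (AE x in lebesgue_on {0<..<1}. (f has_vector_derivative g x) (at x))"
  unfolding ac_deriv_def by (subst AE_lebesgue_on_iff_negligible) (simp_all only: sets_completionI_sets sets_lborel borel_open open_greaterThanLessThan)

lemma qsol_F3_iff_sol: "qsol 3 (F3 p) lam Y \<longleftrightarrow> sol p lam Y"
proof -
  have s: "{1..3::nat} = {1, 2, 3}" "{Suc 0..2} = {1, 2}" "{Suc 0..3} = {1, 2, 3}" by auto
  have k: "(\<exists>D. (f has_vector_derivative D) F \<and> v = D - w) \<longleftrightarrow> (f has_vector_derivative v + w) F"
    for f :: "real \<Rightarrow> complex" and F v w by (auto simp: algebra_simps)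
  have "(\<forall>k\<in>{1..3}. \<exists>D. (Y (k - 1) has_vector_derivative D) (at x) \<and>
        (if k < 3 then Y k x else lam * Y 0 x) = D - (\<Sum>j=1..k. F3 p k j x * Y (j - 1) x)) \<longleftrightarrow>
      (Y 0 has_vector_derivative Y 1 x) (at x) \<and>
      (Y 1 has_vector_derivative Y 2 x - p x * Y 0 x) (at x) \<and>
      (Y 2 has_vector_derivative lam * Y 0 x - p x * Y 1 x) (at x)" for x
    unfolding k s(1) by (simp add: s(2,3) F3_def)
  then show ?thesis
    unfolding qsol_def sol_iff ac_deriv_iff_AE all3 by auto
qed

text \<open>\<open>cs p lam k j\<close> is the \<open>j\<close>-th quasi-derivative of the solution \<open>C\<^bsub>3 - k\<^esub>\<close>.\<close>

definition cs :: "(real \<Rightarrow> complex) \<Rightarrow> complex \<Rightarrow> nat \<Rightarrow> nat \<Rightarrow> real \<Rightarrow> complex" where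
  "cs p lam k = csol p lam (\<lambda>j. if j = k then 1 else 0)"

lemma cs_sol: "L1 p \<Longrightarrow> sol p lam (cs p lam k)"
  unfolding cs_def by (rule csol_solution(1))

lemma cs_0: "L1 p \<Longrightarrow> j < 3 \<Longrightarrow> cs p lam k j 0 = (if j = k then 1 else 0)"
  unfolding cs_def by (simp add: csol_solution(2))

lemma cs_holomorphic:
  "L1 p \<Longrightarrow> j < 3 \<Longrightarrow> x \<in> {0..1} \<Longrightarrow> (\<lambda>lam. cs p lam k j x) holomorphic_on UNIV"
  unfolding cs_def by (rule csol_holomorphic)

lemma cs_unique:
  assumes "L1 p" "sol p lam Y" "\<And>j. j < 3 \<Longrightarrow> Y j 0 = (if j = k then 1 else 0)"
    and "j < 3" "x \<in> {0..1}"
  shows "Y j x = cs p lam k j x"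
  by (rule sol_unique[OF assms(1,2) cs_sol[OF assms(1)] _ assms(4,5)]) (simp add: assms(3) cs_0[OF assms(1)])

text \<open>Existence and uniqueness make the \<open>THE\<close> in \<open>C_form\<close> well
  defined. Since \<open>U s\<close> reads off the quasi-derivative of order \<open>3 - s\<close>,
  the solution with index \<open>r\<close> starts from the unit vector in position
  \<open>3 - r\<close>.\<close>

lemma C_form_F3:
  assumes p: "L1 p" and r: "r \<in> {1..3}" and W: "W = U s \<or> W = V s" "s \<in> {1..3}"
  shows "C_form 3 (F3 p) lam r W = form_val 3 W (cs p lam (3 - r))"
  unfolding C_form_def qsol_F3_iff_sol
proof (rule the_equality)
  have idx: "(3 - s' = 3 - r) = (s' = r)" if "s' \<in> {1..3}" for s' using that r by auto
  show "\<exists>Y. sol p lam Y \<and> (\<forall>s\<in>{1..3}. form_val 3 (U s) Y = (if s = r then 1 else 0)) \<and>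
      form_val 3 W Y = form_val 3 W (cs p lam (3 - r))"
    by (rule exI[of _ "cs p lam (3 - r)"]) (auto simp: cs_sol[OF p] cs_0[OF p] idx)
  fix v assume "\<exists>Y. sol p lam Y \<and> (\<forall>s\<in>{1..3}. form_val 3 (U s) Y = (if s = r then 1 else 0)) \<and> form_val 3 W Y = v"
  then obtain Y where Y: "sol p lam Y" "\<And>s. s \<in> {1..3} \<Longrightarrow> Y (3 - s) 0 = (if s = r then 1 else 0)" "form_val 3 W Y = v"
    by auto
  have init: "Y j 0 = (if j = 3 - r then 1 else 0)" if "j < 3" for j
    using Y(2)[of "3 - j"] that r by auto
  have "Y j x = cs p lam (3 - r) j x" if "j < 3" "x \<in> {0..1}" for j x
    by (rule cs_unique[OF p Y(1) init that])
  moreover have "3 - s < 3" using W(2) by auto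
  ultimately have "form_val 3 W Y = form_val 3 W (cs p lam (3 - r))" using W(1) by auto
  with Y(3) show "v = form_val 3 W (cs p lam (3 - r))" by simp
qed

lemma C_form_F3_U:
  assumes "L1 p" "r \<in> {1..3}" "s \<in> {1..3}"
  shows "C_form 3 (F3 p) lam r (U s) = (if s = r then 1 else 0)"
  using assms by (subst C_form_F3[where s = s]) (auto simp: cs_0)

lemma C_form_F3_V:
  assumes "L1 p" "r \<in> {1..3}" "s \<in> {1..3}"
  shows "C_form 3 (F3 p) lam r (V s) = cs p lam (3 - r) (3 - s) 1"
  using assms by (subst C_form_F3[where s = s]) auto

lemma detn_3: "detn 3 M = M 1 1 * M 2 2 * M 3 3 + M 1 2 * M 2 3 * M 3 1 + M 1 3 * M 2 1 * M 3 2
    - M 1 1 * M 2 3 * M 3 2 - M 1 2 * M 2 1 * M 3 3 - M 1 3 * M 2 2 * M 3 1"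
proof -
  have s: "{1..3::nat} = {1, 2, 3}" by auto
  have f123: "finite {2::nat, 3}" "1 \<notin> {2::nat, 3}" by auto
  have f23: "finite {3::nat}" "2 \<notin> {3::nat}" by auto
  show ?thesis
    unfolding detn_def s sum_over_permutations_insert[OF f123] sum_over_permutations_insert[OF f23] permutes_sing
    by (simp add: sign_swap_id permutation_swap_id sign_compose transpose_def) 
qed

lemma detn_2: "detn 2 M = M 1 1 * M 2 2 - M 1 2 * M 2 1"
proof -
  have s: "{1..2::nat} = {1, 2}" by auto
  have f12: "finite {2::nat}" "1 \<notin> {2::nat}" by auto
  show ?thesis
    unfolding detn_def s sum_over_permutations_insert[OF f12] permutes_sing
    by (simp add: sign_swap_id permutation_swap_id sign_compose transpose_def)
qed

lemma detn_1: "detn (Suc 0) M = M 1 1"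
  by (simp add: detn_def)

section \<open>Skew-adjointness\<close>

text \<open>The three minors of the two columns of quasi-derivatives, ordered so that they are the
  successive quasi-derivatives of the first one, the Wronskian of \<open>Y 0\<close> and
  \<open>Z 0\<close>.\<close>

definition cross :: "(nat \<Rightarrow> real \<Rightarrow> complex) \<Rightarrow> (nat \<Rightarrow> real \<Rightarrow> complex) \<Rightarrow> nat \<Rightarrow> real \<Rightarrow> complex" where
  "cross Y Z k x = (if k = 0 then Y 0 x * Z 1 x - Y 1 x * Z 0 x
     else if k = 1 then Y 0 x * Z 2 x - Y 2 x * Z 0 x else Y 1 x * Z 2 x - Y 2 x * Z 1 x)"

text \<open>On differentiating the minors, the terms with \<open>p\<close> cancel in the first and
  regroup into minors in the others; \<open>lam\<close> cancels in the second and survives in the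
  third with reversed sign.\<close>

lemma sol_cross:
  assumes "sol p lam Y" "sol p lam Z"
  shows "sol p (- lam) (cross Y Z)"
proof -
  have Y: "ac_deriv (Y 0) (Y 1)" "ac_deriv (Y 1) (\<lambda>t. Y 2 t - p t * Y 0 t)"
    "ac_deriv (Y 2) (\<lambda>t. lam * Y 0 t - p t * Y 1 t)" using assms(1) unfolding sol_iff by auto
  have Z: "ac_deriv (Z 0) (Z 1)" "ac_deriv (Z 1) (\<lambda>t. Z 2 t - p t * Z 0 t)"
    "ac_deriv (Z 2) (\<lambda>t. lam * Z 0 t - p t * Z 1 t)" using assms(2) unfolding sol_iff by auto
  note d = ac_deriv_diff[OF ac_deriv_mult ac_deriv_mult]
  have "ac_deriv (cross Y Z 0) (cross Y Z 1)"
    by (rule ac_deriv_cong[OF d[OF Y(1) Z(2) Y(2) Z(1)]]) (auto simp: cross_def algebra_simps)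
  moreover have "ac_deriv (cross Y Z 1) (\<lambda>t. cross Y Z 2 t - p t * cross Y Z 0 t)"
    by (rule ac_deriv_cong[OF d[OF Y(1) Z(3) Y(3) Z(1)]]) (auto simp: cross_def algebra_simps)
  moreover have "ac_deriv (cross Y Z 2) (\<lambda>t. - lam * cross Y Z 0 t - p t * cross Y Z 1 t)"
    by (rule ac_deriv_cong[OF d[OF Y(2) Z(3) Y(3) Z(2)]]) (auto simp: cross_def algebra_simps)
  ultimately show ?thesis unfolding sol_iff by auto
qed

text \<open>At \<open>x = 0\<close> the fundamental matrix is the identity, so the vectors of minors
  are again unit vectors and uniqueness applies.\<close>

lemma cs_cross:
  assumes p: "L1 p" and jx: "j < 3" "x \<in> {0..1}"
  shows "cs p (- lam) 0 j x = cross (cs p lam 0) (cs p lam 1) j x"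
    and "cs p (- lam) 1 j x = cross (cs p lam 0) (cs p lam 2) j x"
    and "cs p (- lam) 2 j x = cross (cs p lam 1) (cs p lam 2) j x"
proof -
  have "cross (cs p lam 0) (cs p lam 1) j x = cs p (- lam) 0 j x"
    by (rule cs_unique[OF p sol_cross[OF cs_sol[OF p] cs_sol[OF p]] _ jx]) (auto simp: cross_def cs_0[OF p])
  then show "cs p (- lam) 0 j x = cross (cs p lam 0) (cs p lam 1) j x" by simp
  have "cross (cs p lam 0) (cs p lam 2) j x = cs p (- lam) 1 j x"
    by (rule cs_unique[OF p sol_cross[OF cs_sol[OF p] cs_sol[OF p]] _ jx]) (auto simp: cross_def cs_0[OF p])
  then show "cs p (- lam) 1 j x = cross (cs p lam 0) (cs p lam 2) j x" by simp
  have "cross (cs p lam 1) (cs p lam 2) j x = cs p (- lam) 2 j x"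
    by (rule cs_unique[OF p sol_cross[OF cs_sol[OF p] cs_sol[OF p]] _ jx]) (auto simp: cross_def cs_0[OF p])
  then show "cs p (- lam) 2 j x = cross (cs p lam 1) (cs p lam 2) j x" by simp
qed

section \<open>Characteristic functions and the solution normalised at the right endpoint\<close>

definition al :: "(real \<Rightarrow> complex) \<Rightarrow> nat \<Rightarrow> complex \<Rightarrow> complex" where
  "al p k lam = cs p lam k 0 1"

lemma al_holomorphic: "L1 p \<Longrightarrow> al p k holomorphic_on UNIV"
  unfolding al_def[abs_def] by (rule cs_holomorphic) auto

lemma al_minus:
  assumes p: "L1 p"
  shows "al p 0 (- lam) = cs p lam 0 0 1 * cs p lam 1 1 1 - cs p lam 0 1 1 * cs p lam 1 0 1"
    and "al p 1 (- lam) = cs p lam 0 0 1 * cs p lam 2 1 1 - cs p lam 0 1 1 * cs p lam 2 0 1"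
    and "al p 2 (- lam) = cs p lam 1 0 1 * cs p lam 2 1 1 - cs p lam 1 1 1 * cs p lam 2 0 1"
proof -
  have *: "(0::nat) < 3" "(1::real) \<in> {0..1}" by auto
  show "al p 0 (- lam) = cs p lam 0 0 1 * cs p lam 1 1 1 - cs p lam 0 1 1 * cs p lam 1 0 1"
    unfolding al_def cs_cross(1)[OF p *] by (simp add: cross_def)
  show "al p 1 (- lam) = cs p lam 0 0 1 * cs p lam 2 1 1 - cs p lam 0 1 1 * cs p lam 2 0 1"
    unfolding al_def cs_cross(2)[OF p *] by (simp add: cross_def)
  show "al p 2 (- lam) = cs p lam 1 0 1 * cs p lam 2 1 1 - cs p lam 1 1 1 * cs p lam 2 0 1"
    unfolding al_def cs_cross(3)[OF p *] by (simp add: cross_def)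
qed

lemma char_det_bc3_1:
  assumes p: "L1 p"
  shows "char_det 3 (F3 p) (bc3 1) lam = al p 0 (- lam)"
  unfolding char_det_def detn_3 al_minus[OF p]
  by (simp add: bc3_def C_form_F3_U[OF p] C_form_F3_V[OF p])

lemma char_det_bc3_2:
  assumes p: "L1 p"
  shows "char_det 3 (F3 p) (bc3 2) lam = - al p 1 (- lam)"
  unfolding char_det_def detn_3 al_minus[OF p]
  by (simp add: bc3_def C_form_F3_U[OF p] C_form_F3_V[OF p])

lemma separation_F3:
  assumes p: "L1 p" and sep: "separation 3 (F3 p)"
  shows "al p 0 lam \<noteq> 0 \<or> al p 0 (- lam) \<noteq> 0"
proof -
  have "Delta_kk 3 (F3 p) 1 lam = al p 0 (- lam)"
    unfolding Delta_kk_def al_minus[OF p]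
    by (simp add: detn_2 C_form_F3_V[OF p])
  moreover have "Delta_kk 3 (F3 p) 2 lam = al p 0 lam"
    unfolding Delta_kk_def al_def
    by (simp add: detn_1 C_form_F3_V[OF p])
  moreover have "\<not> (Delta_kk 3 (F3 p) 1 lam = 0 \<and> Delta_kk 3 (F3 p) 2 lam = 0)"
  proof -
    have "\<not> (\<exists>lam. Delta_kk 3 (F3 p) 1 lam = 0 \<and> Delta_kk 3 (F3 p) (1 + 1) lam = 0)"
      by (rule bspec[OF sep[unfolded separation_def]]) auto
    then show ?thesis unfolding one_add_one by blast
  qed
  ultimately show ?thesis by auto
qed

text \<open>By \<open>al_minus\<close> the values at \<open>- lam\<close> are the minors of the rows
  of zeroth and first quasi-derivatives at 1. The relation is the expansion of a three by three
  determinant in which the zeroth row occurs twice.\<close>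

lemma al_plucker:
  assumes p: "L1 p"
  shows "al p 2 lam * al p 0 (- lam) + al p 0 lam * al p 2 (- lam) = al p 1 lam * al p 1 (- lam)"
  unfolding al_minus[OF p] unfolding al_def by (simp add: algebra_simps)

text \<open>Lagrange identity for a formally skew-adjoint expression: the alternating signs make all
  terms with \<open>p\<close> and \<open>lam\<close> cancel in the derivative.\<close>

lemma sol_pairing_const:
  assumes "sol p lam Y" "sol p (- lam) Z" "x \<in> {0..1}"
  shows "Y 2 x * Z 0 x - Y 1 x * Z 1 x + Y 0 x * Z 2 x = Y 2 0 * Z 0 0 - Y 1 0 * Z 1 0 + Y 0 0 * Z 2 0"
proof -
  have Y: "ac_deriv (Y 0) (Y 1)" "ac_deriv (Y 1) (\<lambda>t. Y 2 t - p t * Y 0 t)"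
    "ac_deriv (Y 2) (\<lambda>t. lam * Y 0 t - p t * Y 1 t)" using assms(1) unfolding sol_iff by auto
  have Z: "ac_deriv (Z 0) (Z 1)" "ac_deriv (Z 1) (\<lambda>t. Z 2 t - p t * Z 0 t)"
    "ac_deriv (Z 2) (\<lambda>t. - lam * Z 0 t - p t * Z 1 t)" using assms(2) unfolding sol_iff by auto
  have "ac_deriv (\<lambda>x. Y 2 x * Z 0 x - Y 1 x * Z 1 x + Y 0 x * Z 2 x) (\<lambda>x. 0)"
    by (rule ac_deriv_cong[OF ac_deriv_add[OF ac_deriv_diff[OF ac_deriv_mult[OF Y(3) Z(1)] ac_deriv_mult[OF Y(2) Z(2)]] ac_deriv_mult[OF Y(1) Z(3)]]])
      (auto simp: algebra_simps)
  from ac_deriv_zero_const[OF this assms(3)] show ?thesis .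
qed

text \<open>\<open>psi p lam\<close> is \<open>al p 0 (- lam)\<close> times the Weyl solution \<open>\<Phi>\<^sub>1\<close>; it is normalised at the endpoint \<open>1\<close>.\<close>

definition psi :: "(real \<Rightarrow> complex) \<Rightarrow> complex \<Rightarrow> nat \<Rightarrow> real \<Rightarrow> complex" where
  "psi p lam j x = al p 0 (- lam) * cs p lam 2 j x - al p 1 (- lam) * cs p lam 1 j x + al p 2 (- lam) * cs p lam 0 j x"

lemma psi_sol:
  assumes p: "L1 p"
  shows "sol p lam (psi p lam)"
proof -
  have "sol p lam (\<lambda>k x. 1 * (al p 0 (- lam) * cs p lam 2 k x + (- al p 1 (- lam)) * cs p lam 1 k x) + al p 2 (- lam) * cs p lam 0 k x)"
    by (intro sol_add_cmult cs_sol[OF p])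
  moreover have "(\<lambda>k x. 1 * (al p 0 (- lam) * cs p lam 2 k x + (- al p 1 (- lam)) * cs p lam 1 k x) + al p 2 (- lam) * cs p lam 0 k x) = psi p lam"
    by (simp add: psi_def fun_eq_iff)
  ultimately show ?thesis by simp
qed

text \<open>At 1, \<open>psi\<close> in order \<open>j\<close> is the determinant obtained by
  adjoining row \<open>j\<close> to rows 0 and 1. A row repeats for \<open>j < 2\<close>; for
  \<open>j = 2\<close> it is the full Wronskian, evaluated through the conserved pairing.\<close>

lemma psi_1:
  assumes p: "L1 p" and "j < 3"
  shows "psi p lam j 1 = (if j = 2 then 1 else 0)"
proof -
  have "psi p lam 0 1 = 0" "psi p lam 1 1 = 0"
    unfolding psi_def al_minus[OF p] by (simp_all add: algebra_simps)
  moreover have "psi p lam 2 1 = 1"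
  proof -
    have "cs p lam 2 2 1 * cs p (- lam) 0 0 1 - cs p lam 2 1 1 * cs p (- lam) 0 1 1 + cs p lam 2 0 1 * cs p (- lam) 0 2 1 = 1"
      using sol_pairing_const[OF cs_sol[OF p] cs_sol[OF p], of 1 lam 2 0] by (simp add: cs_0[OF p])
    moreover have "psi p lam 2 1 = cs p lam 2 2 1 * cs p (- lam) 0 0 1 - cs p lam 2 1 1 * cs p (- lam) 0 1 1 + cs p lam 2 0 1 * cs p (- lam) 0 2 1"
      unfolding psi_def al_minus[OF p] using cs_cross(1)[OF p, of _ 1 lam] by (simp add: cross_def algebra_simps)
    ultimately show ?thesis by simp
  qed
  moreover have "j = 0 \<or> j = 1 \<or> j = 2" using \<open>j < 3\<close> by auto
  ultimately show ?thesis by auto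
qed

lemma absolutely_integrable_reflect_01:
  fixes p :: "real \<Rightarrow> complex"
  assumes "L1 p"
  shows "(\<lambda>x. p (1 - x)) absolutely_integrable_on {0..1}"
proof -
  have *: "(\<lambda>x. f (1 - x)) integrable_on {0..1}" if "f integrable_on {0..1}" for f :: "real \<Rightarrow> 'b::euclidean_space"
  proof -
    have "(f has_integral integral {0..1} f) (cbox 0 1)"
      using that by (simp add: integrable_integral)
    from has_integral_affinity[OF this, of "-1" 1]
    have "((\<lambda>x. f (- x + 1)) has_integral integral {0..1} f) ((\<lambda>x. - x + 1) ` {0..1})" by simp
    moreover have "(\<lambda>x. - x + 1) ` {0..1::real} = {0..1}"
      by (auto simp: image_iff intro: bexI[of _ "1 - _"])
    ultimately show ?thesis by (auto simp: integrable_on_def algebra_simps)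
  qed
  show ?thesis
    using assms *[of p] *[of "\<lambda>x. norm (p x)"] by (auto simp: absolutely_integrable_on_def)
qed

text \<open>Reflection reverses the sign of odd orders, and the equation has odd order 3, hence the
  change from \<open>lam\<close> to \<open>- lam\<close>.\<close>

lemma sol_reflect:
  assumes "sol p lam Y"
  shows "sol (\<lambda>x. p (1 - x)) (- lam) (\<lambda>j x. (-1) ^ j * Y j (1 - x))"
proof -
  have Y: "ac_deriv (Y 0) (Y 1)" "ac_deriv (Y 1) (\<lambda>t. Y 2 t - p t * Y 0 t)"
    "ac_deriv (Y 2) (\<lambda>t. lam * Y 0 t - p t * Y 1 t)" using assms(1) unfolding sol_iff by auto
  show ?thesis
    unfolding sol_iff
  proof (intro conjI)
    show "ac_deriv (\<lambda>x. (- 1) ^ 0 * Y 0 (1 - x)) (\<lambda>x. (- 1) ^ 1 * Y 1 (1 - x))"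
      by (rule ac_deriv_cong[OF ac_deriv_reflect[OF Y(1)]]) auto
    show "ac_deriv (\<lambda>x. (- 1) ^ 1 * Y 1 (1 - x)) (\<lambda>t. (- 1) ^ 2 * Y 2 (1 - t) - p (1 - t) * ((- 1) ^ 0 * Y 0 (1 - t)))"
      by (rule ac_deriv_cong[OF ac_deriv_cmult[OF ac_deriv_reflect[OF Y(2)], of "-1"]]) auto
    show "ac_deriv (\<lambda>x. (- 1) ^ 2 * Y 2 (1 - x)) (\<lambda>t. - lam * ((- 1) ^ 0 * Y 0 (1 - t)) - p (1 - t) * ((- 1) ^ 1 * Y 1 (1 - t)))"
      by (rule ac_deriv_cong[OF ac_deriv_reflect[OF Y(3)]]) auto
  qed
qed

text \<open>Makes every estimate for initial value solutions available for \<open>psi\<close>, with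
  the distance to the endpoint 1 in place of \<open>x\<close>.\<close>

lemma psi_reflect:
  assumes p: "L1 p" and jx: "j < 3" "x \<in> {0..1}"
  shows "psi p lam j x = (-1) ^ j * cs (\<lambda>x. p (1 - x)) (- lam) 2 j (1 - x)"
proof -
  have "(-1) ^ j * psi p lam j (1 - (1 - x)) = cs (\<lambda>x. p (1 - x)) (- lam) 2 j (1 - x)"
    by (rule cs_unique[OF absolutely_integrable_reflect_01[OF p] sol_reflect[OF psi_sol[OF p]]])
      (use jx in \<open>auto simp: psi_1[OF p]\<close>)
  moreover have "(-1 :: complex) ^ j * (-1) ^ j = 1" by (cases "even j") auto
  ultimately show ?thesis
    using mult.assoc[of "(-1) ^ j" "(-1) ^ j" "psi p lam j x"] by simp
qed

section \<open>Estimates for large spectral parameter\<close>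

definition om :: complex where "om = Complex (-1/2) (sqrt 3 / 2)"

lemma om_sq: "om ^ 2 = Complex (-1/2) (- sqrt 3 / 2)"
  by (simp add: om_def power2_eq_square complex_eq_iff)

lemma om_cube: "om ^ 3 = 1"
  by (simp add: power3_eq_cube om_def complex_eq_iff)

lemma om_sum: "1 + om + om ^ 2 = 0"
  unfolding om_sq by (simp add: om_def complex_eq_iff)

lemma norm_om [simp]: "norm om = 1"
  by (simp add: om_def cmod_def power2_eq_square)

lemma om_nonzero [simp]: "om \<noteq> 0"
  by (metis norm_om norm_zero zero_neq_one)

text \<open>Exponential growth rate of the unperturbed equation with spectral parameter
  \<open>\<rho> ^ 3\<close>. It is not an even function of \<open>\<rho>\<close>: solutions at
  \<open>lam\<close> and at \<open>- lam\<close> have different rates.\<close>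

definition mR :: "complex \<Rightarrow> real" where
  "mR \<rho> = max (Re \<rho>) (max (Re (\<rho> * om)) (Re (\<rho> * om ^ 2)))"

lemma Re_le_mR: "i < 3 \<Longrightarrow> Re (\<rho> * om ^ i) \<le> mR \<rho>"
proof -
  assume "i < 3"
  then have "i = 0 \<or> i = 1 \<or> i = 2" by auto
  then show ?thesis by (auto simp: mR_def)
qed

text \<open>A left eigenvector of the system with \<open>p = 0\<close>, for the eigenvalue
  \<open>u\<close> with \<open>u ^ 3 = lam\<close>. In general its derivative is
  \<open>u * Wf u Y x - p x * (u * Y 0 x + Y 1 x)\<close>.\<close>

definition Wf :: "complex \<Rightarrow> (nat \<Rightarrow> real \<Rightarrow> complex) \<Rightarrow> real \<Rightarrow> complex" where
  "Wf u Y x = u ^ 2 * Y 0 x + u * Y 1 x + Y 2 x"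

text \<open>Discrete Fourier inversion over the cube roots of unity; \<open>om_sum\<close> removes
  the unwanted components.\<close>

lemma Wf_inverse:
  assumes "\<rho> \<noteq> 0" "j < 3"
  shows "3 * Y j x = (\<Sum>i<3. Wf (\<rho> * om ^ i) Y x / (\<rho> * om ^ i) ^ (2 - j))"
proof -
  have o3: "om * (om * om) = 1" using om_cube by (simp add: power3_eq_cube mult.assoc)
  have i1: "1 / om = om ^ 2" using o3 by (simp add: field_simps power2_eq_square)
  have i2: "1 / om ^ 2 = om" using o3 by (simp add: field_simps power2_eq_square)
  have i4: "1 / om ^ 4 = om ^ 2"
  proof -
    have "om ^ 4 = om" using om_cube by (simp add: power_eq_if numeral_eq_Suc)
    then show ?thesis using i1 by simp
  qed
  have "j = 0 \<or> j = 1 \<or> j = 2" using \<open>j < 3\<close> by auto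
  then show ?thesis
  proof (elim disjE)
    assume j: "j = 0"
    define a c where "a = Y 1 x / \<rho>" and "c = Y 2 x / \<rho> ^ 2"
    have "Wf (\<rho> * w) Y x / (\<rho> * w) ^ 2 = Y 0 x + a * (1 / w) + c * (1 / w ^ 2)" if "w \<noteq> 0" for w
      using assms(1) that by (simp add: Wf_def a_def c_def field_simps power2_eq_square)
    then have "(\<Sum>i<3. Wf (\<rho> * om ^ i) Y x / (\<rho> * om ^ i) ^ 2) =
       (\<Sum>i<3. Y 0 x + a * (1 / om ^ i) + c * (1 / (om ^ i) ^ 2))" by simp
    also have "\<dots> = 3 * Y 0 x + (1 + 1/om + 1/om^2) * a + (1 + 1/om^2 + 1/om^4) * c"
      by (simp add: sum3 algebra_simps flip: power_mult) (simp add: power2_eq_square)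
    finally have "(\<Sum>i<3. Wf (\<rho> * om ^ i) Y x / (\<rho> * om ^ i) ^ 2) =
       3 * Y 0 x + (1 + 1/om + 1/om^2) * a + (1 + 1/om^2 + 1/om^4) * c" .
    then show ?thesis using om_sum unfolding i1 i2 i4 j by (simp add: add_ac)
  next
    assume j: "j = 1"
    have "(\<Sum>i<3. Wf (\<rho> * om ^ i) Y x / (\<rho> * om ^ i) ^ 1) =
       (1 + om + om^2) * (\<rho> * Y 0 x) + 3 * Y 1 x + (1 + 1/om + 1/om^2) * (Y 2 x / \<rho>)"
      using assms(1) by (simp add: sum3 Wf_def field_simps power2_eq_square)
    then show ?thesis using om_sum unfolding i1 i2 j by (simp add: add_ac)
  next
    assume j: "j = 2"
    have "(\<Sum>i<3. Wf (\<rho> * om ^ i) Y x / (\<rho> * om ^ i) ^ 0) =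
       (1 + om^2 + om^4) * (\<rho>^2 * Y 0 x) + (1 + om + om^2) * (\<rho> * Y 1 x) + 3 * Y 2 x"
      by (simp add: sum3 Wf_def algebra_simps power_mult_distrib flip: power_mult) (simp add: power2_eq_square)
    moreover have "om ^ 4 = om" using om_cube by (simp add: power_eq_if numeral_eq_Suc)
    ultimately show ?thesis using om_sum unfolding j by (simp add: add_ac)
  qed
qed

lemma norm_sol_le:
  assumes "\<rho> \<noteq> 0" "j < 3" "\<And>i. i < 3 \<Longrightarrow> norm (Wf (\<rho> * om ^ i) Y x) \<le> M"
  shows "norm (Y j x) \<le> M / norm \<rho> ^ (2 - j)"
proof -
  have "3 * norm (Y j x) = norm (\<Sum>i<3. Wf (\<rho> * om ^ i) Y x / (\<rho> * om ^ i) ^ (2 - j))"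
    by (subst Wf_inverse[OF assms(1,2), symmetric]) (simp add: norm_mult)
  also have "\<dots> \<le> (\<Sum>i<3::nat. M / norm \<rho> ^ (2 - j))"
    using assms(1,3) by (intro sum_norm_le) (auto simp: norm_divide norm_power norm_mult divide_right_mono)
  also have "\<dots> = 3 * (M / norm \<rho> ^ (2 - j))" by simp
  finally show ?thesis by simp
qed

lemma Wf_continuous_on: "sol p lam Y \<Longrightarrow> continuous_on {0..1} (Wf u Y)"
  unfolding Wf_def[abs_def] by (intro continuous_intros sol_continuous_on) auto

text \<open>For a cube root \<open>u\<close> of the spectral parameter, \<open>exp (- u x) * Wf u Y x\<close> varies only through \<open>p\<close>;
  rescaling by the largest exponential makes the remainder a contraction once \<open>norm \<rho>\<close> exceeds a multiple
  of the \<open>L\<^sub>1\<close> norm of \<open>p\<close>.\<close>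

lemma Wf_variation:
  assumes p: "L1 p" and Y: "sol p (u ^ 3) Y" and "u \<noteq> 0"
    and R: "Re u \<le> R" and x: "x \<in> {0..1}" and "M \<ge> 0"
    and bd0: "\<And>t. t \<in> {0..1} \<Longrightarrow> norm (Y 0 t) \<le> M * exp (R * t) / norm u ^ 2"
    and bd1: "\<And>t. t \<in> {0..1} \<Longrightarrow> norm (Y 1 t) \<le> M * exp (R * t) / norm u"
  shows "norm (Wf u Y x - exp (u * of_real x) * Wf u Y 0) \<le>
    2 * M * integral {0..1} (\<lambda>t. norm (p t)) / norm u * exp (R * x)"
proof -
  have Yd: "ac_deriv (Y 0) (Y 1)" "ac_deriv (Y 1) (\<lambda>t. Y 2 t - p t * Y 0 t)"
    "ac_deriv (Y 2) (\<lambda>t. u ^ 3 * Y 0 t - p t * Y 1 t)" using Y unfolding sol_iff by auto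
  define g where "g t = - (exp (- u * of_real t) * (p t * (u * Y 0 t + Y 1 t)))" for t
  have "ac_deriv (\<lambda>x. exp (- u * of_real x) * Wf u Y x) g"
    unfolding Wf_def
    by (rule ac_deriv_cong[OF ac_deriv_mult[OF ac_deriv_exp[of "-u"] ac_deriv_add[OF ac_deriv_add[OF ac_deriv_cmult[OF Yd(1), of "u^2"] ac_deriv_cmult[OF Yd(2), of u]] Yd(3)]]])
      (auto simp: g_def algebra_simps power2_eq_square power3_eq_cube)
  from ac_deriv_has_integral[OF this, of 0 x] x
  have gi: "(g has_integral (exp (- u * of_real x) * Wf u Y x - Wf u Y 0)) {0..x}" by simp
  have "norm (exp (- u * of_real x) * Wf u Y x - Wf u Y 0) \<le>
      integral {0..x} (\<lambda>t. exp ((R - Re u) * x) * (2 * M / norm u) * norm (p t))"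
    unfolding integral_unique[OF gi, symmetric]
  proof (rule integral_norm_bound_integral)
    show "g integrable_on {0..x}" using gi by blast
    have "p absolutely_integrable_on {0..x}"
      using x by (intro absolutely_integrable_on_subinterval[OF p]) auto
    then show "(\<lambda>t. exp ((R - Re u) * x) * (2 * M / norm u) * norm (p t)) integrable_on {0..x}"
      by (intro integrable_on_mult_right) (auto simp: absolutely_integrable_on_def)
    fix t assume t: "t \<in> {0..x}"
    then have t1: "t \<in> {0..1}" using x by auto
    have "norm (u * Y 0 t + Y 1 t) \<le> norm u * norm (Y 0 t) + norm (Y 1 t)"
      using norm_triangle_ineq[of "u * Y 0 t" "Y 1 t"] by (simp add: norm_mult)
    also have "\<dots> \<le> norm u * (M * exp (R * t) / norm u ^ 2) + M * exp (R * t) / norm u"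
      using bd0[OF t1] bd1[OF t1] by (intro add_mono mult_left_mono) auto
    also have "\<dots> = 2 * M / norm u * exp (R * t)"
      using \<open>u \<noteq> 0\<close> by (simp add: field_simps power2_eq_square)
    finally have "norm (g t) \<le> exp (- Re u * t) * (norm (p t) * (2 * M / norm u * exp (R * t)))"
      unfolding g_def norm_minus_cancel norm_mult
      by (intro mult_mono mult_left_mono) (auto simp: norm_exp_eq_Re)
    also have "\<dots> = exp ((R - Re u) * t) * (2 * M / norm u) * norm (p t)"
      by (simp add: exp_add[symmetric] algebra_simps)
    also have "\<dots> \<le> exp ((R - Re u) * x) * (2 * M / norm u) * norm (p t)"
      using R t \<open>M \<ge> 0\<close> by (intro mult_right_mono) (auto intro!: mult_left_mono)
    finally show "norm (g t) \<le> exp ((R - Re u) * x) * (2 * M / norm u) * norm (p t)" .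
  qed
  also have "\<dots> = exp ((R - Re u) * x) * (2 * M / norm u) * integral {0..x} (\<lambda>t. norm (p t))"
    by simp
  also have "\<dots> \<le> exp ((R - Re u) * x) * (2 * M / norm u) * integral {0..1} (\<lambda>t. norm (p t))"
  proof (rule mult_left_mono)
    have "p absolutely_integrable_on {0..x}"
      using x by (intro absolutely_integrable_on_subinterval[OF p]) auto
    then show "integral {0..x} (\<lambda>t. norm (p t)) \<le> integral {0..1} (\<lambda>t. norm (p t))"
      using p x by (intro integral_subset_le) (auto simp: absolutely_integrable_on_def)
  qed (use \<open>M \<ge> 0\<close> in auto)
  finally have le: "norm (exp (- u * of_real x) * Wf u Y x - Wf u Y 0) \<le>
      exp ((R - Re u) * x) * (2 * M / norm u) * integral {0..1} (\<lambda>t. norm (p t))" .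
  have "Wf u Y x - exp (u * of_real x) * Wf u Y 0 = exp (u * of_real x) * (exp (- u * of_real x) * Wf u Y x - Wf u Y 0)"
    by (simp add: algebra_simps mult_exp_exp)
  then have "norm (Wf u Y x - exp (u * of_real x) * Wf u Y 0) = exp (Re u * x) * norm (exp (- u * of_real x) * Wf u Y x - Wf u Y 0)"
    by (simp add: norm_mult norm_exp_eq_Re)
  also have "\<dots> \<le> exp (Re u * x) * (exp ((R - Re u) * x) * (2 * M / norm u) * integral {0..1} (\<lambda>t. norm (p t)))"
    using le by (intro mult_left_mono) auto
  also have "\<dots> = (exp (Re u * x) * exp ((R - Re u) * x)) * (2 * M / norm u * integral {0..1} (\<lambda>t. norm (p t)))"
    by (simp add: mult_ac)
  also have "exp (Re u * x) * exp ((R - Re u) * x) = exp (R * x)"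
    by (simp add: mult_exp_exp algebra_simps)
  finally show ?thesis by (simp add: mult_ac)
qed

text \<open>A bootstrap: \<open>Wf_variation\<close> asks for an a priori bound, and the weighted
  maximum of the solution itself supplies it. The size condition on \<open>norm \<rho>\<close> lets
  half of that maximum be absorbed.\<close>

lemma sol_asymptotics:
  assumes p: "L1 p" and Y: "sol p (\<rho> ^ 3) Y" and "\<rho> \<noteq> 0"
    and large: "4 * integral {0..1} (\<lambda>t. norm (p t)) \<le> norm \<rho>"
    and B: "\<And>i. i < 3 \<Longrightarrow> norm (Wf (\<rho> * om ^ i) Y 0) \<le> B"
    and x: "x \<in> {0..1}" and i: "i < 3"
  shows "norm (Wf (\<rho> * om ^ i) Y x) \<le> 2 * B * exp (mR \<rho> * x)"
    and "norm (Wf (\<rho> * om ^ i) Y x - exp (\<rho> * om ^ i * of_real x) * Wf (\<rho> * om ^ i) Y 0) \<le>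
       4 * B * integral {0..1} (\<lambda>t. norm (p t)) / norm \<rho> * exp (mR \<rho> * x)"
proof -
  define P where "P = integral {0..1} (\<lambda>t. norm (p t))"
  have P0: "P \<ge> 0" unfolding P_def using p by (intro integral_nonneg) (auto simp: absolutely_integrable_on_def)
  define G where "G t = exp (- mR \<rho> * t) * max (norm (Wf \<rho> Y t)) (max (norm (Wf (\<rho> * om) Y t)) (norm (Wf (\<rho> * om ^ 2) Y t)))" for t
  have "continuous_on {0..1} G"
    unfolding G_def[abs_def] by (intro continuous_intros continuous_on_max Wf_continuous_on[OF Y])
  then obtain s where s: "s \<in> {0..1}" "\<And>t. t \<in> {0..1} \<Longrightarrow> G t \<le> G s"
    using continuous_attains_sup[of "{0..1}" G] by auto
  define M where "M = G s"
  have M0: "M \<ge> 0" by (auto simp: M_def G_def le_max_iff_disj)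
  have B0: "B \<ge> 0" using B[of 0] by (auto intro: order_trans[OF norm_ge_zero])
  have Wle: "norm (Wf (\<rho> * om ^ i) Y t) \<le> M * exp (mR \<rho> * t)" if "t \<in> {0..1}" "i < 3" for t i
  proof -
    have "i = 0 \<or> i = 1 \<or> i = 2" using that by auto
    then have "exp (- mR \<rho> * t) * norm (Wf (\<rho> * om ^ i) Y t) \<le> G t"
      unfolding G_def by (intro mult_left_mono) (auto simp: le_max_iff_disj)
    also have "\<dots> \<le> M" using s that by (simp add: M_def)
    finally have "exp (mR \<rho> * t) * (exp (- mR \<rho> * t) * norm (Wf (\<rho> * om ^ i) Y t)) \<le> exp (mR \<rho> * t) * M"
      by (intro mult_left_mono) auto
    then show ?thesis by (simp add: mult.assoc[symmetric] mult_exp_exp mult.commute)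
  qed
  have var: "norm (Wf (\<rho> * om ^ i) Y t - exp (\<rho> * om ^ i * of_real t) * Wf (\<rho> * om ^ i) Y 0) \<le>
      2 * M * P / norm \<rho> * exp (mR \<rho> * t)" if "t \<in> {0..1}" "i < 3" for t i
  proof -
    have "(om ^ i) ^ 3 = 1"
      by (metis mult.commute om_cube power_mult power_one)
    then have c: "(\<rho> * om ^ i) ^ 3 = \<rho> ^ 3" by (simp add: power_mult_distrib)
    have nu: "norm (\<rho> * om ^ i) = norm \<rho>" by (simp add: norm_mult norm_power)
    have "norm (Wf (\<rho> * om ^ i) Y t - exp (\<rho> * om ^ i * of_real t) * Wf (\<rho> * om ^ i) Y 0) \<le>
      2 * M * integral {0..1} (\<lambda>t. norm (p t)) / norm (\<rho> * om ^ i) * exp (mR \<rho> * t)"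
    proof (rule Wf_variation[OF p])
      show "sol p ((\<rho> * om ^ i) ^ 3) Y" unfolding c by (rule Y)
      show "norm (Y 0 t) \<le> M * exp (mR \<rho> * t) / norm (\<rho> * om ^ i) ^ 2" if "t \<in> {0..1}" for t
        using norm_sol_le[OF \<open>\<rho> \<noteq> 0\<close>, of 0 Y t] Wle[OF that] unfolding nu by simp
      show "norm (Y 1 t) \<le> M * exp (mR \<rho> * t) / norm (\<rho> * om ^ i)" if "t \<in> {0..1}" for t
        using norm_sol_le[OF \<open>\<rho> \<noteq> 0\<close>, of 1 Y t] Wle[OF that] unfolding nu by simp
    qed (use \<open>\<rho> \<noteq> 0\<close> that M0 Re_le_mR in auto)
    then show ?thesis unfolding nu P_def .
  qed
  have step: "norm (Wf (\<rho> * om ^ i) Y t) \<le> (B + M / 2) * exp (mR \<rho> * t)" if t: "t \<in> {0..1}" "i < 3" for t i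
  proof -
    have "norm (exp (\<rho> * om ^ i * of_real t) * Wf (\<rho> * om ^ i) Y 0) \<le> exp (mR \<rho> * t) * B"
    proof -
      have "Re (\<rho> * om ^ i) * t \<le> mR \<rho> * t" using Re_le_mR[OF t(2)] t by (intro mult_right_mono) auto
      then show ?thesis unfolding norm_mult using B[OF t(2)]
        by (intro mult_mono) (auto simp: norm_exp_eq_Re)
    qed
    moreover have "2 * M * P / norm \<rho> * exp (mR \<rho> * t) \<le> M / 2 * exp (mR \<rho> * t)"
    proof (rule mult_right_mono)
      have "M * (4 * P) \<le> M * norm \<rho>" using large M0 by (intro mult_left_mono) (auto simp: P_def)
      then show "2 * M * P / norm \<rho> \<le> M / 2" using \<open>\<rho> \<noteq> 0\<close> by (simp add: field_simps)
    qed simp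
    moreover have "norm (Wf (\<rho> * om ^ i) Y t) \<le> norm (Wf (\<rho> * om ^ i) Y t - exp (\<rho> * om ^ i * of_real t) * Wf (\<rho> * om ^ i) Y 0)
        + norm (exp (\<rho> * om ^ i * of_real t) * Wf (\<rho> * om ^ i) Y 0)"
      using norm_triangle_ineq[of "Wf (\<rho> * om ^ i) Y t - exp (\<rho> * om ^ i * of_real t) * Wf (\<rho> * om ^ i) Y 0"
          "exp (\<rho> * om ^ i * of_real t) * Wf (\<rho> * om ^ i) Y 0"] by simp
    moreover have "(B + M / 2) * exp (mR \<rho> * t) = exp (mR \<rho> * t) * B + M / 2 * exp (mR \<rho> * t)"
      by (simp add: algebra_simps)
    ultimately show ?thesis using var[OF t] by linarith
  qed
  \<comment> \<open>The bound from \<open>step\<close> at the point where the maximum is attained;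
    the right-hand \<open>M\<close> can then be moved to the left.\<close>
  have "M \<le> B + M / 2"
  proof -
    have "norm (Wf \<rho> Y s) \<le> (B + M / 2) * exp (mR \<rho> * s)" "norm (Wf (\<rho> * om) Y s) \<le> (B + M / 2) * exp (mR \<rho> * s)"
      "norm (Wf (\<rho> * om ^ 2) Y s) \<le> (B + M / 2) * exp (mR \<rho> * s)"
      using step[OF s(1), of 0] step[OF s(1), of 1] step[OF s(1), of 2] by simp_all
    then have "M \<le> exp (- mR \<rho> * s) * ((B + M / 2) * exp (mR \<rho> * s))"
      unfolding M_def G_def[of s] by (intro mult_left_mono) auto
    also have "exp (- mR \<rho> * s) * ((B + M / 2) * exp (mR \<rho> * s)) = B + M / 2"
      by (simp add: exp_minus field_simps)
    finally show ?thesis .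
  qed
  then have M2: "M \<le> 2 * B" by simp
  have "norm (Wf (\<rho> * om ^ i) Y x) \<le> M * exp (mR \<rho> * x)" by (rule Wle[OF x i])
  also have "\<dots> \<le> 2 * B * exp (mR \<rho> * x)" using M2 by (intro mult_right_mono) auto
  finally show "norm (Wf (\<rho> * om ^ i) Y x) \<le> 2 * B * exp (mR \<rho> * x)" .
  have "norm (Wf (\<rho> * om ^ i) Y x - exp (\<rho> * om ^ i * of_real x) * Wf (\<rho> * om ^ i) Y 0) \<le>
      2 * M * P / norm \<rho> * exp (mR \<rho> * x)" by (rule var[OF x i])
  also have "\<dots> \<le> 2 * (2 * B) * P / norm \<rho> * exp (mR \<rho> * x)"
    using M2 P0 by (intro mult_right_mono divide_right_mono mult_left_mono) auto
  finally show "norm (Wf (\<rho> * om ^ i) Y x - exp (\<rho> * om ^ i * of_real x) * Wf (\<rho> * om ^ i) Y 0) \<le>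
       4 * B * integral {0..1} (\<lambda>t. norm (p t)) / norm \<rho> * exp (mR \<rho> * x)"
    by (simp add: P_def)
qed

lemma Wf_cs_0:
  assumes p: "L1 p" and "k < 3"
  shows "Wf u (cs p lam k) 0 = u ^ (2 - k)"
proof -
  have "k = 0 \<or> k = 1 \<or> k = 2" using \<open>k < 3\<close> by auto
  then show ?thesis by (auto simp: Wf_def cs_0[OF p])
qed

lemma norm_Wf_cs_0:
  assumes p: "L1 p" and "k < 3"
  shows "norm (Wf (\<rho> * om ^ i) (cs p lam k) 0) \<le> norm \<rho> ^ (2 - k)"
  unfolding Wf_cs_0[OF assms] by (simp add: norm_power norm_mult)

lemma cs_bound:
  assumes p: "L1 p" and "\<rho> \<noteq> 0"
    and large: "4 * integral {0..1} (\<lambda>t. norm (p t)) \<le> norm \<rho>"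
    and kj: "k < 3" "j < 3" and x: "x \<in> {0..1}"
  shows "norm (cs p (\<rho> ^ 3) k j x) \<le> 2 * norm \<rho> ^ j / norm \<rho> ^ k * exp (mR \<rho> * x)"
proof -
  have "norm (cs p (\<rho> ^ 3) k j x) \<le> (2 * norm \<rho> ^ (2 - k) * exp (mR \<rho> * x)) / norm \<rho> ^ (2 - j)"
    using sol_asymptotics(1)[OF p cs_sol[OF p] \<open>\<rho> \<noteq> 0\<close> large norm_Wf_cs_0[OF p kj(1)] x]
    by (rule norm_sol_le[OF \<open>\<rho> \<noteq> 0\<close> kj(2)])
  also have "\<dots> = 2 * (norm \<rho> ^ (2 - k) / norm \<rho> ^ (2 - j)) * exp (mR \<rho> * x)" by simp
  also have "norm \<rho> ^ (2 - k) / norm \<rho> ^ (2 - j) = norm \<rho> ^ j / norm \<rho> ^ k"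
  proof -
    have "norm \<rho> ^ (2 - k) * norm \<rho> ^ k = norm \<rho> ^ j * norm \<rho> ^ (2 - j)"
      using kj by (simp flip: power_add)
    then show ?thesis using \<open>\<rho> \<noteq> 0\<close> by (simp add: field_simps)
  qed
  finally show ?thesis by simp
qed

text \<open>Three times the leading term of \<open>\<rho> ^ k * al p k (\<rho> ^ 3)\<close>. The
  base \<open>om ^ 2\<close> is the inverse of \<open>om\<close>: the weights come from
  \<open>1 / (om ^ i) ^ k\<close>.\<close>

definition Esum :: "nat \<Rightarrow> complex \<Rightarrow> complex" where
  "Esum k \<rho> = (\<Sum>i<3. ((om ^ 2) ^ k) ^ i * exp (\<rho> * om ^ i))"

lemma al_asymptotics:
  assumes p: "L1 p" and "\<rho> \<noteq> 0"
    and large: "4 * integral {0..1} (\<lambda>t. norm (p t)) \<le> norm \<rho>" and k: "k < 3"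
  shows "norm (\<rho> ^ k * al p k (\<rho> ^ 3) - Esum k \<rho> / 3) \<le> 4 * integral {0..1} (\<lambda>t. norm (p t)) / norm \<rho> * exp (mR \<rho>)"
proof -
  define P where "P = integral {0..1} (\<lambda>t. norm (p t))"
  have inv: "1 / om = om ^ 2"
    using om_cube by (simp add: field_simps power2_eq_square power3_eq_cube)
  have inv2: "1 / om ^ i = (om ^ 2) ^ i" for i using inv by (metis power_one_over)
  let ?W = "\<lambda>i. Wf (\<rho> * om ^ i) (cs p (\<rho> ^ 3) k)"
  have e0: "\<rho> ^ k * ?W i 0 / (\<rho> * om ^ i) ^ 2 = ((om ^ 2) ^ k) ^ i" for i
  proof -
    have "(\<rho> * om ^ i) ^ 2 = (\<rho> * om ^ i) ^ (2 - k) * (\<rho> * om ^ i) ^ k" using k by (simp flip: power_add)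
    then have "\<rho> ^ k * ?W i 0 / (\<rho> * om ^ i) ^ 2 = \<rho> ^ k / (\<rho> * om ^ i) ^ k"
      using \<open>\<rho> \<noteq> 0\<close> by (simp add: Wf_cs_0[OF p k])
    also have "\<dots> = 1 / (om ^ i) ^ k" using \<open>\<rho> \<noteq> 0\<close> by (simp add: power_mult_distrib)
    also have "\<dots> = (1 / om ^ i) ^ k" by (simp add: power_one_over)
    also have "\<dots> = ((om ^ 2) ^ k) ^ i" unfolding inv2 by (simp add: power_mult[symmetric] mult_ac)
    finally show ?thesis .
  qed
  have "3 * (\<rho> ^ k * al p k (\<rho> ^ 3)) - Esum k \<rho> =
      (\<Sum>i<3. \<rho> ^ k * (?W i 1 - exp (\<rho> * om ^ i * of_real 1) * ?W i 0) / (\<rho> * om ^ i) ^ 2)"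
  proof -
    have "3 * (\<rho> ^ k * al p k (\<rho> ^ 3)) = \<rho> ^ k * (3 * cs p (\<rho> ^ 3) k 0 1)" by (simp add: al_def)
    also have "\<dots> = (\<Sum>i<3. \<rho> ^ k * (?W i 1 / (\<rho> * om ^ i) ^ 2))"
      by (subst Wf_inverse[OF \<open>\<rho> \<noteq> 0\<close>]) (simp_all add: sum_distrib_left)
    finally have 1: "3 * (\<rho> ^ k * al p k (\<rho> ^ 3)) = (\<Sum>i<3. \<rho> ^ k * (?W i 1 / (\<rho> * om ^ i) ^ 2))" .
    have 2: "Esum k \<rho> = (\<Sum>i<3. (\<rho> ^ k * ?W i 0 / (\<rho> * om ^ i) ^ 2) * exp (\<rho> * om ^ i))"
      unfolding Esum_def e0 ..
    show ?thesis unfolding 1 2 sum_subtractf[symmetric]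
      by (intro sum.cong) (auto simp: right_diff_distrib diff_divide_distrib mult_ac)
  qed
  then have "norm (3 * (\<rho> ^ k * al p k (\<rho> ^ 3)) - Esum k \<rho>) \<le> (\<Sum>i<3::nat. 4 * P / norm \<rho> * exp (mR \<rho>))"
  proof (simp only:, intro sum_norm_le)
    fix i :: nat assume "i \<in> {..<3}"
    then have "norm (?W i 1 - exp (\<rho> * om ^ i * of_real 1) * ?W i 0) \<le> 4 * norm \<rho> ^ (2 - k) * P / norm \<rho> * exp (mR \<rho> * 1)"
      unfolding P_def
      by (intro sol_asymptotics(2)[OF p cs_sol[OF p] \<open>\<rho> \<noteq> 0\<close> large norm_Wf_cs_0[OF p k]]) auto
    then have "norm \<rho> ^ k * norm (?W i 1 - exp (\<rho> * om ^ i * of_real 1) * ?W i 0) / norm \<rho> ^ 2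
        \<le> norm \<rho> ^ k * (4 * norm \<rho> ^ (2 - k) * P / norm \<rho> * exp (mR \<rho> * 1)) / norm \<rho> ^ 2"
      by (intro divide_right_mono mult_left_mono) auto
    also have "\<dots> = (norm \<rho> ^ k * norm \<rho> ^ (2 - k)) / norm \<rho> ^ 2 * (4 * P / norm \<rho> * exp (mR \<rho>))" by (simp add: mult_ac)
    also have "(norm \<rho> ^ k * norm \<rho> ^ (2 - k)) / norm \<rho> ^ 2 = 1"
      using k \<open>\<rho> \<noteq> 0\<close> by (simp flip: power_add)
    finally show "norm (\<rho> ^ k * (?W i 1 - exp (\<rho> * om ^ i * of_real 1) * ?W i 0) / (\<rho> * om ^ i) ^ 2) \<le> 4 * P / norm \<rho> * exp (mR \<rho>)"
      by (simp add: norm_mult norm_divide norm_power)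
  qed
  then have "norm (3 * (\<rho> ^ k * al p k (\<rho> ^ 3) - Esum k \<rho> / 3)) \<le> 3 * (4 * P / norm \<rho> * exp (mR \<rho>))"
    by (simp add: right_diff_distrib)
  then have "norm (3 :: complex) * norm (\<rho> ^ k * al p k (\<rho> ^ 3) - Esum k \<rho> / 3) \<le> 3 * (4 * P / norm \<rho> * exp (mR \<rho>))"
    unfolding norm_mult[of 3] .
  then have "norm (\<rho> ^ k * al p k (\<rho> ^ 3) - Esum k \<rho> / 3) \<le> 4 * P / norm \<rho> * exp (mR \<rho>)"
    by (simp only: norm_numeral mult_le_cancel_left_pos zero_less_numeral)
  then show ?thesis unfolding P_def .
qed

lemma om_pow_3_eq: "om ^ (3 * m) = 1"
  by (simp add: power_mult om_cube)

text \<open>Rotation by \<open>om\<close> permutes the exponentials cyclically, up to an overall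
  factor of modulus one. Together with conjugation this reduces the lower bound to the sector where
  \<open>Re u\<close> is maximal and \<open>Im u\<close> is nonnegative.\<close>

lemma Esum_om: "norm (Esum k (\<rho> * om)) = norm (Esum k \<rho>)"
proof -
  define z where "z = (om ^ 2) ^ k"
  have z3: "z ^ 3 = 1"
    unfolding z_def using om_pow_3_eq[of "2 * k"] by (simp add: mult_ac flip: power_mult)
  have nz: "norm z = 1" by (simp add: z_def norm_power)
  have o3: "\<rho> * om * om ^ 2 = \<rho>" using om_cube by (simp add: power2_eq_square power3_eq_cube mult.assoc)
  have "Esum k \<rho> = exp \<rho> + z * exp (\<rho> * om) + z ^ 2 * exp (\<rho> * om ^ 2)"
    unfolding Esum_def z_def[symmetric] by (simp add: sum3)
  moreover have "Esum k (\<rho> * om) = exp (\<rho> * om) + z * exp (\<rho> * om ^ 2) + z ^ 2 * exp \<rho>"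
  proof -
    have "\<rho> * om * om = \<rho> * om ^ 2" by (simp add: power2_eq_square mult.assoc)
    with o3 show ?thesis unfolding Esum_def z_def[symmetric]
      by (simp only: sum3 power_0 power_one_right mult_1_left mult_1_right)
  qed
  ultimately have "z * Esum k (\<rho> * om) = Esum k \<rho>"
    using z3 by (simp add: algebra_simps power2_eq_square power3_eq_cube)
  then have "norm z * norm (Esum k (\<rho> * om)) = norm (Esum k \<rho>)" by (metis norm_mult)
  then show ?thesis using nz by simp
qed

lemma mR_om: "mR (\<rho> * om) = mR \<rho>"
proof -
  have o3: "\<rho> * om * om ^ 2 = \<rho>" using om_cube by (simp add: power2_eq_square power3_eq_cube mult.assoc)
  have o2: "\<rho> * om * om = \<rho> * om ^ 2" by (simp add: power2_eq_square mult.assoc)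
  show ?thesis unfolding mR_def o3 o2 by (simp add: max.commute max.left_commute)
qed

lemma cnj_om: "cnj om = om ^ 2"
  unfolding om_sq by (simp add: om_def complex_eq_iff)

lemma cnj_om_sq: "cnj (om ^ 2) = om"
  unfolding om_sq by (simp add: om_def complex_eq_iff)

lemma mR_cnj: "mR (cnj \<rho>) = mR \<rho>"
proof -
  have "cnj (\<rho> * om ^ 2) = cnj \<rho> * om" "cnj (\<rho> * om) = cnj \<rho> * om ^ 2"
    by (simp_all only: complex_cnj_mult cnj_om cnj_om_sq)
  then have "Re (cnj \<rho> * om) = Re (\<rho> * om ^ 2)" "Re (cnj \<rho> * om ^ 2) = Re (\<rho> * om)"
    by (metis complex_cnj(1) complex.sel(1) cnj.sel(1))+
  then show ?thesis unfolding mR_def cnj.sel by (simp only: max.commute)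
qed

lemma Esum_cnj: "Esum k (cnj \<rho>) = cnj (Esum k \<rho>)"
proof -
  define z where "z = (om ^ 2) ^ k"
  have z4: "z ^ 4 = z"
    unfolding z_def using om_pow_3_eq[of "2 * k"]
    by (simp add: power_add[of _ 1 3, simplified] mult_ac flip: power_mult)
  have cz: "cnj z = z ^ 2"
  proof -
    have "om ^ 4 = om" using om_cube by (simp add: power_eq_if numeral_eq_Suc)
    then have "z ^ 2 = om ^ k" unfolding z_def by (metis mult.commute mult_2_right numeral_Bit0 power_mult)
    moreover have "cnj z = om ^ k" unfolding z_def complex_cnj_power[of _ k] cnj_om_sq ..
    ultimately show ?thesis by simp
  qed
  have e: "Esum k \<rho> = exp \<rho> + z * exp (\<rho> * om) + z ^ 2 * exp (\<rho> * om ^ 2)" for \<rho>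
    unfolding Esum_def z_def[symmetric] by (simp add: sum3)
  have "cnj (Esum k \<rho>) = exp (cnj \<rho>) + z ^ 2 * exp (cnj \<rho> * om ^ 2) + z ^ 4 * exp (cnj \<rho> * om)"
    unfolding e complex_cnj_add complex_cnj_mult complex_cnj_power[of z] cz exp_cnj complex_cnj_mult cnj_om cnj_om_sq
    by (simp flip: power_mult)
  then show ?thesis unfolding z4 by (simp add: e)
qed

text \<open>On \<open>sqrt 3 * norm \<rho> = 2 * pi * n\<close> the two leading exponentials are almost in phase wherever their moduli are
  comparable, so with cube roots of unity as weights they cannot cancel.\<close>

lemma Esum_lower_base:
  assumes k: "k < 2" and n: "2 \<le> n" and nu: "sqrt 3 * norm u = 2 * pi * real n"
    and max: "Re u = mR u" and Im: "0 \<le> Im u"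
  shows "exp (mR u) / 4 \<le> norm (Esum k u)"
proof -
  define q where "q = sqrt (3::real)"
  have q: "q * q = 3" "q > 0" by (auto simp: q_def)
  have q2: "q \<le> 2"
  proof (rule ccontr)
    assume "\<not> q \<le> 2"
    then have "2 * 2 < q * q" by (intro mult_strict_mono) auto
    then show False using q by simp
  qed
  define s t where "s = Re u" and "t = Im u"
  have t0: "t \<ge> 0" using Im by (simp add: t_def)
  have "Re (u * om ^ 2) \<le> s" using Re_le_mR[of 2 u] max by (simp add: s_def)
  then have "q * t \<le> 3 * s" unfolding om_sq by (simp add: s_def t_def q_def field_simps)
  \<comment> \<open>In this sector \<open>om ^ 2\<close> gives the second largest exponential. Its
    ratio to the largest is \<open>exp (u * (om ^ 2 - 1))\<close>, with exponent of real part
    \<open>- \<sigma>\<close> and imaginary part \<open>- \<tau>\<close>, hence of modulus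
    \<open>A\<close>.\<close>
  define \<sigma> \<tau> where "\<sigma> = (3 * s - q * t) / 2" and "\<tau> = (3 * t + q * s) / 2"
  have \<sigma>0: "\<sigma> \<ge> 0" using \<open>q * t \<le> 3 * s\<close> by (simp add: \<sigma>_def)
  have s0: "s \<ge> 0" using \<open>q * t \<le> 3 * s\<close> t0 q by (smt (verit) mult_nonneg_nonneg)
  have \<tau>0: "\<tau> \<ge> 0" using s0 t0 q by (simp add: \<tau>_def)
  define A where "A = 2 * pi * real n"
  have A: "A \<ge> 12"
  proof -
    have "2 * 3 * 2 \<le> 2 * pi * real n" using pi_gt3 n by (intro mult_mono) auto
    then show ?thesis by (simp add: A_def)
  qed
  have nu2: "(norm u)\<^sup>2 = s\<^sup>2 + t\<^sup>2" by (simp add: cmod_def s_def t_def)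
  have A2: "A\<^sup>2 = 3 * (s\<^sup>2 + t\<^sup>2)"
  proof -
    have "A\<^sup>2 = (q * norm u)\<^sup>2" using nu by (simp add: A_def q_def)
    then show ?thesis using q nu2 by (simp add: power_mult_distrib power2_eq_square[of q])
  qed
  have st: "\<sigma>\<^sup>2 + \<tau>\<^sup>2 = A\<^sup>2"
  proof -
    have "4 * (\<sigma>\<^sup>2 + \<tau>\<^sup>2) = (9 + q * q) * (s\<^sup>2 + t\<^sup>2)"
    proof -
      have "4 * \<sigma>\<^sup>2 = (3 * s - q * t)\<^sup>2" "4 * \<tau>\<^sup>2 = (3 * t + q * s)\<^sup>2"
        by (simp_all add: \<sigma>_def \<tau>_def power_divide)
      then show ?thesis by (simp add: power2_eq_square algebra_simps)
    qed
    then show ?thesis using q A2 by simp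
  qed
  \<comment> \<open>The third exponential has relative exponent at most \<open>- 3 / 2 * s\<close>,
    which this pushes below \<open>- 4\<close>.\<close>
  have s3: "s \<ge> 3"
  proof -
    have "(q * t)\<^sup>2 \<le> (3 * s)\<^sup>2" using \<open>q * t \<le> 3 * s\<close> q t0 by (intro power_mono) auto
    then have "3 * t\<^sup>2 \<le> 9 * s\<^sup>2" using q by (simp add: power_mult_distrib power2_eq_square[of q])
    then have "A\<^sup>2 \<le> 12 * s\<^sup>2" using A2 by simp
    moreover have "12\<^sup>2 \<le> A\<^sup>2" using A by (intro power_mono) auto
    ultimately have "3\<^sup>2 \<le> s\<^sup>2" by simp
    then show ?thesis using s0 by (rule power2_le_imp_le)
  qed
  define z where "z = (om ^ 2) ^ k"
  have nz: "norm z = 1" by (simp add: z_def norm_power)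
  \<comment> \<open>Because \<open>A\<close> is a multiple of \<open>2 * pi\<close>, the phase
    \<open>- \<tau>\<close> may be replaced by the small angle \<open>A - \<tau>\<close>.\<close>
  define \<delta> where "\<delta> = A - \<tau>"
  have dz: "exp (u * (om ^ 2 - 1)) = of_real (exp (- \<sigma>)) * cis \<delta>"
  proof -
    have "u * (om ^ 2 - 1) = Complex (- \<sigma>) (- \<tau>)"
      unfolding om_sq by (simp add: complex_eq_iff \<sigma>_def \<tau>_def s_def t_def q_def field_simps)
    then have "exp (u * (om ^ 2 - 1)) = of_real (exp (- \<sigma>)) * cis (- \<tau>)"
      by (simp add: exp_eq_polar)
    moreover have "cis \<delta> = cis (- \<tau>)"
    proof -
      have "A = 2 * real n * pi" by (simp add: A_def)
      then have "cis A = 1" by (simp add: complex_eq_iff cos_2npi sin_2npi)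
      then show ?thesis using cis_mult[of A "- \<tau>"] by (simp add: \<delta>_def)
    qed
    ultimately show ?thesis by simp
  qed
  \<comment> \<open>Either the second term has modulus at most 1/2, or \<open>\<sigma> < 1\<close>,
    and then \<open>\<delta> * (A + \<tau>) = \<sigma>\<^sup>2\<close> forces
    \<open>\<delta> \<le> 1/12\<close>. The margin 1/3 leaves 1/4 after subtracting the third term,
    which is at most 1/16.\<close>
  have main: "1/3 \<le> norm (1 + z ^ 2 * exp (u * (om ^ 2 - 1)))"
  proof (cases "\<sigma> \<ge> 1")
    case True
    have "exp (- \<sigma>) \<le> 1/2"
    proof -
      have "2 \<le> exp \<sigma>" using exp_ge_add_one_self[of \<sigma>] True by linarith
      then show ?thesis by (simp add: exp_minus field_simps)
    qed
    then have "norm (z ^ 2 * exp (u * (om ^ 2 - 1))) \<le> 1/2"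
      unfolding dz by (simp add: norm_mult norm_power nz)
    then show ?thesis
      using norm_diff_ineq[of 1 "z ^ 2 * exp (u * (om ^ 2 - 1))"] by simp
  next
    case False
    have "\<tau> \<le> A"
    proof (rule power2_le_imp_le)
      show "\<tau>\<^sup>2 \<le> A\<^sup>2" using st by (metis le_add_same_cancel2 zero_le_power2)
    qed (use A in simp)
    then have \<delta>0: "\<delta> \<ge> 0" by (simp add: \<delta>_def)
    have "\<delta> * (A + \<tau>) = \<sigma>\<^sup>2" using st by (simp add: \<delta>_def power2_eq_square algebra_simps)
    also have "\<dots> \<le> 1" using False \<sigma>0 by (simp add: power_le_one)
    finally have "\<delta> * (A + \<tau>) \<le> 1" .
    moreover have "\<delta> * 12 \<le> \<delta> * (A + \<tau>)" using A \<tau>0 \<delta>0 by (intro mult_left_mono) auto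
    ultimately have \<delta>1: "\<delta> \<le> 1/12" by simp
    \<comment> \<open>For \<open>k = 0\<close> the weight is 1; for \<open>k = 1\<close> it is
      \<open>om\<close>, with real part \<open>- 1/2\<close>, and the small angle costs at most
      another 1/12. Cancellation would need a value near \<open>- 1\<close>.\<close>
    have Rez: "- (2/3) \<le> Re (z ^ 2 * cis \<delta>)"
    proof -
      have "k = 0 \<or> k = 1" using k by auto
      then show ?thesis
      proof
        assume "k = 0"
        then have "Re (z ^ 2 * cis \<delta>) = cos \<delta>" by (simp add: z_def)
        moreover have "cos \<delta> \<ge> 0" using \<delta>0 \<delta>1 pi_gt3 by (intro cos_ge_zero) auto
        ultimately show ?thesis by simp
      next
        assume "k = 1"
        moreover have "(om ^ 2) ^ 2 = om" using om_cube by (simp add: power_eq_if numeral_eq_Suc flip: power_mult)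
        ultimately have "z ^ 2 = om" by (simp add: z_def)
        then have "Re (z ^ 2 * cis \<delta>) = - (cos \<delta> / 2) - q / 2 * sin \<delta>" by (simp add: om_def q_def)
        moreover have "cos \<delta> \<le> 1" by simp
        moreover have "q / 2 * sin \<delta> \<le> 1 * \<delta>"
          using q q2 \<delta>0 \<delta>1 sin_x_le_x[of \<delta>] sin_ge_zero[of \<delta>] pi_gt3 by (intro mult_mono) auto
        ultimately show ?thesis using \<delta>1 by linarith
      qed
    qed
    have "exp (- \<sigma>) * (- (2/3)) \<le> exp (- \<sigma>) * Re (z ^ 2 * cis \<delta>)"
      using Rez by (intro mult_left_mono) auto
    moreover have "exp (- \<sigma>) \<le> 1" using \<sigma>0 by simp
    ultimately have "- (2/3) \<le> exp (- \<sigma>) * Re (z ^ 2 * cis \<delta>)" by linarith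
    moreover have "z ^ 2 * exp (u * (om ^ 2 - 1)) = of_real (exp (- \<sigma>)) * (z ^ 2 * cis \<delta>)"
      unfolding dz by simp
    then have "Re (1 + z ^ 2 * exp (u * (om ^ 2 - 1))) = 1 + exp (- \<sigma>) * Re (z ^ 2 * cis \<delta>)"
      by (simp only: plus_complex.sel one_complex.sel times_complex.sel Re_complex_of_real Im_complex_of_real)
    ultimately have "1/3 \<le> Re (1 + z ^ 2 * exp (u * (om ^ 2 - 1)))" by linarith
    then show ?thesis using complex_Re_le_cmod order_trans by blast
  qed
  have third: "norm (z * exp (u * (om - 1))) \<le> 1/16"
  proof -
    have "Re (u * (om - 1)) = - (3/2 * s) - q / 2 * t"
      by (simp add: om_def s_def t_def q_def field_simps)
    also have "\<dots> \<le> - 4"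
    proof -
      have "0 \<le> q / 2 * t" using t0 q by simp
      then show ?thesis using s3 by linarith
    qed
    finally have "norm (z * exp (u * (om - 1))) \<le> exp (- 4)"
      by (simp add: norm_mult nz norm_exp_eq_Re)
    also have "exp (- 4 :: real) \<le> 1/16"
    proof -
      have "(2::real) ^ 4 \<le> exp 1 ^ 4" using exp_ge_add_one_self[of 1] by (intro power_mono) auto
      also have "exp 1 ^ 4 = exp (4::real)" by (simp flip: exp_of_nat_mult)
      finally show ?thesis by (simp add: exp_minus field_simps)
    qed
    finally show ?thesis .
  qed
  have "Esum k u = exp u * ((1 + z ^ 2 * exp (u * (om ^ 2 - 1))) + z * exp (u * (om - 1)))"
    unfolding Esum_def z_def[symmetric]
    by (simp add: sum3 algebra_simps mult_exp_exp)
  then have "norm (Esum k u) = exp s * norm ((1 + z ^ 2 * exp (u * (om ^ 2 - 1))) + z * exp (u * (om - 1)))"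
    by (simp add: norm_mult norm_exp_eq_Re s_def)
  moreover have "1/4 \<le> norm ((1 + z ^ 2 * exp (u * (om ^ 2 - 1))) + z * exp (u * (om - 1)))"
    using main third norm_diff_ineq[of "1 + z ^ 2 * exp (u * (om ^ 2 - 1))" "z * exp (u * (om - 1))"] by linarith
  then have "exp s * (1/4) \<le> exp s * norm ((1 + z ^ 2 * exp (u * (om ^ 2 - 1))) + z * exp (u * (om - 1)))"
    by (intro mult_left_mono) auto
  ultimately show ?thesis using max by (simp add: s_def)
qed

lemma Esum_lower:
  assumes k: "k < 2" and n: "2 \<le> n" and nu: "sqrt 3 * norm \<rho> = 2 * pi * real n"
  shows "exp (mR \<rho>) / 4 \<le> norm (Esum k \<rho>)"
proof -
  have inv: "mR (\<rho> * om ^ i) = mR \<rho> \<and> norm (Esum k (\<rho> * om ^ i)) = norm (Esum k \<rho>)" for i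
  proof (induction i)
    case (Suc i)
    have eq: "\<rho> * om ^ Suc i = \<rho> * om ^ i * om" by (simp add: mult_ac)
    show ?case unfolding eq using Suc mR_om[of "\<rho> * om ^ i"] Esum_om[of k "\<rho> * om ^ i"] by simp
  qed simp
  have "mR \<rho> = Re (\<rho> * om ^ 0) \<or> mR \<rho> = Re (\<rho> * om ^ 1) \<or> mR \<rho> = Re (\<rho> * om ^ 2)"
    by (auto simp: mR_def max_def)
  then obtain i where i: "mR \<rho> = Re (\<rho> * om ^ i)" by blast
  define u where "u = \<rho> * om ^ i"
  have u: "Re u = mR u" "norm u = norm \<rho>" "mR u = mR \<rho>" "norm (Esum k u) = norm (Esum k \<rho>)"
    using i inv[of i] by (auto simp: u_def norm_mult norm_power)
  show ?thesis
  proof (cases "Im u \<ge> 0")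
    case True
    then show ?thesis using Esum_lower_base[OF k n, of u] u nu by simp
  next
    case False
    then show ?thesis using Esum_lower_base[OF k n, of "cnj u"] u nu by (simp add: mR_cnj Esum_cnj)
  qed
qed

text \<open>After division by 3 the leading term is at least \<open>exp (mR \<rho>) / 12\<close>;
  the factor 96 keeps the error \<open>4 * P / norm \<rho>\<close> at 1/24, so half of the leading
  term survives.\<close>

lemma al_lower:
  assumes p: "L1 p" and k: "k < 2" and n: "2 \<le> n"
    and nu: "sqrt 3 * norm \<rho> = 2 * pi * real n"
    and large: "96 * integral {0..1} (\<lambda>t. norm (p t)) \<le> norm \<rho>"
  shows "exp (mR \<rho>) / 24 \<le> norm \<rho> ^ k * norm (al p k (\<rho> ^ 3))"
proof -
  define P where "P = integral {0..1} (\<lambda>t. norm (p t))"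
  have P0: "P \<ge> 0" unfolding P_def using p by (intro integral_nonneg) (auto simp: absolutely_integrable_on_def)
  have "sqrt 3 * norm \<rho> > 0" using nu n by simp
  then have r0: "norm \<rho> > 0" by (simp add: zero_less_mult_iff)
  then have "\<rho> \<noteq> 0" by auto
  have "norm (\<rho> ^ k * al p k (\<rho> ^ 3) - Esum k \<rho> / 3) \<le> 4 * P / norm \<rho> * exp (mR \<rho>)"
    unfolding P_def by (rule al_asymptotics[OF p \<open>\<rho> \<noteq> 0\<close>]) (use large k P0 in \<open>auto simp: P_def\<close>)
  also have "\<dots> \<le> 1/24 * exp (mR \<rho>)"
    using large r0 by (intro mult_right_mono) (auto simp: P_def field_simps)
  finally have "norm (\<rho> ^ k * al p k (\<rho> ^ 3) - Esum k \<rho> / 3) \<le> exp (mR \<rho>) / 24" by simp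
  moreover have "exp (mR \<rho>) / 12 \<le> norm (Esum k \<rho> / 3)"
    using Esum_lower[OF k n nu] by (simp add: norm_divide)
  moreover have "norm (Esum k \<rho> / 3) - norm (\<rho> ^ k * al p k (\<rho> ^ 3)) \<le> norm (\<rho> ^ k * al p k (\<rho> ^ 3) - Esum k \<rho> / 3)"
    using norm_triangle_ineq2[of "Esum k \<rho> / 3" "\<rho> ^ k * al p k (\<rho> ^ 3)"] by (simp add: norm_minus_commute)
  ultimately have "exp (mR \<rho>) / 24 \<le> norm (\<rho> ^ k * al p k (\<rho> ^ 3))" by simp
  then show ?thesis by (simp add: norm_mult norm_power)
qed

section \<open>Entire functions on circles\<close>

text \<open>Maximum modulus principle. Every point of the circle of radius \<open>r ^ 3\<close> is a
  cube \<open>\<rho> ^ 3\<close> with \<open>norm \<rho> = r\<close>, so bounds stated in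
  \<open>\<rho>\<close> cover the whole circle in the spectral plane.\<close>

lemma norm_le_on_circles:
  assumes f: "f holomorphic_on UNIV" and "n \<ge> 1"
    and b: "\<And>\<rho>. sqrt 3 * norm \<rho> = 2 * pi * real n \<Longrightarrow> norm (f (\<rho> ^ 3)) \<le> B"
    and z: "norm z < (2 * pi * real n / sqrt 3) ^ 3"
  shows "norm (f z) \<le> B"
proof (rule maximum_modulus_frontier[of f "ball 0 ((2 * pi * real n / sqrt 3) ^ 3)"])
  define r where "r = 2 * pi * real n / sqrt 3"
  have r0: "r > 0" using \<open>n \<ge> 1\<close> by (simp add: r_def)
  show "f holomorphic_on interior (ball 0 ((2 * pi * real n / sqrt 3) ^ 3))"
    using f holomorphic_on_subset by blast
  show "continuous_on (closure (ball 0 ((2 * pi * real n / sqrt 3) ^ 3))) f"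
    using f holomorphic_on_imp_continuous_on continuous_on_subset by blast
  show "norm (f w) \<le> B" if "w \<in> frontier (ball 0 ((2 * pi * real n / sqrt 3) ^ 3))" for w
  proof -
    have nw: "norm w = r ^ 3" using that r0 by (simp add: r_def)
    then have "w \<noteq> 0" using r0 by auto
    define \<rho> where "\<rho> = exp (Ln w / 3)"
    have w: "\<rho> ^ 3 = w" using \<open>w \<noteq> 0\<close> by (simp add: \<rho>_def exp_of_nat_mult[symmetric])
    then have "norm \<rho> ^ 3 = r ^ 3" using nw by (simp flip: norm_power)
    then have "norm \<rho> = r" using r0 by (simp add: power_eq_iff_eq_base)
    then have "sqrt 3 * norm \<rho> = 2 * pi * real n" by (simp add: r_def)
    from b[OF this] w show ?thesis by simp
  qed
  show "z \<in> ball 0 ((2 * pi * real n / sqrt 3) ^ 3)" using z by simp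
qed simp

lemma entire_zero_if_small_on_circles:
  assumes f: "f holomorphic_on UNIV" and B: "B \<longlonglongrightarrow> 0"
    and b: "\<And>n \<rho>. n \<ge> N \<Longrightarrow> sqrt 3 * norm \<rho> = 2 * pi * real n \<Longrightarrow> norm (f (\<rho> ^ 3)) \<le> B n"
  shows "f z = 0"
proof -
  have "filterlim (\<lambda>n. (2 * pi * real n / sqrt 3) ^ 3) at_top sequentially" by real_asymp
  then have "\<forall>\<^sub>F n in sequentially. norm z < (2 * pi * real n / sqrt 3) ^ 3"
    by (simp add: filterlim_at_top_dense)
  then have "\<forall>\<^sub>F n in sequentially. norm (f z) \<le> B n"
    using eventually_ge_at_top[of "max 1 N"]
    by eventually_elim (rule norm_le_on_circles[OF f], use b in auto)
  then have "norm (f z) \<le> 0"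
    by (intro tendsto_lowerbound[OF B]) auto
  then show ?thesis by simp
qed

lemma entire_const_if_bounded_on_circles:
  assumes f: "f holomorphic_on UNIV"
    and b: "\<And>n \<rho>. n \<ge> N \<Longrightarrow> sqrt 3 * norm \<rho> = 2 * pi * real n \<Longrightarrow> norm (f (\<rho> ^ 3)) \<le> B"
  obtains c where "\<And>z. f z = c"
proof -
  have "norm (f z) \<le> B" for z
  proof -
    have "filterlim (\<lambda>n. (2 * pi * real n / sqrt 3) ^ 3) at_top sequentially" by real_asymp
    then have "\<forall>\<^sub>F n in sequentially. norm z < (2 * pi * real n / sqrt 3) ^ 3"
      by (simp add: filterlim_at_top_dense)
    then have "\<forall>\<^sub>F n in sequentially. norm (f z) \<le> B"
      using eventually_ge_at_top[of "max 1 N"]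
      by eventually_elim (rule norm_le_on_circles[OF f], use b in auto)
    then show ?thesis by simp
  qed
  then have "bounded (range f)" by (auto simp: bounded_iff)
  from Liouville_theorem[OF f this] show ?thesis
    unfolding constant_on_def using that by auto
qed

lemma zero_mult_factor:
  assumes g: "g holomorphic_on UNIV" and "zero_mult g z = enat k"
  obtains r h where "r > 0" "h holomorphic_on ball z r" "\<And>w. w \<in> ball z r \<Longrightarrow> g w = (w - z) ^ k * h w"
    "\<And>w. w \<in> ball z r \<Longrightarrow> h w \<noteq> 0"
proof -
  have ex: "\<exists>k. (deriv ^^ k) g z \<noteq> 0"
    using assms(2) by (auto simp: zero_mult_def split: if_splits)
  have k: "k = (LEAST k. (deriv ^^ k) g z \<noteq> 0)"
    using assms(2) by (auto simp: zero_mult_def split: if_splits)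
  have nz: "(deriv ^^ k) g z \<noteq> 0" unfolding k using ex by (rule LeastI_ex)
  have zz: "(deriv ^^ i) g z = 0" if "i < k" for i using that not_less_Least unfolding k by blast
  show ?thesis
  proof (cases "k = 0")
    case True
    then have "g z \<noteq> 0" using nz by simp
    moreover have "continuous (at z) g"
      using g by (metis holomorphic_on_imp_continuous_on continuous_on_eq_continuous_at open_UNIV UNIV_I)
    ultimately obtain r where r: "r > 0" "\<And>w. dist z w < r \<Longrightarrow> g w \<noteq> 0"
      using continuous_at_avoid[of z g 0] by blast
    show ?thesis
    proof (rule that[of r g])
      show "g holomorphic_on ball z r" using g by (rule holomorphic_on_subset) simp
    qed (use r True in auto)
  next
    case False
    obtain h r where h: "0 < r" "h holomorphic_on ball z r"
      "\<And>w. w \<in> ball z r \<Longrightarrow> g w - g z = (w - z) ^ k * h w" "\<And>w. w \<in> ball z r \<Longrightarrow> h w \<noteq> 0"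
    proof -
      have k0: "0 < k" using False by simp
      show ?thesis
      proof (rule holomorphic_factor_order_of_zero[OF g open_UNIV UNIV_I k0 nz])
        show "(deriv ^^ i) g z = 0" if "i < k" for i by (rule zz[OF that])
      qed (rule that)
    qed
    moreover have "g z = 0" using zz[of 0] False by simp
    ultimately show ?thesis using that[of r h] by auto
  qed
qed

text \<open>Equal finite orders make the powers of \<open>w - z\<close> cancel in the local
  factorisations. The point \<open>w0\<close> rules out infinite order, which would make
  \<open>g\<close> vanish identically.\<close>

lemma entire_quotient:
  assumes f: "f holomorphic_on UNIV" and g: "g holomorphic_on UNIV" and "g w0 \<noteq> 0"
    and eq: "zero_mult f = zero_mult g"
  obtains Q where "Q holomorphic_on UNIV" "\<And>z. f z = g z * Q z"
proof -
  have loc: "\<exists>r h. r > 0 \<and> h holomorphic_on ball z r \<and> (\<forall>w\<in>ball z r. f w = g w * h w) \<and>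
      (\<forall>w\<in>ball z r - {z}. g w \<noteq> 0)" for z
  proof -
    have "zero_mult g z \<noteq> \<infinity>"
    proof
      assume "zero_mult g z = \<infinity>"
      then have "(deriv ^^ n) g z = 0" for n by (auto simp: zero_mult_def split: if_splits)
      from holomorphic_fun_eq_0_on_connected[OF g open_UNIV connected_UNIV this] \<open>g w0 \<noteq> 0\<close>
      show False by auto
    qed
    then obtain k where k: "zero_mult g z = enat k" by auto
    then have kf: "zero_mult f z = enat k" using eq by simp
    obtain r h where h: "r > 0" "h holomorphic_on ball z r" "\<And>w. w \<in> ball z r \<Longrightarrow> g w = (w - z) ^ k * h w"
      "\<And>w. w \<in> ball z r \<Longrightarrow> h w \<noteq> 0" using zero_mult_factor[OF g k] by metis
    obtain r' h' where h': "r' > 0" "h' holomorphic_on ball z r'" "\<And>w. w \<in> ball z r' \<Longrightarrow> f w = (w - z) ^ k * h' w"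
      "\<And>w. w \<in> ball z r' \<Longrightarrow> h' w \<noteq> 0" using zero_mult_factor[OF f kf] by metis
    show ?thesis
    proof (intro exI[of _ "min r r'"] exI[of _ "\<lambda>w. h' w / h w"] conjI ballI)
      show "(\<lambda>w. h' w / h w) holomorphic_on ball z (min r r')"
        using h(2,4) h'(2) by (intro holomorphic_on_divide) (auto elim!: holomorphic_on_subset)
      show "f w = g w * (h' w / h w)" if "w \<in> ball z (min r r')" for w
        using that h(3,4)[of w] h'(3)[of w] by simp
      show "g w \<noteq> 0" if "w \<in> ball z (min r r') - {z}" for w
        using that h(3,4)[of w] by auto
    qed (use h h' in auto)
  qed
  then obtain r h where rh: "\<And>z. r z > 0" "\<And>z. h z holomorphic_on ball z (r z)"
    "\<And>z w. w \<in> ball z (r z) \<Longrightarrow> f w = g w * h z w" "\<And>z w. w \<in> ball z (r z) - {z} \<Longrightarrow> g w \<noteq> 0"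
    by metis
  \<comment> \<open>At a zero of \<open>g\<close> the value is that of the local quotient at its
    centre, which is what makes \<open>Q\<close> agree with each local quotient on its whole
    disc.\<close>
  define Q where "Q z = (if g z \<noteq> 0 then f z / g z else h z z)" for z
  have Qh: "Q w = h z w" if "w \<in> ball z (r z)" for z w
    using rh(3)[OF that] rh(4)[of w z] that by (cases "w = z") (auto simp: Q_def)
  show ?thesis
  proof (rule that[of Q])
    show "Q holomorphic_on UNIV"
    proof -
      have "Q holomorphic_on (\<Union>z\<in>UNIV. ball z (r z))"
      proof (rule holomorphic_on_UN_open)
        show "Q holomorphic_on ball z (r z)" for z
          using rh(2)[of z] by (rule holomorphic_transform) (simp add: Qh)
      qed auto
      moreover have "(\<Union>z\<in>UNIV. ball z (r z)) = UNIV" using rh(1) by (auto intro!: centre_in_ball[THEN iffD2])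
      ultimately show ?thesis by simp
    qed
    show "f z = g z * Q z" for z
      using rh(3)[of z z] rh(1)[of z] by (simp add: Q_def)
  qed
qed

section \<open>Recovering the potential\<close>

text \<open>On the positive axis the other two exponentials stay bounded while \<open>exp t\<close>
  dominates. The limit does not depend on the potential, and so fixes the constant left open by
  Liouville's theorem.\<close>

lemma al_limit:
  assumes p: "L1 p" and k: "k < 3"
  shows "((\<lambda>t. of_real t ^ k * al p k (of_real t ^ 3) / exp (of_real t)) \<longlongrightarrow> 1/3) at_top"
proof -
  define P where "P = integral {0..1} (\<lambda>t. norm (p t))"
  have "((\<lambda>t. of_real t ^ k * al p k (of_real t ^ 3) / exp (of_real t) - 1/3) \<longlongrightarrow> 0) at_top"
  proof (rule Lim_null_comparison)
    show "((\<lambda>t. 4 * P / t + 2 * exp (- t)) \<longlongrightarrow> 0) at_top" by real_asymp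
    show "\<forall>\<^sub>F t in at_top. norm (of_real t ^ k * al p k (of_real t ^ 3) / exp (of_real t) - 1/3) \<le> 4 * P / t + 2 * exp (- t)"
      using eventually_ge_at_top[of "max 1 (4 * P)"]
    proof eventually_elim
      case (elim t)
      then have t: "t \<ge> 1" "4 * P \<le> t" by auto
      have Re: "Re (of_real t * om) = - t / 2" "Re (of_real t * om ^ 2) = - t / 2"
        unfolding om_sq by (simp_all add: om_def)
      then have mRt: "mR (of_real t) = t" using t by (simp add: mR_def)
      have 1: "norm (of_real t ^ k * al p k (of_real t ^ 3) - Esum k (of_real t) / 3) \<le> 4 * P / t * exp t"
        using al_asymptotics[OF p _ _ k, of "of_real t"] t unfolding mRt P_def by auto
      have "Esum k (of_real t) - exp (of_real t) = (om ^ 2) ^ k * exp (of_real t * om) + ((om ^ 2) ^ k) ^ 2 * exp (of_real t * om ^ 2)"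
        unfolding Esum_def by (simp add: sum3)
      also have "norm \<dots> \<le> exp (- t / 2) + exp (- t / 2)"
        by (rule norm_triangle_le) (simp only: norm_mult norm_power norm_om norm_exp_eq_Re Re, simp)
      also have "\<dots> \<le> 1 + 1" using t by (intro add_mono) auto
      finally have 2: "norm (Esum k (of_real t) - exp (of_real t)) \<le> 2" by simp
      define w where "w = of_real t ^ k * al p k (of_real t ^ 3)"
      have "w / exp (of_real t) - 1/3 = (w - Esum k (of_real t) / 3 + (Esum k (of_real t) - exp (of_real t)) / 3) / exp (of_real t)"
        by (simp add: field_simps)
      then have "norm (w / exp (of_real t) - 1/3) = norm (w - Esum k (of_real t) / 3 + (Esum k (of_real t) - exp (of_real t)) / 3) / exp t"
        by (simp add: norm_divide norm_exp_eq_Re)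
      also have "\<dots> \<le> (4 * P / t * exp t + 2) / exp t"
      proof (rule divide_right_mono)
        have "norm ((Esum k (of_real t) - exp (of_real t)) / 3) \<le> 2"
          using 2 by (simp add: norm_divide)
        then show "norm (w - Esum k (of_real t) / 3 + (Esum k (of_real t) - exp (of_real t)) / 3) \<le> 4 * P / t * exp t + 2"
          using 1 unfolding w_def by (intro norm_triangle_le add_mono)
      qed simp
      also have "\<dots> = 4 * P / t + 2 * exp (- t)" by (simp only: add_divide_distrib) (simp add: exp_minus divide_inverse)
      finally show ?case by (simp add: w_def)
    qed
  qed
  then show ?thesis by (rule LIM_zero_cancel)
qed

lemma norm_ge_on_large_circles:
  "\<exists>N\<ge>2. \<forall>n\<ge>N. \<forall>\<rho>::complex. sqrt 3 * norm \<rho> = 2 * pi * real n \<longrightarrow> K \<le> norm \<rho> \<and> \<rho> \<noteq> 0"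
proof -
  obtain N :: nat where N: "sqrt 3 * K \<le> real N" using real_arch_simple by blast
  show ?thesis
  proof (intro exI[of _ "max 2 N"] conjI allI impI)
    fix n and \<rho> :: complex assume n: "n \<ge> max 2 N" and rho: "sqrt 3 * norm \<rho> = 2 * pi * real n"
    have "sqrt 3 * K \<le> real n * 1" using N n by auto
    also have "\<dots> \<le> real n * (2 * pi)" using pi_gt3 by (intro mult_left_mono) auto
    also have "\<dots> = sqrt 3 * norm \<rho>" using rho by simp
    finally show "K \<le> norm \<rho>" by simp
    show "\<rho> \<noteq> 0" using rho n by auto
  qed simp
qed

lemma integral_norm_nonneg:
  fixes p :: "real \<Rightarrow> complex"
  shows "p absolutely_integrable_on S \<Longrightarrow> 0 \<le> integral S (\<lambda>t. norm (p t))"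
  by (intro integral_nonneg) (auto simp: absolutely_integrable_on_def)

text \<open>On the circles, \<open>cs_bound\<close> contributes the factor 2 above and
  \<open>al_lower\<close> the factor 1/24 below, whence the bound 48 for the quotient. Both are
  applied at \<open>- \<rho>\<close>, since the spectra determine the functions of
  \<open>- z\<close>.\<close>

lemma al_eqI:
  assumes p: "L1 p" and q: "L1 q" and k: "k < 2"
    and Q: "Q holomorphic_on UNIV" and eq: "\<And>z. al p k (- z) = al q k (- z) * Q z"
  shows "al p k z = al q k z"
proof -
  define K where "K = 96 * integral {0..1} (\<lambda>t. norm (p t)) + 96 * integral {0..1} (\<lambda>t. norm (q t))"
  note P0 = integral_norm_nonneg[OF p] integral_norm_nonneg[OF q]
  obtain N where N2: "N \<ge> 2" and N: "\<And>n (\<rho>::complex). \<lbrakk>n \<ge> N; sqrt 3 * norm \<rho> = 2 * pi * real n\<rbrakk> \<Longrightarrow> K \<le> norm \<rho> \<and> \<rho> \<noteq> 0"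
    using norm_ge_on_large_circles[of K] by auto
  have bd: "norm (Q (\<rho> ^ 3)) \<le> 48" if n: "n \<ge> N" and rho: "sqrt 3 * norm \<rho> = 2 * pi * real n" for n \<rho>
  proof -
    have K: "K \<le> norm \<rho>" and r: "\<rho> \<noteq> 0" using N[OF n rho] by auto
    have m3: "- (\<rho> ^ 3) = (- \<rho>) ^ 3" by simp
    have low: "exp (mR (- \<rho>)) / 24 \<le> norm \<rho> ^ k * norm (al q k ((- \<rho>) ^ 3))"
      using al_lower[OF q k, of n "- \<rho>"] n N2 rho K P0 by (simp add: K_def)
    have up: "norm (al p k ((- \<rho>) ^ 3)) \<le> 2 * norm \<rho> ^ 0 / norm \<rho> ^ k * exp (mR (- \<rho>) * 1)"
      using cs_bound[OF p, of "- \<rho>" k 0 1] r k K P0 unfolding al_def by (auto simp: K_def)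
    have "norm \<rho> ^ k * (norm (al q k ((- \<rho>) ^ 3)) * norm (Q (\<rho> ^ 3))) = norm \<rho> ^ k * norm (al p k ((- \<rho>) ^ 3))"
      using eq[of "\<rho> ^ 3"] unfolding m3 by (simp add: norm_mult)
    also have "\<dots> \<le> 2 * exp (mR (- \<rho>))"
      using mult_left_mono[OF up, of "norm \<rho> ^ k"] r by simp
    finally have "norm \<rho> ^ k * norm (al q k ((- \<rho>) ^ 3)) * norm (Q (\<rho> ^ 3)) \<le> 2 * exp (mR (- \<rho>))"
      by (simp add: mult.assoc)
    moreover have "exp (mR (- \<rho>)) / 24 * norm (Q (\<rho> ^ 3)) \<le> norm \<rho> ^ k * norm (al q k ((- \<rho>) ^ 3)) * norm (Q (\<rho> ^ 3))"
      using low by (intro mult_right_mono) auto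
    ultimately have "exp (mR (- \<rho>)) / 24 * norm (Q (\<rho> ^ 3)) \<le> 2 * exp (mR (- \<rho>))" by linarith
    then have "exp (mR (- \<rho>)) * norm (Q (\<rho> ^ 3)) \<le> exp (mR (- \<rho>)) * 48" by simp
    then show ?thesis by simp
  qed
  obtain c where c: "\<And>z. Q z = c"
    using entire_const_if_bounded_on_circles[OF Q, of N 48] bd by blast
  have pc: "al p k z = al q k z * c" for z using eq[of "- z"] c by simp
  have "((\<lambda>t. (of_real t ^ k * al q k (of_real t ^ 3) / exp (of_real t)) * c) \<longlongrightarrow> 1/3 * c) at_top"
    by (intro tendsto_mult al_limit[OF q] tendsto_const) (use k in simp)
  then have "((\<lambda>t. of_real t ^ k * al p k (of_real t ^ 3) / exp (of_real t)) \<longlongrightarrow> 1/3 * c) at_top"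
    unfolding pc by (simp add: mult_ac)
  moreover have "((\<lambda>t. of_real t ^ k * al p k (of_real t ^ 3) / exp (of_real t)) \<longlongrightarrow> 1/3) at_top"
    by (rule al_limit[OF p]) (use k in simp)
  ultimately have "1/3 * c = 1/3"
    by (rule tendsto_unique[OF trivial_limit_at_top_linorder])
  then show ?thesis using pc by simp
qed

lemma al_not_identically_zero:
  assumes p: "L1 p" and k: "k < 2"
  shows "\<exists>z. al p k z \<noteq> 0"
proof (rule ccontr)
  assume "\<nexists>z. al p k z \<noteq> 0"
  then have "((\<lambda>t::real. 0) \<longlongrightarrow> (1/3::complex)) at_top" using al_limit[OF p, of k] k by simp
  then show False by (simp add: tendsto_const_iff)
qed

lemma holomorphic_minus_arg:
  assumes "f holomorphic_on UNIV"
  shows "(\<lambda>z. f (- z)) holomorphic_on UNIV"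
  using holomorphic_on_compose_gen[OF holomorphic_on_minus[OF holomorphic_on_ident] assms]
  by (simp add: o_def)

text \<open>The constant \<open>c\<close> accommodates the sign in the characteristic determinant of
  the second problem.\<close>

lemma al_eq_if_zero_mult_eq:
  assumes p: "L1 p" and q: "L1 q" and k: "k < 2"
    and "c \<noteq> 0" and z: "zero_mult (\<lambda>z. c * al p k (- z)) = zero_mult (\<lambda>z. c * al q k (- z))"
  shows "al p k z = al q k z"
proof -
  have hol: "(\<lambda>z. c * al p k (- z)) holomorphic_on UNIV" if "L1 p" for p
    by (intro holomorphic_on_mult holomorphic_on_const holomorphic_minus_arg al_holomorphic[OF that])
  obtain w where "al q k w \<noteq> 0" using al_not_identically_zero[OF q k] by blast
  then have nz: "c * al q k (- (- w)) \<noteq> 0" using \<open>c \<noteq> 0\<close> by simp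
  obtain Q where "Q holomorphic_on UNIV" "\<And>z. c * al p k (- z) = c * al q k (- z) * Q z"
    by (rule entire_quotient[OF hol[OF p] hol[OF q] nz z]) (rule that)
  then show ?thesis using \<open>c \<noteq> 0\<close> by (intro al_eqI[OF p q k, of Q]) auto
qed

lemma al2_eq:
  assumes p: "L1 p" and q: "L1 q"
    and sep: "separation 3 (F3 p)"
    and a0: "\<And>z. al p 0 z = al q 0 z" and a1: "\<And>z. al p 1 z = al q 1 z"
  shows "al p 2 z = al q 2 z"
proof -
  define a where "a = al p 0"
  define b where "b z = al p 2 z - al q 2 z" for z
  have ha: "a holomorphic_on UNIV" unfolding a_def by (rule al_holomorphic[OF p])
  have hb: "b holomorphic_on UNIV" unfolding b_def
    by (intro holomorphic_on_diff al_holomorphic[OF p] al_holomorphic[OF q])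
  \<comment> \<open>Difference of the Pluecker relations for \<open>p\<close> and \<open>q\<close>:
    the right-hand sides agree and only the terms with index 2 differ.\<close>
  have rel: "b z * a (- z) = - (a z * b (- z))" for z
    using al_plucker[OF p, of z] al_plucker[OF q, of z] unfolding a_def b_def a0 a1
    by (simp add: algebra_simps)
  have sepa: "a z \<noteq> 0 \<or> a (- z) \<noteq> 0" for z using separation_F3[OF p sep] by (simp add: a_def)
  \<comment> \<open>By separation, one of the two expressions for \<open>b z / a z\<close> provided by \<open>rel\<close> is always defined.\<close>
  define D where "D z = (if a z \<noteq> 0 then b z / a z else - (b (- z) / a (- z)))" for z
  let ?A = "{z. a z \<noteq> 0}" and ?B = "{z. a (- z) \<noteq> 0}"
  have oA: "open ?A"
    by (intro open_Collect_neq holomorphic_on_imp_continuous_on[OF ha] continuous_on_const)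
  have oB: "open ?B"
    by (intro open_Collect_neq holomorphic_on_imp_continuous_on[OF holomorphic_minus_arg[OF ha]] continuous_on_const)
  have hA: "D holomorphic_on ?A"
  proof (rule holomorphic_transform)
    show "(\<lambda>z. b z / a z) holomorphic_on ?A"
      by (rule holomorphic_on_divide) (auto intro: holomorphic_on_subset[OF ha] holomorphic_on_subset[OF hb])
  qed (auto simp: D_def)
  have hB: "D holomorphic_on ?B"
  proof (rule holomorphic_transform)
    show "(\<lambda>z. - (b (- z) / a (- z))) holomorphic_on ?B"
      by (intro holomorphic_on_minus holomorphic_on_divide)
        (auto intro: holomorphic_on_subset[OF holomorphic_minus_arg[OF ha]] holomorphic_on_subset[OF holomorphic_minus_arg[OF hb]])
    show "- (b (- z) / a (- z)) = D z" if "z \<in> ?B" for z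
      using that rel[of z] by (auto simp: D_def field_simps)
  qed
  have "D holomorphic_on (?A \<union> ?B)" by (rule holomorphic_on_Un[OF hA hB oA oB])
  moreover have "?A \<union> ?B = UNIV" using sepa by auto
  ultimately have hD: "D holomorphic_on UNIV" by simp
  define K where "K = 96 * integral {0..1} (\<lambda>t. norm (p t)) + 96 * integral {0..1} (\<lambda>t. norm (q t))"
  note P0 = integral_norm_nonneg[OF p] integral_norm_nonneg[OF q]
  obtain N where N2: "N \<ge> 2" and N: "\<And>n (\<rho>::complex). \<lbrakk>n \<ge> N; sqrt 3 * norm \<rho> = 2 * pi * real n\<rbrakk> \<Longrightarrow> K \<le> norm \<rho> \<and> \<rho> \<noteq> 0"
    using norm_ge_on_large_circles[of K] by auto
  have D0: "D z = 0" for z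
  proof (rule entire_zero_if_small_on_circles[OF hD])
    \<comment> \<open>Here 96 is 4 times 24: \<open>b\<close> is at most
      \<open>4 / norm \<rho> ^ 2 * exp (mR \<rho>)\<close>, and \<open>a\<close> is at least
      \<open>exp (mR \<rho>) / 24\<close>.\<close>
    show "(\<lambda>n. 96 / (2 * pi * real n / sqrt 3) ^ 2) \<longlonglongrightarrow> 0" by real_asymp
    fix n and \<rho> :: complex assume n: "n \<ge> N" and rho: "sqrt 3 * norm \<rho> = 2 * pi * real n"
    have K: "K \<le> norm \<rho>" and r: "\<rho> \<noteq> 0" using N[OF n rho] by auto
    have low: "exp (mR \<rho>) / 24 \<le> norm (a (\<rho> ^ 3))"
      using al_lower[OF p, of 0 n \<rho>] n N2 rho K P0 by (simp add: K_def a_def)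
    have "norm (al p 2 (\<rho> ^ 3)) \<le> 2 / norm \<rho> ^ 2 * exp (mR \<rho>)" "norm (al q 2 (\<rho> ^ 3)) \<le> 2 / norm \<rho> ^ 2 * exp (mR \<rho>)"
      using cs_bound[OF p r, of 2 0 1] cs_bound[OF q r, of 2 0 1] K P0 unfolding al_def by (auto simp: K_def)
    then have "norm (b (\<rho> ^ 3)) \<le> 2 / norm \<rho> ^ 2 * exp (mR \<rho>) + 2 / norm \<rho> ^ 2 * exp (mR \<rho>)"
      unfolding b_def by (intro order_trans[OF norm_triangle_ineq4] add_mono)
    also have "\<dots> = 4 / norm \<rho> ^ 2 * exp (mR \<rho>)" by simp
    finally have nb: "norm (b (\<rho> ^ 3)) \<le> 4 / norm \<rho> ^ 2 * exp (mR \<rho>)" .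
    have "0 < exp (mR \<rho>) / 24" by simp
    then have na: "a (\<rho> ^ 3) \<noteq> 0" using low by auto
    then have "norm (D (\<rho> ^ 3)) = norm (b (\<rho> ^ 3)) / norm (a (\<rho> ^ 3))" by (simp add: D_def norm_divide)
    also have "\<dots> \<le> (4 / norm \<rho> ^ 2 * exp (mR \<rho>)) / (exp (mR \<rho>) / 24)"
      using low nb by (intro frac_le) auto
    also have "\<dots> = 96 / norm \<rho> ^ 2" by simp
    also have "norm \<rho> = 2 * pi * real n / sqrt 3" using rho by (simp add: field_simps)
    finally show "norm (D (\<rho> ^ 3)) \<le> 96 / (2 * pi * real n / sqrt 3) ^ 2" .
  qed
  have "b z = 0"
  proof (cases "a z = 0")
    case False
    then show ?thesis using D0[of z] by (simp add: D_def)
  next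
    case True
    then show ?thesis using rel[of z] sepa[of z] by simp
  qed
  then show ?thesis by (simp add: b_def)
qed

text \<open>\<open>mixed p q lam 0 j\<close> are, up to sign, the entries in the first row of the transformation matrix taking
  solutions for \<open>q\<close> to solutions for \<open>p\<close>; by skew-adjointness the inverse fundamental matrix is expressed
  through solutions at \<open>- lam\<close>.\<close>

definition mixed :: "(real \<Rightarrow> complex) \<Rightarrow> (real \<Rightarrow> complex) \<Rightarrow> complex \<Rightarrow> nat \<Rightarrow> nat \<Rightarrow> real \<Rightarrow> complex" where
  "mixed p q lam i j x = cs p lam 2 i x * cs q (- lam) 0 j x - cs p lam 1 i x * cs q (- lam) 1 j x
     + cs p lam 0 i x * cs q (- lam) 2 j x"

text \<open>The right-hand side is \<open>al p 0 lam\<close> times the second Weyl solution, which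
  vanishes at both ends. Its form as a minor of a solution normalised at 0 and one normalised at 1
  avoids the excessive growth of the two separate terms.\<close>

lemma cross_psi:
  assumes p: "L1 p" and jx: "j < 3" "x \<in> {0..1}"
  shows "cross (cs p (- lam) 0) (psi p (- lam)) j x = al p 0 lam * cs p lam 1 j x - al p 1 lam * cs p lam 0 j x"
proof -
  have "cs p (- (- lam)) 1 j x = cross (cs p (- lam) 0) (cs p (- lam) 2) j x"
    "cs p (- (- lam)) 0 j x = cross (cs p (- lam) 0) (cs p (- lam) 1) j x"
    by (rule cs_cross[OF p jx])+
  then have 1: "cs p lam 1 j x = cross (cs p (- lam) 0) (cs p (- lam) 2) j x"
    and 2: "cs p lam 0 j x = cross (cs p (- lam) 0) (cs p (- lam) 1) j x"
    unfolding minus_minus by auto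
  show ?thesis unfolding 1 2 by (simp add: cross_def psi_def algebra_simps)
qed

text \<open>Equal \<open>al\<close> means equal Weyl matrices, so the triangular changes from
  initial value solutions to Weyl solutions for \<open>p\<close> and \<open>q\<close> cancel in the
  sum. In each of the three products the growth from 0 and the growth from 1 combine to a rate
  independent of \<open>x\<close>, ready for comparison with \<open>al\<close>.\<close>

lemma mixed_eq:
  assumes p: "L1 p" and q: "L1 q"
    and al: "\<And>k z. k < 3 \<Longrightarrow> al q k z = al p k z" and jx: "j < 3" "x \<in> {0..1}"
  shows "al p 0 lam * al p 0 (- lam) * mixed p q lam 0 j x =
    al p 0 lam * psi p lam 0 x * cs q (- lam) 0 j x
    - cross (cs p (- lam) 0) (psi p (- lam)) 0 x * cross (cs q lam 0) (psi q lam) j x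
    + al p 0 (- lam) * cs p lam 0 0 x * psi q (- lam) j x"
proof -
  have X: "cross (cs q lam 0) (psi q lam) j x = al p 0 (- lam) * cs q (- lam) 1 j x - al p 1 (- lam) * cs q (- lam) 0 j x"
    using cross_psi[OF q jx, of "- lam"] unfolding minus_minus by (simp add: al)
  have X0: "cross (cs p (- lam) 0) (psi p (- lam)) 0 x = al p 0 lam * cs p lam 1 0 x - al p 1 lam * cs p lam 0 0 x"
    by (rule cross_psi[OF p _ jx(2)]) simp
  have Y: "psi q (- lam) j x = al p 0 lam * cs q (- lam) 2 j x - al p 1 lam * cs q (- lam) 1 j x + al p 2 lam * cs q (- lam) 0 j x"
    unfolding psi_def minus_minus by (simp add: al)
  \<comment> \<open>The surplus on the right is a multiple of the Pluecker combination, which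
    vanishes.\<close>
  have poly: "a0 * (b0 * c2 - b1 * c1 + b2 * c0) * d0 - (a0 * c1 - a1 * c0) * (b0 * d1 - b1 * d0)
      + b0 * c0 * (a0 * d2 - a1 * d1 + a2 * d0) =
      a0 * b0 * (c2 * d0 - c1 * d1 + c0 * d2) + (a2 * b0 + a0 * b2 - a1 * b1) * (c0 * d0)"
    for a0 a1 a2 b0 b1 b2 c0 c1 c2 d0 d1 d2 :: complex
    by (simp add: algebra_simps)
  have pl: "al p 2 lam * al p 0 (- lam) + al p 0 lam * al p 2 (- lam) - al p 1 lam * al p 1 (- lam) = 0"
    using al_plucker[OF p, of lam] by simp
  have "al p 0 lam * psi p lam 0 x * cs q (- lam) 0 j x
    - cross (cs p (- lam) 0) (psi p (- lam)) 0 x * cross (cs q lam 0) (psi q lam) j x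
    + al p 0 (- lam) * cs p lam 0 0 x * psi q (- lam) j x
    = al p 0 lam * al p 0 (- lam) * mixed p q lam 0 j x +
      (al p 2 lam * al p 0 (- lam) + al p 0 lam * al p 2 (- lam) - al p 1 lam * al p 1 (- lam)) * (cs p lam 0 0 x * cs q (- lam) 0 j x)"
    unfolding X X0 Y unfolding psi_def mixed_def by (rule poly)
  then show ?thesis unfolding pl by simp
qed

lemma psi_bound:
  assumes p: "L1 p" and "\<rho> \<noteq> 0"
    and large: "4 * integral {0..1} (\<lambda>t. norm (p (1 - t))) \<le> norm \<rho>"
    and j: "j < 3" and x: "x \<in> {0..1}"
  shows "norm (psi p (\<rho> ^ 3) j x) \<le> 2 * norm \<rho> ^ j / norm \<rho> ^ 2 * exp (mR (- \<rho>) * (1 - x))"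
proof -
  have "norm (psi p (\<rho> ^ 3) j x) = norm (cs (\<lambda>x. p (1 - x)) ((- \<rho>) ^ 3) 2 j (1 - x))"
    using psi_reflect[OF p j x, of "\<rho> ^ 3"] by (simp add: norm_mult norm_power)
  also have "\<dots> \<le> 2 * norm (- \<rho>) ^ j / norm (- \<rho>) ^ 2 * exp (mR (- \<rho>) * (1 - x))"
    by (rule cs_bound[OF absolutely_integrable_reflect_01[OF p]]) (use assms in auto)
  finally show ?thesis by simp
qed

lemma cross_psi_bound:
  assumes p: "L1 p" and r: "\<rho> \<noteq> 0"
    and large: "4 * integral {0..1} (\<lambda>t. norm (p t)) \<le> norm \<rho>" "4 * integral {0..1} (\<lambda>t. norm (p (1 - t))) \<le> norm \<rho>"
    and j: "j < 3" and x: "x \<in> {0..1}"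
  shows "norm (cross (cs p (\<rho> ^ 3) 0) (psi p (\<rho> ^ 3)) j x) \<le>
    8 * norm \<rho> ^ j / norm \<rho> * (exp (mR \<rho> * x) * exp (mR (- \<rho>) * (1 - x)))"
proof -
  define E where "E = exp (mR \<rho> * x) * exp (mR (- \<rho>) * (1 - x))"
  have r0: "norm \<rho> > 0" using r by simp
  \<comment> \<open>Every product in the minor of order \<open>j\<close> has orders adding up to
    \<open>j + 1\<close>, so all of them carry the same power of \<open>norm \<rho>\<close>.\<close>
  have pr: "norm (cs p (\<rho> ^ 3) 0 a x * psi p (\<rho> ^ 3) b x) \<le> 4 * norm \<rho> ^ j / norm \<rho> * E"
    if ab: "a < 3" "b < 3" "a + b = j + 1" for a b
  proof -
    have "norm (cs p (\<rho> ^ 3) 0 a x * psi p (\<rho> ^ 3) b x) \<le>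
        (2 * norm \<rho> ^ a / norm \<rho> ^ 0 * exp (mR \<rho> * x)) * (2 * norm \<rho> ^ b / norm \<rho> ^ 2 * exp (mR (- \<rho>) * (1 - x)))"
      unfolding norm_mult using ab
      by (intro mult_mono cs_bound[OF p r large(1)] psi_bound[OF p r large(2)] x) auto
    also have "\<dots> = 4 * (norm \<rho> ^ (a + b) / norm \<rho> ^ 2) * E"
      by (simp add: E_def power_add)
    also have "norm \<rho> ^ (a + b) / norm \<rho> ^ 2 = norm \<rho> ^ j / norm \<rho>"
      using r0 unfolding ab(3) by (simp add: power2_eq_square)
    finally show ?thesis by simp
  qed
  have "\<exists>a b. a < 3 \<and> b < 3 \<and> a + b = j + 1 \<and>
      cross (cs p (\<rho> ^ 3) 0) (psi p (\<rho> ^ 3)) j x = cs p (\<rho> ^ 3) 0 a x * psi p (\<rho> ^ 3) b x - cs p (\<rho> ^ 3) 0 b x * psi p (\<rho> ^ 3) a x"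
  proof -
    have "j = 0 \<or> j = 1 \<or> j = 2" using j by auto
    then show ?thesis
    proof (elim disjE)
      assume "j = 0"
      then show ?thesis by (intro exI[of _ 0] exI[of _ 1]) (auto simp: cross_def)
    next
      assume "j = 1"
      then show ?thesis by (intro exI[of _ 0] exI[of _ 2]) (auto simp: cross_def)
    next
      assume "j = 2"
      then show ?thesis by (intro exI[of _ 1] exI[of _ 2]) (auto simp: cross_def)
    qed
  qed
  then obtain a b where ab: "a < 3" "b < 3" "a + b = j + 1"
    and eq: "cross (cs p (\<rho> ^ 3) 0) (psi p (\<rho> ^ 3)) j x = cs p (\<rho> ^ 3) 0 a x * psi p (\<rho> ^ 3) b x - cs p (\<rho> ^ 3) 0 b x * psi p (\<rho> ^ 3) a x"
    by blast
  have "norm (cross (cs p (\<rho> ^ 3) 0) (psi p (\<rho> ^ 3)) j x) \<le> 4 * norm \<rho> ^ j / norm \<rho> * E + 4 * norm \<rho> ^ j / norm \<rho> * E"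
    unfolding eq using pr[OF ab] pr[of b a] ab
    by (intro order_trans[OF norm_triangle_ineq4] add_mono) auto
  then show ?thesis by (simp add: E_def)
qed

lemma mixed_holomorphic:
  assumes p: "L1 p" and q: "L1 q"
    and ij: "i < 3" "j < 3" and x: "x \<in> {0..1}"
  shows "(\<lambda>lam. mixed p q lam i j x) holomorphic_on UNIV"
  unfolding mixed_def
  by (intro holomorphic_on_add holomorphic_on_diff holomorphic_on_mult cs_holomorphic[OF p ij(1) x]
      holomorphic_minus_arg[OF cs_holomorphic[OF q ij(2) x]])

text \<open>The exponentials in the three products of \<open>mixed_eq\<close> are exchanged for
  \<open>al\<close> at \<open>lam\<close> and \<open>- lam\<close>, each at the price of a factor
  24. The constant is \<open>4 * 24 + 64 * 24 ^ 2 + 4 * 24\<close>.\<close>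

lemma mixed_bound:
  assumes p: "L1 p" and q: "L1 q"
    and al: "\<And>k z. k < 3 \<Longrightarrow> al q k z = al p k z" and j: "j < 3" and x: "x \<in> {0..1}"
    and n: "n \<ge> 2" and rho: "sqrt 3 * norm \<rho> = 2 * pi * real n" and r: "\<rho> \<noteq> 0"
    and large: "96 * integral {0..1} (\<lambda>t. norm (p t)) \<le> norm \<rho>" "96 * integral {0..1} (\<lambda>t. norm (q t)) \<le> norm \<rho>"
      "96 * integral {0..1} (\<lambda>t. norm (p (1 - t))) \<le> norm \<rho>" "96 * integral {0..1} (\<lambda>t. norm (q (1 - t))) \<le> norm \<rho>"
  shows "norm (mixed p q (\<rho> ^ 3) 0 j x) \<le> 37056 * (norm \<rho> ^ j / norm \<rho> ^ 2)"
proof -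
  define a b where "a = norm (al p 0 (\<rho> ^ 3))" and "b = norm (al p 0 ((- \<rho>) ^ 3))"
  define E F where "E = exp (mR \<rho>)" and "F = exp (mR (- \<rho>))"
  define s where "s = norm \<rho> ^ j / norm \<rho> ^ 2"
  have s0: "s \<ge> 0" by (simp add: s_def)
  have EF: "E > 0" "F > 0" by (auto simp: E_def F_def)
  have m3: "- (\<rho> ^ 3) = (- \<rho>) ^ 3" "\<rho> ^ 3 = - ((- \<rho>) ^ 3)" by simp_all
  have nr: "- \<rho> \<noteq> 0" "norm (- \<rho>) = norm \<rho>" "- (- \<rho>) = \<rho>" using r by auto
  note P0 = integral_norm_nonneg[OF p] integral_norm_nonneg[OF q]
    integral_norm_nonneg[OF absolutely_integrable_reflect_01[OF p]] integral_norm_nonneg[OF absolutely_integrable_reflect_01[OF q]]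
  have l4: "4 * integral {0..1} (\<lambda>t. norm (p t)) \<le> norm \<rho>" "4 * integral {0..1} (\<lambda>t. norm (q t)) \<le> norm \<rho>"
      "4 * integral {0..1} (\<lambda>t. norm (p (1 - t))) \<le> norm \<rho>" "4 * integral {0..1} (\<lambda>t. norm (q (1 - t))) \<le> norm \<rho>"
    using large P0 by linarith+
  have lowa: "E \<le> 24 * a" using al_lower[OF p _ n rho large(1), of 0] by (simp add: E_def a_def)
  have lowb: "F \<le> 24 * b"
    using al_lower[OF p _ n, of 0 "- \<rho>"] rho large(1) unfolding nr by (simp add: F_def b_def)
  have ab0: "a > 0" "b > 0" using lowa lowb EF by linarith+
  have expE: "exp (mR \<rho> * x) * exp (mR \<rho> * (1 - x)) = E" by (simp add: E_def mult_exp_exp algebra_simps)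
  have expF: "exp (mR (- \<rho>) * (1 - x)) * exp (mR (- \<rho>) * x) = F" by (simp add: F_def mult_exp_exp algebra_simps)
  have t1: "norm (psi p (\<rho> ^ 3) 0 x) * norm (cs q ((- \<rho>) ^ 3) 0 j x) \<le> 4 * s * F"
  proof -
    have "norm (psi p (\<rho> ^ 3) 0 x) * norm (cs q ((- \<rho>) ^ 3) 0 j x) \<le>
        (2 * norm \<rho> ^ 0 / norm \<rho> ^ 2 * exp (mR (- \<rho>) * (1 - x))) * (2 * norm (- \<rho>) ^ j / norm (- \<rho>) ^ 0 * exp (mR (- \<rho>) * x))"
      by (intro mult_mono psi_bound[OF p r l4(3)] cs_bound[OF q nr(1)] x j) (use l4 nr in auto)
    also have "\<dots> = 4 * s * (exp (mR (- \<rho>) * (1 - x)) * exp (mR (- \<rho>) * x))"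
      unfolding nr s_def by simp
    finally show ?thesis unfolding expF .
  qed
  have t3: "norm (cs p (\<rho> ^ 3) 0 0 x) * norm (psi q ((- \<rho>) ^ 3) j x) \<le> 4 * s * E"
  proof -
    have "norm (cs p (\<rho> ^ 3) 0 0 x) * norm (psi q ((- \<rho>) ^ 3) j x) \<le>
        (2 * norm \<rho> ^ 0 / norm \<rho> ^ 0 * exp (mR \<rho> * x)) * (2 * norm (- \<rho>) ^ j / norm (- \<rho>) ^ 2 * exp (mR (- (- \<rho>)) * (1 - x)))"
      by (intro mult_mono psi_bound[OF q nr(1)] cs_bound[OF p r l4(1)] x j) (use l4 nr in auto)
    also have "\<dots> = 4 * s * (exp (mR \<rho> * x) * exp (mR \<rho> * (1 - x)))"
      unfolding nr s_def by simp
    finally show ?thesis unfolding expE .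
  qed
  have t2: "norm (cross (cs p ((- \<rho>) ^ 3) 0) (psi p ((- \<rho>) ^ 3)) 0 x) * norm (cross (cs q (\<rho> ^ 3) 0) (psi q (\<rho> ^ 3)) j x) \<le> 64 * s * (E * F)"
  proof -
    have "norm (cross (cs p ((- \<rho>) ^ 3) 0) (psi p ((- \<rho>) ^ 3)) 0 x) * norm (cross (cs q (\<rho> ^ 3) 0) (psi q (\<rho> ^ 3)) j x) \<le>
        (8 * norm (- \<rho>) ^ 0 / norm (- \<rho>) * (exp (mR (- \<rho>) * x) * exp (mR (- (- \<rho>)) * (1 - x)))) *
        (8 * norm \<rho> ^ j / norm \<rho> * (exp (mR \<rho> * x) * exp (mR (- \<rho>) * (1 - x))))"
      by (intro mult_mono cross_psi_bound[OF p nr(1)] cross_psi_bound[OF q r] x j) (use l4 nr in auto)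
    also have "\<dots> = 64 * s * ((exp (mR \<rho> * x) * exp (mR \<rho> * (1 - x))) * (exp (mR (- \<rho>) * (1 - x)) * exp (mR (- \<rho>) * x)))"
      unfolding nr s_def power2_eq_square by simp
    finally show ?thesis unfolding expE expF .
  qed
  have "a * b * norm (mixed p q (\<rho> ^ 3) 0 j x) = norm (al p 0 (\<rho> ^ 3) * al p 0 (- (\<rho> ^ 3)) * mixed p q (\<rho> ^ 3) 0 j x)"
    unfolding m3(1) a_def b_def by (simp add: norm_mult)
  also have "\<dots> \<le> a * (norm (psi p (\<rho> ^ 3) 0 x) * norm (cs q ((- \<rho>) ^ 3) 0 j x))
      + norm (cross (cs p ((- \<rho>) ^ 3) 0) (psi p ((- \<rho>) ^ 3)) 0 x) * norm (cross (cs q (\<rho> ^ 3) 0) (psi q (\<rho> ^ 3)) j x)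
      + b * (norm (cs p (\<rho> ^ 3) 0 0 x) * norm (psi q ((- \<rho>) ^ 3) j x))"
  proof -
    have tri: "norm (A - B + C) \<le> norm A + norm B + norm C" for A B C :: complex
      using norm_triangle_ineq[of "A - B" C] norm_triangle_ineq4[of A B] by linarith
    have me: "al p 0 (\<rho> ^ 3) * al p 0 (- (\<rho> ^ 3)) * mixed p q (\<rho> ^ 3) 0 j x =
      al p 0 (\<rho> ^ 3) * psi p (\<rho> ^ 3) 0 x * cs q (- (\<rho> ^ 3)) 0 j x
      - cross (cs p (- (\<rho> ^ 3)) 0) (psi p (- (\<rho> ^ 3))) 0 x * cross (cs q (\<rho> ^ 3) 0) (psi q (\<rho> ^ 3)) j x
      + al p 0 (- (\<rho> ^ 3)) * cs p (\<rho> ^ 3) 0 0 x * psi q (- (\<rho> ^ 3)) j x"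
      by (rule mixed_eq[OF p q _ j x]) (rule al)
    show ?thesis
      unfolding me unfolding a_def b_def m3(1) by (rule order_trans[OF tri]) (simp add: norm_mult mult.assoc)
  qed
  also have "\<dots> \<le> a * (4 * s * F) + 64 * s * (E * F) + b * (4 * s * E)"
    using t1 t2 t3 ab0 by (intro add_mono mult_left_mono) auto
  also have "\<dots> \<le> a * (4 * s * (24 * b)) + 64 * s * ((24 * a) * (24 * b)) + b * (4 * s * (24 * a))"
    using lowa lowb ab0 s0 EF by (intro add_mono mult_left_mono mult_mono) auto
  also have "\<dots> = a * b * (37056 * s)" by simp
  finally have "a * b * norm (mixed p q (\<rho> ^ 3) 0 j x) \<le> a * b * (37056 * s)" .
  moreover have "a * b > 0" using ab0 by simp
  ultimately have "norm (mixed p q (\<rho> ^ 3) 0 j x) \<le> 37056 * s" by (simp only: mult_le_cancel_left_pos)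
  then show ?thesis by (simp only: s_def)
qed

text \<open>For \<open>j < 2\<close> the bound of order
  \<open>norm \<rho> ^ j / norm \<rho> ^ 2\<close> tends to 0 on the circles; for
  \<open>j = 2\<close> it would give boundedness only.\<close>

lemma mixed_zero:
  assumes p: "L1 p" and q: "L1 q"
    and al: "\<And>k z. k < 3 \<Longrightarrow> al q k z = al p k z" and j: "j < 2" and x: "x \<in> {0..1}"
  shows "mixed p q lam 0 j x = 0"
proof -
  define K where "K = 96 * (integral {0..1} (\<lambda>t. norm (p t)) + integral {0..1} (\<lambda>t. norm (q t))
    + integral {0..1} (\<lambda>t. norm (p (1 - t))) + integral {0..1} (\<lambda>t. norm (q (1 - t))))"
  note P0 = integral_norm_nonneg[OF p] integral_norm_nonneg[OF q]
    integral_norm_nonneg[OF absolutely_integrable_reflect_01[OF p]] integral_norm_nonneg[OF absolutely_integrable_reflect_01[OF q]]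
  obtain N where N2: "N \<ge> 2" and N: "\<And>n (\<rho>::complex). \<lbrakk>n \<ge> N; sqrt 3 * norm \<rho> = 2 * pi * real n\<rbrakk> \<Longrightarrow> K \<le> norm \<rho> \<and> \<rho> \<noteq> 0"
    using norm_ge_on_large_circles[of K] by auto
  show ?thesis
  proof (rule entire_zero_if_small_on_circles[where f = "\<lambda>lam. mixed p q lam 0 j x" and N = N])
    show "(\<lambda>lam. mixed p q lam 0 j x) holomorphic_on UNIV"
      using j x by (intro mixed_holomorphic p q) auto
    have "j = 0 \<or> j = 1" using j by auto
    then show "(\<lambda>n. 37056 * ((2 * pi * real n / sqrt 3) ^ j / (2 * pi * real n / sqrt 3) ^ 2)) \<longlonglongrightarrow> 0"
    proof
      assume j: "j = 0"
      show ?thesis unfolding j by real_asymp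
    next
      assume j: "j = 1"
      show ?thesis unfolding j by real_asymp
    qed
    fix n and \<rho> :: complex assume n: "n \<ge> N" and rho: "sqrt 3 * norm \<rho> = 2 * pi * real n"
    have K: "K \<le> norm \<rho>" and r: "\<rho> \<noteq> 0" using N[OF n rho] by auto
    have eq: "2 * pi * real n / sqrt 3 = norm \<rho>" using rho by (simp add: field_simps)
    show "norm (mixed p q (\<rho> ^ 3) 0 j x) \<le> 37056 * ((2 * pi * real n / sqrt 3) ^ j / (2 * pi * real n / sqrt 3) ^ 2)"
      unfolding eq
    proof (rule mixed_bound[OF p q _ _ x _ rho r])
      show "al q k z = al p k z" if "k < 3" for k z by (rule al[OF that])
      show "n \<ge> 2" "j < 3" using n N2 j by auto
    qed (use K P0 in \<open>auto simp: K_def\<close>)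
  qed
qed

section \<open>Differentiating the transformation at \<open>lam = 0\<close>\<close>

lemma ac_deriv_skew_sum:
  assumes "ac_deriv u0 u0'" "ac_deriv u1 u1'" "ac_deriv u2 u2'" "ac_deriv v0 v0'" "ac_deriv v1 v1'" "ac_deriv v2 v2'"
  shows "ac_deriv (\<lambda>x. u2 x * v0 x - u1 x * v1 x + u0 x * v2 x)
    (\<lambda>x. (u2 x * v0' x + u2' x * v0 x) - (u1 x * v1' x + u1' x * v1 x) + (u0 x * v2' x + u0' x * v2 x))"
  using assms by (intro ac_deriv_add ac_deriv_diff ac_deriv_mult)

text \<open>By the product rule, differentiation raises either index by one, with corrections from
  \<open>p\<close> on the left index and from \<open>q\<close> on the right. At
  \<open>lam = 0\<close> the spectral terms drop out of both equations.\<close>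

lemma ac_deriv_mixed:
  assumes p: "L1 p" and q: "L1 q"
  defines "T \<equiv> mixed p q 0"
  shows "ac_deriv (T 0 0) (\<lambda>x. T 0 1 x + T 1 0 x)"
    and "ac_deriv (T 0 1) (\<lambda>x. T 0 2 x - q x * T 0 0 x + T 1 1 x)"
    and "ac_deriv (T 0 2) (\<lambda>x. - q x * T 0 1 x + T 1 2 x)"
    and "ac_deriv (T 1 0) (\<lambda>x. T 1 1 x + T 2 0 x - p x * T 0 0 x)"
    and "ac_deriv (T 1 1) (\<lambda>x. T 1 2 x - q x * T 1 0 x + T 2 1 x - p x * T 0 1 x)"
    and "ac_deriv (T 1 2) (\<lambda>x. - q x * T 1 1 x + T 2 2 x - p x * T 0 2 x)"
    and "ac_deriv (T 2 0) (\<lambda>x. T 2 1 x - p x * T 1 0 x)"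
    and "ac_deriv (T 2 1) (\<lambda>x. T 2 2 x - q x * T 2 0 x - p x * T 1 1 x)"
proof -
  have c: "\<And>k. ac_deriv (cs p 0 k 0) (cs p 0 k 1)" "\<And>k. ac_deriv (cs p 0 k 1) (\<lambda>t. cs p 0 k 2 t - p t * cs p 0 k 0 t)"
    "\<And>k. ac_deriv (cs p 0 k 2) (\<lambda>t. 0 * cs p 0 k 0 t - p t * cs p 0 k 1 t)"
    using cs_sol[OF p, of 0] unfolding sol_iff by blast+
  have d: "\<And>k. ac_deriv (cs q (- 0) k 0) (cs q (- 0) k 1)" "\<And>k. ac_deriv (cs q (- 0) k 1) (\<lambda>t. cs q (- 0) k 2 t - q t * cs q (- 0) k 0 t)"
    "\<And>k. ac_deriv (cs q (- 0) k 2) (\<lambda>t. - 0 * cs q (- 0) k 0 t - q t * cs q (- 0) k 1 t)"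
    using cs_sol[OF q, of "- 0"] unfolding sol_iff minus_zero by blast+
  show "ac_deriv (T 0 0) (\<lambda>x. T 0 1 x + T 1 0 x)"
    unfolding T_def mixed_def
    by (rule ac_deriv_cong[OF ac_deriv_skew_sum[OF c(1)[of 0] c(1)[of 1] c(1)[of 2] d(1)[of 0] d(1)[of 1] d(1)[of 2]]]) (auto simp: algebra_simps)
  show "ac_deriv (T 0 1) (\<lambda>x. T 0 2 x - q x * T 0 0 x + T 1 1 x)"
    unfolding T_def mixed_def
    by (rule ac_deriv_cong[OF ac_deriv_skew_sum[OF c(1)[of 0] c(1)[of 1] c(1)[of 2] d(2)[of 0] d(2)[of 1] d(2)[of 2]]]) (auto simp: algebra_simps)
  show "ac_deriv (T 0 2) (\<lambda>x. - q x * T 0 1 x + T 1 2 x)"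
    unfolding T_def mixed_def
    by (rule ac_deriv_cong[OF ac_deriv_skew_sum[OF c(1)[of 0] c(1)[of 1] c(1)[of 2] d(3)[of 0] d(3)[of 1] d(3)[of 2]]]) (auto simp: algebra_simps)
  show "ac_deriv (T 1 0) (\<lambda>x. T 1 1 x + T 2 0 x - p x * T 0 0 x)"
    unfolding T_def mixed_def
    by (rule ac_deriv_cong[OF ac_deriv_skew_sum[OF c(2)[of 0] c(2)[of 1] c(2)[of 2] d(1)[of 0] d(1)[of 1] d(1)[of 2]]]) (auto simp: algebra_simps)
  show "ac_deriv (T 1 1) (\<lambda>x. T 1 2 x - q x * T 1 0 x + T 2 1 x - p x * T 0 1 x)"
    unfolding T_def mixed_def
    by (rule ac_deriv_cong[OF ac_deriv_skew_sum[OF c(2)[of 0] c(2)[of 1] c(2)[of 2] d(2)[of 0] d(2)[of 1] d(2)[of 2]]]) (auto simp: algebra_simps)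
  show "ac_deriv (T 1 2) (\<lambda>x. - q x * T 1 1 x + T 2 2 x - p x * T 0 2 x)"
    unfolding T_def mixed_def
    by (rule ac_deriv_cong[OF ac_deriv_skew_sum[OF c(2)[of 0] c(2)[of 1] c(2)[of 2] d(3)[of 0] d(3)[of 1] d(3)[of 2]]]) (auto simp: algebra_simps)
  show "ac_deriv (T 2 0) (\<lambda>x. T 2 1 x - p x * T 1 0 x)"
    unfolding T_def mixed_def
    by (rule ac_deriv_cong[OF ac_deriv_skew_sum[OF c(3)[of 0] c(3)[of 1] c(3)[of 2] d(1)[of 0] d(1)[of 1] d(1)[of 2]]]) (auto simp: algebra_simps)
  show "ac_deriv (T 2 1) (\<lambda>x. T 2 2 x - q x * T 2 0 x - p x * T 1 1 x)"
    unfolding T_def mixed_def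
    by (rule ac_deriv_cong[OF ac_deriv_skew_sum[OF c(3)[of 0] c(3)[of 1] c(3)[of 2] d(2)[of 0] d(2)[of 1] d(2)[of 2]]]) (auto simp: algebra_simps)
qed

text \<open>Repeated differentiation of the two vanishing entries determines all entries except
  \<open>T 2 2\<close>. The last derivatives give two equations for \<open>T 2 2\<close> and
  \<open>p - q\<close>, and eliminating \<open>T 2 2\<close> leaves \<open>p = q\<close>.\<close>

lemma mixed_zero_imp_eq_ae:
  assumes p: "L1 p" and q: "L1 q"
    and T00: "\<And>x. x \<in> {0..1} \<Longrightarrow> mixed p q 0 0 0 x = 0" and T01: "\<And>x. x \<in> {0..1} \<Longrightarrow> mixed p q 0 0 1 x = 0"
  shows "AE x in lebesgue_on {0<..<1}. p x = q x"
proof -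
  define T where "T = mixed p q 0"
  note D = ac_deriv_mixed[OF p q, folded T_def]
  have Tc: "continuous_on {0..1} (T i j)" if "i < 3" "j < 3" for i j
    unfolding T_def mixed_def using that
    by (intro continuous_intros sol_continuous_on[OF cs_sol[OF p]] sol_continuous_on[OF cs_sol[OF q]]) auto
  have z0: "T 0 0 x = 0" "T 0 1 x = 0" if "x \<in> {0..1}" for x
    using T00 T01 that by (auto simp: T_def)
  have T10: "T 1 0 x = 0" if x: "x \<in> {0..1}" for x
  proof -
    have "T 0 1 x + T 1 0 x = 0"
      by (rule ac_deriv_zero_continuous[OF D(1) z0(1) _ x]) (assumption, (intro continuous_intros Tc; simp))
    then show ?thesis using z0(2)[OF x] by simp
  qed
  have T02: "T 0 2 x + T 1 1 x = 0" if x: "x \<in> {0..1}" for x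
  proof (rule ac_deriv_zero_continuous[OF _ z0(2) _ x])
    show "ac_deriv (T 0 1) (\<lambda>x. T 0 2 x + T 1 1 x)"
      by (rule ac_deriv_cong[OF D(2)]) (auto simp: z0 simp del: One_nat_def)
  qed (assumption, (intro continuous_intros Tc; simp))
  have T20: "T 1 1 x + T 2 0 x = 0" if x: "x \<in> {0..1}" for x
  proof (rule ac_deriv_zero_continuous[OF _ T10 _ x])
    show "ac_deriv (T 1 0) (\<lambda>x. T 1 1 x + T 2 0 x)"
      by (rule ac_deriv_cong[OF D(4)]) (auto simp: z0 simp del: One_nat_def)
  qed (assumption, (intro continuous_intros Tc; simp))
  have D11: "ac_deriv (T 1 1) (\<lambda>x. T 1 2 x + T 2 1 x)"
    by (rule ac_deriv_cong[OF D(5)]) (auto simp: z0 T10 simp del: One_nat_def)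
  have D02: "ac_deriv (T 0 2) (T 1 2)"
    by (rule ac_deriv_cong[OF D(3)]) (auto simp: z0 simp del: One_nat_def)
  have D20: "ac_deriv (T 2 0) (T 2 1)"
    by (rule ac_deriv_cong[OF D(7)]) (auto simp: T10 simp del: One_nat_def)
  \<comment> \<open>Derivatives of the relations \<open>T02\<close> and \<open>T20\<close>. They
    form a nonsingular linear system for \<open>T 1 2\<close> and \<open>T 2 1\<close>, so both
    entries vanish.\<close>
  have e1: "T 1 2 x + (T 1 2 x + T 2 1 x) = 0" if x: "x \<in> {0..1}" for x
    by (rule ac_deriv_zero_continuous[OF ac_deriv_add[OF D02 D11] T02 _ x]) (assumption, (intro continuous_intros Tc; simp))
  have e2: "(T 1 2 x + T 2 1 x) + T 2 1 x = 0" if x: "x \<in> {0..1}" for x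
    by (rule ac_deriv_zero_continuous[OF ac_deriv_add[OF D11 D20] T20 _ x]) (assumption, (intro continuous_intros Tc; simp))
  have T12: "T 1 2 x = 0" and T21: "T 2 1 x = 0" if x: "x \<in> {0..1}" for x
  proof -
    have "T 1 2 x = T 2 1 x" using e1[OF x] e2[OF x] by (simp add: add_eq_0_iff)
    then show "T 1 2 x = 0" "T 2 1 x = 0" using e1[OF x] by auto
  qed
  \<comment> \<open>The entry is constant; its value at 0 is the middle term of the alternating sum,
    hence the minus sign.\<close>
  have T11: "T 1 1 x = - 1" if x: "x \<in> {0..1}" for x
  proof -
    have "ac_deriv (T 1 1) (\<lambda>x. 0)" by (rule ac_deriv_cong[OF D11]) (auto simp: T12 T21 simp del: One_nat_def)
    from ac_deriv_zero_const[OF this x] show ?thesis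
      by (simp add: T_def mixed_def cs_0[OF p] cs_0[OF q])
  qed
  \<comment> \<open>From here on the derivatives contain \<open>p\<close> and \<open>q\<close>
    explicitly, so their vanishing holds only almost everywhere.\<close>
  obtain N where N: "negligible N" "\<And>x. x \<in> {0<..<1} - N \<Longrightarrow> - q x * T 1 1 x + T 2 2 x - p x * T 0 2 x = 0"
    by (rule ac_deriv_zero_ae[OF D(6) T12]) (assumption, rule that)
  obtain M where M: "negligible M" "\<And>x. x \<in> {0<..<1} - M \<Longrightarrow> T 2 2 x - q x * T 2 0 x - p x * T 1 1 x = 0"
    by (rule ac_deriv_zero_ae[OF D(8) T21]) (assumption, rule that)
  have "p x = q x" if x: "x \<in> {0<..<1} - (N \<union> M)" for x
  proof -
    have x1: "x \<in> {0..1}" using x by auto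
    have t: "T 1 1 x = - 1" "T 0 2 x = 1" "T 2 0 x = 1"
      using T11[OF x1] T02[OF x1] T20[OF x1] by (auto simp: add_eq_0_iff)
    have "q x + T 2 2 x - p x = 0" "T 2 2 x - q x + p x = 0"
      using N(2)[of x] M(2)[of x] x unfolding t by auto
    moreover have "2 * p x - 2 * q x = (T 2 2 x - q x + p x) - (q x + T 2 2 x - p x)" by simp
    ultimately have "2 * p x = 2 * q x" by simp
    then show ?thesis by simp
  qed
  moreover have "negligible (N \<union> M)" using N M by (intro negligible_Un)
  ultimately have "\<exists>N. negligible N \<and> (\<forall>x\<in>{0<..<1} - N. p x = q x)" by blast
  moreover have "{0<..<1::real} \<in> sets lebesgue" by simp
  ultimately show ?thesis by (simp only: AE_lebesgue_on_iff_negligible)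
qed

theorem theorem2p1:
  fixes p q :: "real \<Rightarrow> complex"
  assumes "p absolutely_integrable_on {0..1}"
      and "q absolutely_integrable_on {0..1}"
      and "separation 3 (F3 p)"
      and "separation 3 (F3 q)"
      and "spectrum_mult 3 (F3 p) (bc3 1) = spectrum_mult 3 (F3 q) (bc3 1)"
      and "spectrum_mult 3 (F3 p) (bc3 2) = spectrum_mult 3 (F3 q) (bc3 2)"
  shows "AE x in lebesgue_on {0<..<1}. p x = q x"
proof -
  note p = assms(1) and q = assms(2)
  \<comment> \<open>The factors 1 and \<open>- 1\<close> bring both determinants into the shape
    expected by \<open>al_eq_if_zero_mult_eq\<close>.\<close>
  have cd: "char_det 3 (F3 p) (bc3 1) = (\<lambda>z. 1 * al p 0 (- z))" "char_det 3 (F3 p) (bc3 2) = (\<lambda>z. (- 1) * al p 1 (- z))"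
    if "p absolutely_integrable_on {0..1}" for p
    using char_det_bc3_1[OF that] char_det_bc3_2[OF that] by (auto simp: fun_eq_iff)
  have a0: "al p 0 z = al q 0 z" for z
    using assms(5) unfolding spectrum_mult_def cd(1)[OF p] cd(1)[OF q]
    by (intro al_eq_if_zero_mult_eq[OF p q, of 0 1]) auto
  have a1: "al p 1 z = al q 1 z" for z
    using assms(6) unfolding spectrum_mult_def cd(2)[OF p] cd(2)[OF q]
    by (intro al_eq_if_zero_mult_eq[OF p q, of 1 "- 1"]) auto
  have a2: "al p 2 z = al q 2 z" for z
    by (rule al2_eq[OF p q assms(3) a0 a1])
  have al: "al q k z = al p k z" if "k < 3" for k z
  proof -
    have "k = 0 \<or> k = 1 \<or> k = 2" using that by auto
    then show ?thesis using a0 a1 a2 by auto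
  qed
  show ?thesis
    by (rule mixed_zero_imp_eq_ae[OF p q]) (auto intro!: mixed_zero[OF p q al])
qed

end
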